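(* Let $p$ be a prime, $q$ a power of $p$, and $n\ge1$ an integer. For every $\xi\in\mathbb{F}_q((T^{-1}))$ which is not algebraic of degree at most $n$, we have $$w_n^*(\xi)\ \ge\ \widehat{w}_n^@(\xi)\ \ge\ \frac{w_n(\xi)}{w_n(\xi)-n+1}\qquad\text{and}\qquad w_n^*(\xi)\ \ge\ \frac{\widehat{w}_n(\xi)}{\widehat{w}_n(\xi)-n+1}.$$
   Context: $\mathbb{F}_q$ is the field with $q$ elements. For a nonzero $\xi=\sum_{k\ge N} a_k T^{-k}\in\mathbb{F}_q((T^{-1}))$ with $a_N\neq 0$, set $|\xi|=q^{-N}$, and $|0|=0$. $C_\infty$ denotes the completion of an algebraic closure of $\mathbb{F}_q((T^{-1}))$, with the extended absolute value. The height $H(P)$ of $P\in\mathbb{F}_q[T][X]$ is the maximum of the absolute values of its coefficients. An element of $C_\infty$ is algebraic if it is a root of a nonzero polynomial in $\mathbb{F}_q[T][X]$; its degree and height $H(\alpha)$ are those of its minimal defining polynomial over $\mathbb{F}_q[T]$. $w_n(\xi)$ is the supremum of the real $w$ such that $0<|P(\xi)|<H(P)^{-w}$ has infinitely many solutions $P\in\mathbb{F}_q[T][X]$ of degree at most $n$. $w_n^*(\xi)$ is the supremum of the real $w^*$ such that $0<|\xi-\alpha|<H(\alpha)^{-w^*-1}$ has infinitely many solutions in algebraic $\alpha\in\mathbb{F}_q((T^{-1}))$ of degree at most $n$. $\widehat{w}_n(\xi)$ is the supremum of the real $\widehat w$ for which there is $H_0$ such that for every $H>H_0$ there is $P\in\mathbb{F}_q[T][X]$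 of degree at most $n$ and height at most $H$ with $0<|P(\xi)|<H^{-\widehat w}$. $\widehat{w}_n^@(\xi)$ is the supremum of the real $\widehat w^@$ for which there is $H_0$ such that for every $H>H_0$ there is an algebraic $\alpha\in C_\infty$ of degree at most $n$ and height at most $H$ with $0<|\xi-\alpha|<H(\alpha)^{-1}H^{-\widehat w^@}$. *)

theory Defs
  imports
    "HOL-Algebra.Algebraic_Closure_Type"
    "HOL-Computational_Algebra.Computational_Algebra"
    "HOL-Library.Extended_Real"
    "HOL-Analysis.Abstract_Metric_Spaces"
begin

text \<open>
  The field with \<open>q\<close> elements is a finite field type \<open>'a\<close> with \<open>CARD('a) = q\<close>.
  The field of Laurent series in \<open>T\<^sup>-\<^sup>1\<close> over it is \<open>'a fls\<close>, whose variable \<^term>\<open>fls_X\<close> plays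
  the role of \<open>T\<^sup>-\<^sup>1\<close>; thus \<open>T\<close> is \<^term>\<open>fls_X_inv\<close>, and the \<open>N\<close> in
  \<open>\<xi> = (\<Sum>k\<ge>N. a\<^sub>k T\<^sup>-\<^sup>k)\<close>, \<open>a\<^sub>N \<noteq> 0\<close>, is \<^term>\<open>fls_subdegree \<xi>\<close>.
  Polynomials in \<open>X\<close> with coefficients in the polynomials in \<open>T\<close> have type \<open>'a poly poly\<close>.
\<close>

definition laurent_abs :: "'a::{field,finite} fls \<Rightarrow> real" where
  "laurent_abs \<xi> = (if \<xi> = 0 then 0 else real CARD('a) powi (- fls_subdegree \<xi>))"

definition poly_T :: "'a::{field,finite} poly \<Rightarrow> 'a fls" where
  "poly_T c = poly (map_poly fls_const c) fls_X_inv"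

definition height :: "'a::{field,finite} poly poly \<Rightarrow> real" where
  "height P = Max ((\<lambda>i. laurent_abs (poly_T (coeff P i))) ` {..degree P})"

definition eval_over :: "('a::{field,finite} poly \<Rightarrow> 'k::field) \<Rightarrow> 'a poly poly \<Rightarrow> 'k \<Rightarrow> 'k" where
  "eval_over e P x = poly (map_poly e P) x"

text \<open>
  In the following notions, \<open>e\<close> is the embedding of the polynomials in \<open>T\<close> into the field in which
  the element \<open>\<alpha>\<close> lives.
\<close>

definition algebraic_over :: "('a::{field,finite} poly \<Rightarrow> 'k::field) \<Rightarrow> 'k \<Rightarrow> bool" where
  "algebraic_over e \<alpha> \<longleftrightarrow> (\<exists>P. P \<noteq> 0 \<and> eval_over e P \<alpha> = 0)"

text \<open>
  A minimal defining polynomial is an annihilating polynomial of least degree with coprime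
  coefficients. This determines it up to a nonzero constant from the finite field; the last
  condition (the leading coefficient is a monic polynomial in \<open>T\<close>) only serves to fix that constant
  and influences neither degree nor height.
\<close>

definition is_min_poly_over ::
    "('a::{field,finite} poly \<Rightarrow> 'k::field) \<Rightarrow> 'k \<Rightarrow> 'a poly poly \<Rightarrow> bool" where
  "is_min_poly_over e \<alpha> P \<longleftrightarrow>
     P \<noteq> 0 \<and> eval_over e P \<alpha> = 0 \<and>
     (\<forall>Q. Q \<noteq> 0 \<and> eval_over e Q \<alpha> = 0 \<longrightarrow> degree P \<le> degree Q) \<and>
     (\<forall>c. (\<forall>i. c dvd coeff P i) \<longrightarrow> is_unit c) \<and>
     lead_coeff (lead_coeff P) = 1"

definition min_poly_over :: "('a::{field,finite} poly \<Rightarrow> 'k::field) \<Rightarrow> 'k \<Rightarrow> 'a poly poly" where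
  "min_poly_over e \<alpha> = (THE P. is_min_poly_over e \<alpha> P)"

definition alg_height :: "('a::{field,finite} poly \<Rightarrow> 'k::field) \<Rightarrow> 'k \<Rightarrow> real" where
  "alg_height e \<alpha> = height (min_poly_over e \<alpha>)"

definition algebraic_deg_le :: "('a::{field,finite} poly \<Rightarrow> 'k::field) \<Rightarrow> nat \<Rightarrow> 'k \<Rightarrow> bool" where
  "algebraic_deg_le e n \<alpha> \<longleftrightarrow> algebraic_over e \<alpha> \<and> degree (min_poly_over e \<alpha>) \<le> n"

text \<open>
  The completion \<open>C\<^sub>\<infinity>\<close> of an algebraic closure of the Laurent series field, with the extended
  absolute value. It is characterised as a complete valued field with an absolute value that
  extends \<^const>\<open>laurent_abs\<close>, together with an embedding of the algebraic closure that has dense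
  image; as the extension of the absolute value to the algebraic closure is unique, this determines
  \<open>C\<^sub>\<infinity>\<close> up to isometric isomorphism.
\<close>

locale completed_alg_closure =
  fixes emb :: "'a::{field,finite} fls alg_closure \<Rightarrow> 'c::field"
    and absC :: "'c \<Rightarrow> real"
  assumes emb_1: "emb 1 = 1"
    and emb_add: "emb (x + y) = emb x + emb y"
    and emb_mult: "emb (x * y) = emb x * emb y"
    and absC_nonneg: "absC z \<ge> 0"
    and absC_eq_0_iff: "absC z = 0 \<longleftrightarrow> z = 0"
    and absC_mult: "absC (z * w) = absC z * absC w"
    and absC_add_le_max: "absC (z + w) \<le> max (absC z) (absC w)"
    and absC_extends: "absC (emb (to_ac \<xi>)) = laurent_abs \<xi>"
    and dense: "\<epsilon> > 0 \<Longrightarrow> \<exists>x. absC (z - emb x) < \<epsilon>"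
    and complete: "Metric_space.mcomplete UNIV (\<lambda>z w. absC (z - w))"

text \<open>
  All exponents are suprema of sets of real numbers, taken in the extended reals since they may be
  infinite.
\<close>

definition w_exp :: "nat \<Rightarrow> 'a::{field,finite} fls \<Rightarrow> ereal" where
  "w_exp n \<xi> = Sup (ereal ` {w.
     infinite {P. degree P \<le> n \<and>
       0 < laurent_abs (eval_over poly_T P \<xi>) \<and>
       laurent_abs (eval_over poly_T P \<xi>) < height P powr (- w)}})"

definition w_star_exp :: "nat \<Rightarrow> 'a::{field,finite} fls \<Rightarrow> ereal" where
  "w_star_exp n \<xi> = Sup (ereal ` {w.
     infinite {\<alpha>. algebraic_deg_le poly_T n \<alpha> \<and>
       0 < laurent_abs (\<xi> - \<alpha>) \<and>
       laurent_abs (\<xi> - \<alpha>) < alg_height poly_T \<alpha> powr (- w - 1)}})"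

definition w_hat_exp :: "nat \<Rightarrow> 'a::{field,finite} fls \<Rightarrow> ereal" where
  "w_hat_exp n \<xi> = Sup (ereal ` {w.
     \<exists>H0::real. \<forall>H>H0. \<exists>P. degree P \<le> n \<and> height P \<le> H \<and>
       0 < laurent_abs (eval_over poly_T P \<xi>) \<and>
       laurent_abs (eval_over poly_T P \<xi>) < H powr (- w)})"

definition w_hat_at_exp ::
    "('a::{field,finite} fls alg_closure \<Rightarrow> 'c::field) \<Rightarrow> ('c \<Rightarrow> real) \<Rightarrow> nat \<Rightarrow> 'a fls \<Rightarrow> ereal" where
  "w_hat_at_exp emb absC n \<xi> = Sup (ereal ` {w.
     \<exists>H0::real. \<forall>H>H0. \<exists>\<alpha>. algebraic_deg_le (\<lambda>c. emb (to_ac (poly_T c))) n \<alpha> \<and>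
       alg_height (\<lambda>c. emb (to_ac (poly_T c))) \<alpha> \<le> H \<and>
       0 < absC (emb (to_ac \<xi>) - \<alpha>) \<and>
       absC (emb (to_ac \<xi>) - \<alpha>)
         < inverse (alg_height (\<lambda>c. emb (to_ac (poly_T c))) \<alpha>) * H powr (- w)})"

text \<open>
  The quotient \<open>w / (w - n + 1)\<close>, read as its limit 1 at \<open>w = \<infinity>\<close> (where the division of the
  extended reals would yield 0).
\<close>

definition exp_quotient :: "nat \<Rightarrow> ereal \<Rightarrow> ereal" where
  "exp_quotient n w = (if w = \<infinity> then 1 else w / (w - ereal (real n) + 1))"

end

theory Submission
  imports Defs
begin

text \<open>
  For the two lower bounds let \<open>w\<close> exceed \<open>w\<^sub>n(\<xi>)\<close> (or the uniform exponent). The box principle yields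
  \<open>P\<close> of degree at most \<open>n\<close> with \<open>|P(\<xi>)| \<le> H\<^bsup>-w\<^esup>\<close>, \<open>|P'(\<xi>)| \<le> H\<^bsup>w-n+1\<^esup>\<close> and all higher Hasse derivatives at
  \<open>\<xi>\<close> bounded by \<open>H\<close>. If \<open>P'(\<xi>)\<close> were at most \<open>H\<close>, then \<open>P\<close> would have height about \<open>H\<close> and
  \<open>P(\<xi>)\<close> would be too small for the choice of \<open>w\<close>. Hence \<open>P'(\<xi>)\<close> dominates, and Hensel's lemma gives a
  root \<open>\<alpha>\<close> of \<open>P\<close> in the Laurent series field with \<open>|\<xi> - \<alpha>| = |P(\<xi>)| / |P'(\<xi>)|\<close>, where
  \<open>|P'(\<xi>)|\<close> is comparable to \<open>H(P)\<close>.

  For \<open>w\<^sub>n\<^sup>*(\<xi>) \<ge> \<close> the uniform exponent with approximations from \<open>C\<^sub>\<infinity>\<close>, one turns an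
  \<open>\<alpha>\<close> from \<open>C\<^sub>\<infinity>\<close> at distance \<open>\<rho>\<close> from \<open>\<xi>\<close> into an approximation from the Laurent series field of the
  same quality. Let \<open>k\<close> be the index of the term of the Taylor expansion at \<open>\<xi>\<close> of the minimal
  polynomial of \<open>\<alpha>\<close> that dominates at radius \<open>\<rho>\<close>. If \<open>k = 1\<close>, Hensel's lemma applies. If
  \<open>1 < k < p\<close>, the derivative again has a root within distance \<open>\<rho>\<close>. If \<open>k \<ge> p\<close>, write
  \<open>P = \<Sum> X\<^sup>r T\<^sup>j R\<^sub>r\<^sub>j\<^sup>p\<close> with \<open>r, j < p\<close>; some \<open>R\<^sub>r\<^sub>j\<close>, whose height is at most \<open>H(P)\<^bsup>1/p\<^esup>\<close>, has a root within
  distance about \<open>\<rho>\<^bsup>1/p\<^esup>\<close>.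
\<close>

section \<open>The absolute value\<close>

lemma card_field_gt_1: "real CARD('a::{field,finite}) > 1"
proof -
  have "card {0, 1 :: 'a} \<le> CARD('a)"
    by (rule card_mono) auto
  then show ?thesis by simp
qed

lemma powi_card_le_iff:
  "real CARD('a::{field,finite}) powi a \<le> real CARD('a) powi b \<longleftrightarrow> a \<le> b"
  using card_field_gt_1[where 'a='a] power_int_strict_increasing[of b a "real CARD('a)"]
    power_int_increasing[of a b "real CARD('a)"] by force

lemma laurent_abs_0 [simp]: "laurent_abs 0 = 0"
  by (simp add: laurent_abs_def)

lemma laurent_abs_eq_0_iff [simp]: "laurent_abs x = 0 \<longleftrightarrow> x = 0"
  using card_field_gt_1[where 'a='a] by (auto simp: laurent_abs_def)

lemma laurent_abs_nonneg [simp]: "laurent_abs x \<ge> 0"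
  by (simp add: laurent_abs_def)

lemma laurent_abs_pos_iff [simp]: "laurent_abs x > 0 \<longleftrightarrow> x \<noteq> 0"
  by (metis laurent_abs_eq_0_iff laurent_abs_nonneg less_eq_real_def less_irrefl)

lemma laurent_abs_mult: "laurent_abs (x * y) = laurent_abs x * laurent_abs y"
  using card_field_gt_1[where 'a='a] by (auto simp: laurent_abs_def simp flip: power_int_add)

lemma laurent_abs_1 [simp]: "laurent_abs 1 = 1"
  by (simp add: laurent_abs_def)

lemma laurent_abs_power: "laurent_abs (x ^ n) = laurent_abs x ^ n"
  by (induction n) (simp_all add: laurent_abs_mult)

lemma laurent_abs_inverse: "laurent_abs (inverse x) = inverse (laurent_abs x)"
proof (cases "x = 0")
  case False
  then have "laurent_abs x * laurent_abs (inverse x) = 1"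
    by (simp flip: laurent_abs_mult)
  then show ?thesis
    by (metis inverse_unique)
qed simp

lemma laurent_abs_divide: "laurent_abs (x / y) = laurent_abs x / laurent_abs y"
  by (simp add: divide_inverse laurent_abs_mult laurent_abs_inverse)

lemma laurent_abs_minus [simp]: "laurent_abs (- x) = laurent_abs x"
  by (simp add: laurent_abs_def)

text \<open>A ball around 0 is cut out by the vanishing of coefficients. This turns the ultrametric
  inequality, and later the box principle, into coefficientwise statements.\<close>

lemma laurent_abs_le_powi_iff:
  "laurent_abs (x :: 'a::{field,finite} fls) \<le> real CARD('a) powi b \<longleftrightarrow> (\<forall>k < -b. fls_nth x k = 0)"
proof (cases "x = 0")
  case False
  have "laurent_abs x \<le> real CARD('a) powi b \<longleftrightarrow> - fls_subdegree x \<le> b"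
    using False by (simp add: laurent_abs_def powi_card_le_iff)
  also have "\<dots> \<longleftrightarrow> (\<forall>k < -b. fls_nth x k = 0)"
  proof
    assume "\<forall>k < -b. fls_nth x k = 0"
    with False have "-b \<le> fls_subdegree x"
      by (intro fls_subdegree_geI) auto
    then show "- fls_subdegree x \<le> b" by simp
  qed auto
  finally show ?thesis .
qed auto

lemma laurent_abs_ex_powi:
  assumes "(x :: 'a::{field,finite} fls) \<noteq> 0"
  shows "laurent_abs x = real CARD('a) powi (- fls_subdegree x)"
  using assms by (simp add: laurent_abs_def)

lemma laurent_abs_add_le_max: "laurent_abs (x + y) \<le> max (laurent_abs x) (laurent_abs y)"
proof -
  have *: "laurent_abs (x + y) \<le> laurent_abs y" if "laurent_abs x \<le> laurent_abs y"
    for x y :: "'a fls"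
  proof (cases "y = 0")
    case False
    then have y: "laurent_abs y = real CARD('a) powi (- fls_subdegree y)"
      by (rule laurent_abs_ex_powi)
    from that show ?thesis
      unfolding y laurent_abs_le_powi_iff by simp
  qed (use that in \<open>auto simp: order_antisym\<close>)
  show ?thesis
    using *[of x y] *[of y x] by (cases "laurent_abs x \<le> laurent_abs y") (auto simp: add_ac max_def)
qed

lemma laurent_abs_add_le:
  "laurent_abs x \<le> M \<Longrightarrow> laurent_abs y \<le> M \<Longrightarrow> laurent_abs (x + y) \<le> M"
  using laurent_abs_add_le_max[of x y] by linarith

lemma laurent_abs_diff_le:
  "laurent_abs x \<le> M \<Longrightarrow> laurent_abs y \<le> M \<Longrightarrow> laurent_abs (x - y) \<le> M"
  using laurent_abs_add_le[of x M "- y"] by simp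

lemma laurent_abs_sum_le:
  assumes "\<And>i. i \<in> A \<Longrightarrow> laurent_abs (f i) \<le> M" and "0 \<le> M"
  shows "laurent_abs (sum f A) \<le> M"
  using assms
  by (induction A rule: infinite_finite_induct) (auto intro!: laurent_abs_add_le)

lemma laurent_abs_sum_ge_exists:
  assumes "finite A" and "sum f A \<noteq> 0"
  obtains i where "i \<in> A" "laurent_abs (sum f A) \<le> laurent_abs (f i)"
proof -
  from assms have ne: "A \<noteq> {}" by auto
  define M where "M = Max ((\<lambda>i. laurent_abs (f i)) ` A)"
  have "M \<in> (\<lambda>i. laurent_abs (f i)) ` A"
    unfolding M_def using assms ne by (intro Max_in) auto
  then obtain i where i: "i \<in> A" "M = laurent_abs (f i)" by auto
  have "laurent_abs (sum f A) \<le> M"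
    unfolding M_def using assms ne by (intro laurent_abs_sum_le) (auto simp: Max_ge_iff)
  with i show ?thesis using that by auto
qed

lemma laurent_abs_of_nat_le_1: "laurent_abs (of_nat n) \<le> 1"
  by (induction n) (auto intro: laurent_abs_add_le)

text \<open>An integer is a constant series, so it has subdegree 0 if it is nonzero. Hence a
  coefficient whose index is prime to the characteristic keeps its size under
  differentiation.\<close>

lemma laurent_abs_of_nat:
  "(of_nat n :: 'a::{field,finite} fls) \<noteq> 0 \<Longrightarrow> laurent_abs (of_nat n :: 'a fls) = 1"
  by (simp add: laurent_abs_def)

lemma laurent_abs_fls_X_inv [simp]: "laurent_abs (fls_X_inv :: 'a::{field,finite} fls) = real CARD('a)"
  by (simp add: laurent_abs_def)

section \<open>Polynomials in \<open>T\<close> inside a field\<close>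

lemma poly_T_pCons: "poly_T (pCons a c) = fls_const a + fls_X_inv * poly_T c"
  by (simp add: poly_T_def map_poly_pCons)

lemma poly_T_0 [simp]: "poly_T 0 = 0"
  by (simp add: poly_T_def)

lemma poly_T_nth: "fls_nth (poly_T c) k = (if k \<le> 0 then coeff c (nat (- k)) else 0)"
proof (induction c arbitrary: k)
  case (pCons a c)
  show ?case
  proof (cases "k < 0")
    case True
    then have "nat (- k) = Suc (nat (- (k + 1)))" by simp
    with True show ?thesis
      by (simp add: poly_T_pCons fls_X_inv_times_conv_shift pCons.IH)
  qed (simp add: poly_T_pCons fls_X_inv_times_conv_shift pCons.IH)
qed simp

lemma poly_T_eq_0_iff [simp]: "poly_T c = 0 \<longleftrightarrow> c = 0"
proof
  assume *: "poly_T c = 0"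
  have "coeff c i = 0" for i
    using poly_T_nth[of c "- int i"] * by simp
  then show "c = 0" by (simp add: poly_eq_iff)
qed simp

lemma poly_T_add: "poly_T (c + d) = poly_T c + poly_T d"
  by (rule fls_eqI) (simp add: poly_T_nth)

lemma poly_T_1 [simp]: "poly_T 1 = 1"
  by (simp add: one_pCons poly_T_pCons)

lemma poly_T_smult: "poly_T (smult a c) = fls_const a * poly_T c"
  by (rule fls_eqI) (simp add: poly_T_nth)

lemma poly_T_mult: "poly_T (c * d) = poly_T c * poly_T d"
  by (induction c) (auto simp: poly_T_add poly_T_pCons poly_T_smult algebra_simps)

lemma laurent_abs_poly_T:
  assumes "(c :: 'a::{field,finite} poly) \<noteq> 0"
  shows "laurent_abs (poly_T c) = real CARD('a) ^ degree c"
proof -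
  have "fls_subdegree (poly_T c) = - int (degree c)"
    by (rule fls_subdegree_eqI) (use assms in \<open>auto simp: poly_T_nth coeff_eq_0\<close>)
  then show ?thesis using assms by (simp add: laurent_abs_def)
qed

text \<open>Minimal polynomials and heights occur both in the Laurent series field and in
  C_infinity. Their theory is developed once, for any injective ring homomorphism from the
  polynomials in \<open>T\<close> into a field.\<close>

locale coeff_embedding =
  fixes e :: "'a::{field,finite} poly \<Rightarrow> 'k::field"
  assumes e_1: "e 1 = 1"
    and e_add: "e (c + d) = e c + e d"
    and e_mult: "e (c * d) = e c * e d"
    and e_eq_0: "e c = 0 \<Longrightarrow> c = 0"
begin

lemma e_0 [simp]: "e 0 = 0"
  using e_add[of 0 0] by (metis add_0 add_cancel_right_left)

lemma e_eq_0_iff: "e c = 0 \<longleftrightarrow> c = 0"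
  using e_eq_0 by auto

lemma eval_over_0 [simp]: "eval_over e 0 x = 0"
  by (simp add: eval_over_def)

lemma eval_over_pCons: "eval_over e (pCons c P) x = e c + x * eval_over e P x"
  by (simp add: eval_over_def map_poly_pCons)

lemma eval_over_add: "eval_over e (P + Q) x = eval_over e P x + eval_over e Q x"
proof (induction P Q rule: poly_induct2)
  case (pCons a P b Q)
  then show ?case by (simp add: eval_over_pCons e_add algebra_simps)
qed (simp add: eval_over_def)

lemma eval_over_smult: "eval_over e (smult c P) x = e c * eval_over e P x"
  by (induction P) (simp_all add: eval_over_pCons e_mult algebra_simps)

lemma eval_over_mult: "eval_over e (P * Q) x = eval_over e P x * eval_over e Q x"
  by (induction P) (simp_all add: eval_over_add eval_over_smult eval_over_pCons algebra_simps)

end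

interpretation base: coeff_embedding poly_T
  by unfold_locales (auto simp: poly_T_add poly_T_mult)

lemma coeff_embedding_completed:
  assumes "completed_alg_closure emb absC"
  shows "coeff_embedding (\<lambda>c. emb (to_ac (poly_T c)))"
proof -
  interpret completed_alg_closure emb absC by fact
  have "c = 0" if "emb (to_ac (poly_T c)) = 0" for c
    by (metis that absC_eq_0_iff absC_extends laurent_abs_eq_0_iff poly_T_eq_0_iff)
  then show ?thesis
    by unfold_locales (simp_all only: poly_T_add poly_T_mult poly_T_1 to_ac_add to_ac_mult to_ac_1
      emb_1 emb_add emb_mult)
qed

section \<open>Heights and Gauss's lemma\<close>

text \<open>The degree in \<open>T\<close>; for nonzero \<open>P\<close> it is the logarithm of the
  height to base \<open>q\<close>.\<close>

definition tdeg :: "'a::zero poly poly \<Rightarrow> nat" where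
  "tdeg P = Max ((\<lambda>i. degree (coeff P i)) ` {..degree P})"

lemma degree_coeff_le_tdeg: "degree (coeff P i) \<le> tdeg P"
proof (cases "i \<le> degree P")
  case True
  then show ?thesis unfolding tdeg_def by (intro Max_ge) auto
qed (simp add: coeff_eq_0)

lemma tdeg_leI: "(\<And>i. degree (coeff P i) \<le> m) \<Longrightarrow> tdeg P \<le> m"
  unfolding tdeg_def by (subst Max_le_iff) auto

lemma tdeg_attained: 
  assumes "P \<noteq> 0" obtains i where "degree (coeff P i) = tdeg P" "coeff P i \<noteq> 0"
proof (cases "tdeg P = 0")
  case True
  then show ?thesis
    using that[of "degree P"] degree_coeff_le_tdeg[of P "degree P"] assms by auto
next
  case False
  have "tdeg P \<in> (\<lambda>i. degree (coeff P i)) ` {..degree P}"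
    unfolding tdeg_def by (intro Max_in) auto
  then obtain i where "degree (coeff P i) = tdeg P" by auto
  moreover from this False have "coeff P i \<noteq> 0"
    by (metis degree_0)
  ultimately show ?thesis using that by blast
qed

lemma height_0 [simp]: "height 0 = 0"
  by (simp add: height_def)

lemma height_eq:
  assumes "(P :: 'a::{field,finite} poly poly) \<noteq> 0"
  shows "height P = real CARD('a) ^ tdeg P"
  unfolding height_def
proof (rule Max_eqI)
  fix y assume "y \<in> (\<lambda>i. laurent_abs (poly_T (coeff P i))) ` {..degree P}"
  then obtain i where y: "y = laurent_abs (poly_T (coeff P i))" by auto
  show "y \<le> real CARD('a) ^ tdeg P"
  proof (cases "coeff P i = 0")
    case False
    then show ?thesis
      unfolding y using card_field_gt_1[where 'a='a] degree_coeff_le_tdeg[of P i]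
      by (simp add: laurent_abs_poly_T power_increasing)
  qed (simp add: y)
next
  obtain i where i: "degree (coeff P i) = tdeg P" "coeff P i \<noteq> 0"
    using tdeg_attained[OF assms] .
  then have "i \<le> degree P" by (simp add: le_degree)
  moreover have "laurent_abs (poly_T (coeff P i)) = real CARD('a) ^ tdeg P"
    using i by (simp add: laurent_abs_poly_T)
  ultimately show "real CARD('a) ^ tdeg P \<in> (\<lambda>i. laurent_abs (poly_T (coeff P i))) ` {..degree P}"
    by force
qed auto

lemma height_ge_1: "P \<noteq> 0 \<Longrightarrow> height P \<ge> 1"
  using card_field_gt_1[where 'a='a] by (simp add: height_eq)

lemma height_nonneg: "height P \<ge> 0"
  using height_ge_1[of P] by (cases "P = 0") auto

lemma laurent_abs_coeff_le_height: "laurent_abs (poly_T (coeff P i)) \<le> height P"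
proof (cases "i \<le> degree P")
  case True
  then show ?thesis unfolding height_def by (intro Max_ge) auto
qed (use height_nonneg in \<open>auto simp: coeff_eq_0\<close>)

lemma height_leI:
  assumes "\<And>i. laurent_abs (poly_T (coeff P i)) \<le> M"
  shows "height P \<le> M"
  unfolding height_def using assms by (subst Max_le_iff) auto

lemma height_le_iff:
  "height (P :: 'a::{field,finite} poly poly) \<le> real CARD('a) ^ m \<longleftrightarrow> (\<forall>i. degree (coeff P i) \<le> m)"
proof (cases "P = 0")
  case False
  have "height P \<le> real CARD('a) ^ m \<longleftrightarrow> tdeg P \<le> m"
    using card_field_gt_1[where 'a='a] False by (simp add: height_eq)
  also have "\<dots> \<longleftrightarrow> (\<forall>i. degree (coeff P i) \<le> m)"
    using degree_coeff_le_tdeg tdeg_leI le_trans by meson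
  finally show ?thesis .
qed auto

text \<open>Gauss's argument: let \<open>i\<close> and \<open>j\<close> be the least indices at
  which the maximal degree in \<open>T\<close> occurs in \<open>P\<close> and \<open>Q\<close>. In
  the coefficient of \<open>P * Q\<close> at \<open>i + j\<close> only the product of these two
  coefficients reaches degree \<open>tdeg P + tdeg Q\<close>, so its leading term cannot
  cancel.\<close>

lemma tdeg_le_mult:
  assumes "(P :: 'a::idom poly poly) \<noteq> 0" "Q \<noteq> 0"
  shows "tdeg P \<le> tdeg (P * Q)"
proof -
  define i where "i = (LEAST i. coeff P i \<noteq> 0 \<and> degree (coeff P i) = tdeg P)"
  define j where "j = (LEAST j. coeff Q j \<noteq> 0 \<and> degree (coeff Q j) = tdeg Q)"
  have i: "coeff P i \<noteq> 0 \<and> degree (coeff P i) = tdeg P"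
    unfolding i_def by (rule LeastI_ex) (metis tdeg_attained[OF assms(1)])
  have j: "coeff Q j \<noteq> 0 \<and> degree (coeff Q j) = tdeg Q"
    unfolding j_def by (rule LeastI_ex) (metis tdeg_attained[OF assms(2)])
  \<comment> \<open>The alternative of a zero coefficient matters when \<open>tdeg P = 0\<close>,
    because the zero polynomial has degree 0 as well.\<close>
  have li: "coeff P i' = 0 \<or> degree (coeff P i') < tdeg P" if "i' < i" for i'
    using not_less_Least[OF that[unfolded i_def]] degree_coeff_le_tdeg[of P i'] by linarith
  have lj: "coeff Q j' = 0 \<or> degree (coeff Q j') < tdeg Q" if "j' < j" for j'
    using not_less_Least[OF that[unfolded j_def]] degree_coeff_le_tdeg[of Q j'] by linarith
  let ?D = "tdeg P + tdeg Q"
  have top: "coeff (coeff P k * coeff Q (i + j - k)) ?D = 0" if "k \<le> i + j" "k \<noteq> i" for k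
  proof (cases "coeff P k = 0 \<or> coeff Q (i + j - k) = 0")
    case False
    have "degree (coeff P k) + degree (coeff Q (i + j - k)) < ?D"
    proof (cases "k < i")
      case True
      with li[of k] False degree_coeff_le_tdeg[of Q "i + j - k"] show ?thesis by linarith
    next
      case c: False
      with that have "i + j - k < j" by linarith
      with lj[of "i + j - k"] False degree_coeff_le_tdeg[of P k] show ?thesis by linarith
    qed
    then show ?thesis
      by (intro coeff_eq_0) (use degree_mult_le le_less_trans in blast)
  qed auto
  have "coeff (coeff (P * Q) (i + j)) ?D = (\<Sum>k\<le>i+j. coeff (coeff P k * coeff Q (i + j - k)) ?D)"
    by (simp add: coeff_mult coeff_sum)
  also have "\<dots> = (\<Sum>k\<in>{i}. coeff (coeff P k * coeff Q (i + j - k)) ?D)"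
    by (rule sum.mono_neutral_right) (use top in auto)
  also have "\<dots> = coeff (coeff P i * coeff Q j) (degree (coeff P i) + degree (coeff Q j))"
    using i j by simp
  also have "\<dots> = lead_coeff (coeff P i) * lead_coeff (coeff Q j)"
    by (rule coeff_mult_degree_sum)
  also have "\<dots> \<noteq> 0"
    using i j by (metis leading_coeff_0_iff mult_eq_0_iff)
  finally have "?D \<le> degree (coeff (P * Q) (i + j))"
    by (rule le_degree)
  with degree_coeff_le_tdeg[of "P * Q" "i + j"] show ?thesis by linarith
qed

lemma height_le_mult:
  assumes "(P :: 'a::{field,finite} poly poly) \<noteq> 0" "Q \<noteq> 0"
  shows "height P \<le> height (P * Q)"
  using assms card_field_gt_1[where 'a='a] tdeg_le_mult[OF assms]
  by (simp add: height_eq power_increasing)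

section \<open>Primitive polynomials and minimal polynomials\<close>

lemma exists_irreducible_factor:
  assumes "(a :: 'a::field poly) \<noteq> 0" "degree a > 0"
  obtains b where "irreducible b" "b dvd a" "degree b > 0"
proof -
  obtain b where b: "b dvd a" "degree b > 0"
    and least: "\<And>c. c dvd a \<Longrightarrow> degree c > 0 \<Longrightarrow> degree b \<le> degree c"
    using ex_has_least_nat[of "\<lambda>b. b dvd a \<and> degree b > 0" a degree] assms by auto
  have "irreducible b"
  proof (rule irreducibleI)
    show "b \<noteq> 0" using b by auto
    then show "\<not> is_unit b" using b by (simp add: is_unit_iff_degree)
    fix x y assume xy: "b = x * y"
    then have nz: "x \<noteq> 0" "y \<noteq> 0" using \<open>b \<noteq> 0\<close> by auto
    show "is_unit x \<or> is_unit y"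
    proof (rule ccontr)
      assume "\<not> (is_unit x \<or> is_unit y)"
      with nz have "degree x > 0" "degree y > 0"
        by (auto simp: is_unit_iff_degree)
      moreover have "x dvd a" using b xy by (metis dvd_mult_left)
      ultimately show False
        using least[of x] xy nz by (simp add: degree_mult_eq)
    qed
  qed
  with b that show ?thesis by blast
qed

text \<open>The irreducible factors of \<open>a\<close> are stripped off one at a time. Each factor
  \<open>b\<close> is prime as a constant of the bivariate ring and does not divide the primitive
  \<open>P\<close>, so it divides \<open>S\<close> and can be cancelled. When \<open>a\<close> has
  become constant it is a unit.\<close>

lemma primitive_dvd_cancel:
  fixes P Q :: "'a::field poly poly"
  assumes "\<forall>c. (\<forall>i. c dvd coeff P i) \<longrightarrow> is_unit c"
    and "a \<noteq> 0" and "smult a Q = P * S"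
  shows "P dvd Q"
  using assms(2,3)
proof (induction "degree a" arbitrary: a S rule: less_induct)
  case less
  show ?case
  proof (cases "degree a = 0")
    case True
    then have "is_unit a" using less.prems by (simp add: is_unit_iff_degree)
    then obtain b where b: "a * b = 1" by (auto simp: dvd_def)
    have "Q = smult (a * b) Q" by (simp add: b)
    also have "\<dots> = smult b (smult a Q)" by (simp add: mult.commute)
    also have "\<dots> = P * smult b S" using less.prems(2) by simp
    finally show ?thesis by (rule dvdI)
  next
    case False
    then obtain b where b: "irreducible b" "b dvd a" "degree b > 0"
      using exists_irreducible_factor[OF less.prems(1)] by blast
    then have prime: "prime_elem [:b:]"
      by (intro lift_prime_elem_poly field_poly_irreducible_imp_prime)
    from b obtain a' where a': "a = b * a'" by (auto simp: dvd_def)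
    have "[:b:] dvd P * S"
      unfolding less.prems(2)[symmetric] a' by (simp add: const_poly_dvd_iff)
    moreover have "\<not> [:b:] dvd P"
      using assms(1) b(1) by (auto simp: const_poly_dvd_iff irreducible_def)
    ultimately have "[:b:] dvd S"
      using prime by (simp add: prime_elem_dvd_mult_iff)
    then obtain S' where S': "S = smult b S'" by (auto simp: dvd_def)
    have b0: "b \<noteq> 0" using b by auto
    have "smult b (smult a' Q) = smult b (P * S')"
      using less.prems(2) by (simp add: a' S')
    then have "smult a' Q = P * S'"
      using b0 by (metis smult_cancel)
    moreover have "a' \<noteq> 0" "degree a' < degree a"
      using less.prems(1) b b0 by (auto simp: a' degree_mult_eq)
    ultimately show ?thesis using less.hyps by blast
  qed
qed

context coeff_embedding
begin

text \<open>The coefficients form no field, so pseudo-division is used. The remainder vanishes at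
  \<open>x\<close> and has smaller degree than \<open>P\<close>, hence is 0 by minimality; the
  multiplier \<open>a\<close> is then removed because \<open>P\<close> is primitive.\<close>

lemma is_min_poly_over_dvd:
  assumes P: "is_min_poly_over e x P" and Q: "eval_over e Q x = 0"
  shows "P dvd Q"
proof -
  have P0: "P \<noteq> 0" using P by (simp add: is_min_poly_over_def)
  obtain a S where aS: "a \<noteq> 0" "smult a Q = P * S + pseudo_mod Q P"
    using pseudo_mod(1)[OF P0, of Q] by blast
  have "eval_over e (pseudo_mod Q P) x = eval_over e (smult a Q) x - eval_over e (P * S) x"
    by (simp add: aS(2) eval_over_add)
  also have "\<dots> = 0"
    using P Q by (simp add: eval_over_smult eval_over_mult is_min_poly_over_def)
  finally have "pseudo_mod Q P = 0"
    using P pseudo_mod(2)[OF P0, of Q] unfolding is_min_poly_over_def by (meson linorder_not_less)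
  with aS primitive_dvd_cancel[of P a Q S] P show ?thesis
    by (simp add: is_min_poly_over_def)
qed

text \<open>Two candidates divide each other, so they differ by a unit, which is a constant of the
  finite field; the normalisation of the leading coefficient makes it 1.\<close>

lemma is_min_poly_over_unique:
  assumes P: "is_min_poly_over e x P" and Q: "is_min_poly_over e x Q"
  shows "P = Q"
proof -
  from P Q have nz: "P \<noteq> 0" and l: "lead_coeff (lead_coeff P) = 1" "lead_coeff (lead_coeff Q) = 1"
    by (auto simp: is_min_poly_over_def)
  have "P dvd Q" "Q dvd P"
    using P Q is_min_poly_over_dvd by (auto simp: is_min_poly_over_def)
  then obtain U V where U: "Q = P * U" and V: "P = Q * V" by (meson dvdE)
  have "P * (U * V) = P * 1"
    by (metis mult.assoc mult_1_right U V)
  then have "U * V = 1" using nz by (metis mult_cancel_left)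
  then have "is_unit U" by (metis dvd_triv_left)
  then obtain u where u: "U = [:u:]" "is_unit u"
    by (auto simp: is_unit_poly_iff)
  then obtain t where t: "u = [:t:]"
    by (auto simp: is_unit_poly_iff)
  have "t = lead_coeff (lead_coeff (P * U))"
    using u t l by (simp add: lead_coeff_mult)
  then have "t = 1" using U l by simp
  then show ?thesis using U u t by (simp flip: one_pCons)
qed

text \<open>Minimise first the degree in \<open>X\<close>, then the degree in \<open>T\<close> of
  the leading coefficient. Dividing by a nonconstant common factor would lower the latter, so the
  minimiser is primitive.\<close>

lemma is_min_poly_over_exists:
  assumes "algebraic_over e x"
  shows "\<exists>P. is_min_poly_over e x P"
proof -
  let ?A = "\<lambda>P. P \<noteq> 0 \<and> eval_over e P x = 0"
  from assms obtain P0 where "?A P0" by (auto simp: algebraic_over_def)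
  then obtain P1 where P1: "?A P1" and min1: "\<And>Q. ?A Q \<Longrightarrow> degree P1 \<le> degree Q"
    using ex_has_least_nat[of ?A P0 degree] by auto
  let ?B = "\<lambda>P. ?A P \<and> degree P = degree P1"
  obtain P where P: "?B P" and min2: "\<And>Q. ?B Q \<Longrightarrow> degree (lead_coeff P) \<le> degree (lead_coeff Q)"
    using ex_has_least_nat[of ?B P1 "\<lambda>P. degree (lead_coeff P)"] P1 by auto
  have prim: "is_unit c" if c: "\<forall>i. c dvd coeff P i" for c
  proof -
    from c have "[:c:] dvd P" by (simp add: const_poly_dvd_iff)
    then obtain P' where P': "P = smult c P'" by (auto simp: dvd_def)
    with P have nz: "c \<noteq> 0" "P' \<noteq> 0" by auto
    then have "?B P'"
      using P P' by (auto simp: eval_over_smult e_eq_0_iff)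
    from min2[OF this] nz have "degree c = 0"
      by (simp add: P' degree_mult_eq)
    with nz show ?thesis by (simp add: is_unit_iff_degree)
  qed
  define t where "t = inverse (lead_coeff (lead_coeff P))"
  have t: "t \<noteq> 0" "t * lead_coeff (lead_coeff P) = 1"
    using P unfolding t_def by (metis leading_coeff_0_iff inverse_nonzero_iff_nonzero left_inverse)+
  have "is_min_poly_over e x (smult [:t:] P)"
    unfolding is_min_poly_over_def
  proof (intro conjI allI impI)
    show "smult [:t:] P \<noteq> 0" using P t by simp
    show "eval_over e (smult [:t:] P) x = 0" using P by (simp add: eval_over_smult)
    show "degree (smult [:t:] P) \<le> degree Q" if "?A Q" for Q
      using P t min1[OF that] by simp
    show "is_unit c" if c: "\<forall>i. c dvd coeff (smult [:t:] P) i" for c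
    proof (rule prim, rule allI)
      fix i
      show "c dvd coeff P i" using spec[OF c, of i] t(1) by (simp add: dvd_smult_iff)
    qed
    show "lead_coeff (lead_coeff (smult [:t:] P)) = 1"
      using t by simp
  qed
  then show ?thesis by blast
qed

lemma is_min_poly_min_poly_over:
  assumes "algebraic_over e x"
  shows "is_min_poly_over e x (min_poly_over e x)"
  unfolding min_poly_over_def
  by (rule theI') (use is_min_poly_over_exists[OF assms] is_min_poly_over_unique in blast)

lemma algebraic_deg_leI:
  assumes "Q \<noteq> 0" "eval_over e Q x = 0" "degree Q \<le> n"
  shows "algebraic_deg_le e n x"
proof -
  have alg: "algebraic_over e x" using assms by (auto simp: algebraic_over_def)
  then show ?thesis
    using is_min_poly_min_poly_over[OF alg] assms
    by (auto simp: algebraic_deg_le_def is_min_poly_over_def intro: le_trans)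
qed

text \<open>Hensel's lemma produces roots of polynomials that need not be minimal. The minimal
  polynomial divides any such polynomial, and passing to a divisor does not increase the
  height.\<close>

lemma alg_height_le:
  assumes "Q \<noteq> 0" "eval_over e Q x = 0"
  shows "alg_height e x \<le> height Q"
proof -
  have alg: "algebraic_over e x" using assms by (auto simp: algebraic_over_def)
  have m: "is_min_poly_over e x (min_poly_over e x)"
    using is_min_poly_min_poly_over[OF alg] .
  then obtain R where "Q = min_poly_over e x * R"
    using is_min_poly_over_dvd[OF m assms(2)] by (auto simp: dvd_def)
  with assms(1) show ?thesis
    by (auto simp: alg_height_def intro!: height_le_mult)
qed

lemma algebraic_deg_leE:
  assumes "algebraic_deg_le e n x"
  obtains P where "P \<noteq> 0" "eval_over e P x = 0" "degree P \<le> n" "height P = alg_height e x"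
  using assms is_min_poly_min_poly_over[of x] that[of "min_poly_over e x"]
  by (auto simp: algebraic_deg_le_def is_min_poly_over_def alg_height_def)

lemma alg_height_ge_1:
  assumes "algebraic_deg_le e n x"
  shows "alg_height e x \<ge> 1"
  using algebraic_deg_leE[OF assms] height_ge_1 by metis

end

section \<open>Hensel's lemma\<close>

text \<open>Newton iteration: the coefficients of the iterates of a contraction stabilise.\<close>

lemma fps_contraction_fixpoint:
  fixes f :: "'a::comm_ring_1 fps \<Rightarrow> 'a fps"
  assumes contr: "\<And>x y m. (\<And>i. i < m \<Longrightarrow> fps_nth x i = fps_nth y i) \<Longrightarrow>
    (\<And>i. i \<le> m \<Longrightarrow> fps_nth (f x) i = fps_nth (f y) i)"
  obtains z where "f z = z"
proof -
  define it where "it = (\<lambda>k. (f ^^ k) 0)"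
  \<comment> \<open>The diagonal limit: coefficient \<open>m\<close> no longer changes from iterate
    \<open>Suc m\<close> on.\<close>
  define z where "z = Abs_fps (\<lambda>m. fps_nth (it (Suc m)) m)"
  have step: "fps_nth (it k) i = fps_nth (it (Suc k)) i" if "i < k" for i k
    using that
  proof (induction k arbitrary: i)
    case (Suc k)
    have "fps_nth (f (it k)) i = fps_nth (f (it (Suc k))) i"
      by (rule contr[of k]) (use Suc in auto)
    then show ?case by (simp add: it_def)
  qed simp
  have it: "fps_nth (it k) i = fps_nth z i" if "i < k" for i k
    using that
  proof (induction k)
    case (Suc k)
    show ?case
    proof (cases "i = k")
      case False
      with Suc step[of i k] show ?thesis by simp
    qed (simp add: z_def)
  qed simp
  have "f z = z"
  proof (rule fps_ext)
    fix i
    have "fps_nth (f z) i = fps_nth (f (it i)) i"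
      by (rule contr[of i]) (use it[of _ i] in auto)
    also have "f (it i) = it (Suc i)" by (simp add: it_def)
    also have "fps_nth (it (Suc i)) i = fps_nth z i" by (rule it) simp
    finally show "fps_nth (f z) i = fps_nth z i" .
  qed
  then show ?thesis by (rule that)
qed

lemma fps_mult_nth_cong:
  fixes x y :: "'a::comm_ring_1 fps"
  assumes "\<And>i. i \<le> m \<Longrightarrow> fps_nth x i = fps_nth y i"
    and "\<And>i. i \<le> m \<Longrightarrow> fps_nth x' i = fps_nth y' i" and "i \<le> m"
  shows "fps_nth (x * x') i = fps_nth (y * y') i"
  unfolding fps_mult_nth by (rule sum.cong) (use assms in auto)

lemma fps_poly_nth_cong:
  fixes x y :: "'a::comm_ring_1 fps"
  assumes "\<And>i. i \<le> m \<Longrightarrow> fps_nth x i = fps_nth y i" and "i \<le> m"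
  shows "fps_nth (poly p x) i = fps_nth (poly p y) i"
  using assms(2)
proof (induction p arbitrary: i)
  case (pCons a p)
  have "fps_nth (x * poly p x) i = fps_nth (y * poly p y) i"
    by (rule fps_mult_nth_cong[of m]) (use assms(1) pCons in auto)
  then show ?case by simp
qed simp

text \<open>The factor \<open>fps_X\<close> makes the map contracting: the coefficients of
  \<open>z\<close> below \<open>m\<close> determine those of the image up to and including
  \<open>m\<close>.\<close>

lemma fps_fixpoint_poly:
  fixes p :: "'a::comm_ring_1 fps poly"
  obtains z where "z = c + fps_X * poly p z"
proof -
  let ?f = "\<lambda>z. c + fps_X * poly p z"
  have "fps_nth (?f x) i = fps_nth (?f y) i"
    if *: "\<And>i. i < m \<Longrightarrow> fps_nth x i = fps_nth y i" and "i \<le> m" for x y m i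
  proof (cases i)
    case (Suc j)
    then have "fps_nth (poly p x) j = fps_nth (poly p y) j"
      by (intro fps_poly_nth_cong[of j]) (use that in auto)
    with Suc show ?thesis by simp
  qed simp
  then obtain z where "?f z = z"
    by (rule fps_contraction_fixpoint)
  then show ?thesis using that[of z] by simp
qed

lemma laurent_abs_fps_to_fls_le_1: "laurent_abs (fps_to_fls x) \<le> 1"
  using laurent_abs_le_powi_iff[of "fps_to_fls x" 0] by simp

lemma laurent_abs_lt_1E:
  assumes "laurent_abs (x :: 'a::{field,finite} fls) < 1"
  obtains y where "x = fls_X * fps_to_fls y"
proof -
  have "laurent_abs x \<le> real CARD('a) powi (-1)"
  proof (cases "x = 0")
    case False
    have "real CARD('a) powi (- fls_subdegree x) < real CARD('a) powi 0"
      using assms False by (simp add: laurent_abs_def)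
    then have "- fls_subdegree x < 0"
      by (metis powi_card_le_iff linorder_not_le)
    then show ?thesis
      unfolding laurent_abs_ex_powi[OF False] powi_card_le_iff by simp
  qed simp
  then have 0: "fls_nth x k = 0" if "k < 1" for k
    using that unfolding laurent_abs_le_powi_iff by auto
  have "x = fls_X * fps_to_fls (Abs_fps (\<lambda>n. fls_nth x (int n + 1)))"
    by (rule fls_eqI) (auto simp: fls_X_times_conv_shift 0)
  then show ?thesis by (rule that)
qed

lemma fps_to_fls_poly: "fps_to_fls (poly p z) = poly (map_poly fps_to_fls p) (fps_to_fls z)"
  by (induction p) (simp_all add: map_poly_pCons fls_times_fps_to_fls)

text \<open>The coefficients lie in the maximal ideal, so \<open>F\<close> is \<open>fls_X\<close>
  times a polynomial \<open>G\<close> over the power series. The equation becomes the fixed point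
  equation z = -1 - X G(z).\<close>

lemma hensel_normalised:
  fixes F :: "'a::{field,finite} fls poly"
  assumes "\<And>i. laurent_abs (coeff F i) < 1"
  obtains z where "laurent_abs z \<le> 1" "1 + z + poly F z = 0"
proof -
  have "\<exists>G. F = smult fls_X (map_poly fps_to_fls G)"
    using assms
  proof (induction F)
    case (pCons a F)
    have "laurent_abs (coeff F i) < 1" for i
      using pCons.prems[of "Suc i"] by simp
    then obtain G where G: "F = smult fls_X (map_poly fps_to_fls G)"
      using pCons.IH by blast
    obtain b where "a = fls_X * fps_to_fls b"
      using laurent_abs_lt_1E[of a] pCons.prems[of 0] by auto
    then have "pCons a F = smult fls_X (map_poly fps_to_fls (pCons b G))"
      by (simp add: G map_poly_pCons)
    then show ?case by blast
  qed (auto intro: exI[of _ 0])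
  then obtain G where G: "F = smult fls_X (map_poly fps_to_fls G)" by blast
  obtain z where z: "z = -1 + fps_X * poly (-G) z"
    by (rule fps_fixpoint_poly)
  have "poly F (fps_to_fls z) = fls_X * fps_to_fls (poly G z)"
    by (simp add: G fps_to_fls_poly)
  also have "\<dots> = fps_to_fls (fps_X * poly G z)"
    by (simp add: fls_times_fps_to_fls)
  also have "fps_X * poly G z = - (1 + z)"
    by (subst (2) z) simp
  also have "fps_to_fls (- (1 + z)) = - (1 + fps_to_fls z)"
    by (rule fls_eqI) simp
  finally have "1 + fps_to_fls z + poly F (fps_to_fls z) = 0" by simp
  with laurent_abs_fps_to_fls_le_1 show ?thesis by (rule that)
qed

lemma poly_eq_sum_atMost:
  assumes "degree p \<le> n"
  shows "poly p x = (\<Sum>i\<le>n. coeff p i * (x::'a::comm_semiring_1) ^ i)"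
  unfolding poly_altdef
  by (rule sum.mono_neutral_left) (use assms in \<open>auto simp: coeff_eq_0\<close>)

text \<open>If \<open>coeff F 0\<close> is nonzero, \<open>dom\<close> says that at radius |F(0)| /
  |F'(0)| the linear term strictly exceeds all later ones, so the first segment of the Newton
  polygon has length one. If \<open>coeff F 0\<close> is zero, the root 0 serves.\<close>

lemma hensel_root:
  fixes F :: "'a::{field,finite} fls poly"
  assumes c1: "coeff F 1 \<noteq> 0"
    and dom: "\<And>i. i \<ge> 2 \<Longrightarrow>
      laurent_abs (coeff F i) * laurent_abs (coeff F 0) ^ (i - 1) < laurent_abs (coeff F 1) ^ i"
  obtains y where "poly F y = 0" "laurent_abs y \<le> laurent_abs (coeff F 0) / laurent_abs (coeff F 1)"
proof (cases "coeff F 0 = 0")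
  case True
  then have "poly F 0 = 0" by (simp add: poly_0_coeff_0)
  then show ?thesis using that[of 0] by simp
next
  case False
  define a b where "a = coeff F 0" and "b = coeff F 1"
  have nz: "a \<noteq> 0" "b \<noteq> 0" using False c1 by (auto simp: a_def b_def)
  \<comment> \<open>Substituting \<open>y = a / b * z\<close> and dividing by \<open>a\<close> turns
    \<open>F\<close> into \<open>1 + z + G\<close>, and \<open>dom\<close> makes all coefficients of
    \<open>G\<close> smaller than 1.\<close>
  define G where "G = (\<Sum>i\<in>{2..degree F}. monom (coeff F i * a ^ (i - 1) / b ^ i) i)"
  have cG: "coeff G i = (if i \<in> {2..degree F} then coeff F i * a ^ (i - 1) / b ^ i else 0)" for i
    by (simp add: G_def coeff_sum)
  have "laurent_abs (coeff G i) < 1" for i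
    using dom[of i] nz
    by (auto simp: cG laurent_abs_divide laurent_abs_mult laurent_abs_power a_def b_def)
  then obtain z where z: "laurent_abs z \<le> 1" "1 + z + poly G z = 0"
    by (rule hensel_normalised)
  let ?y = "a / b * z"
  define N where "N = Suc (degree F)"
  have "poly F ?y = (\<Sum>i\<le>N. coeff F i * ?y ^ i)"
    by (rule poly_eq_sum_atMost) (simp add: N_def)
  also have "{..N} = insert 0 (insert 1 {2..N})"
    by (auto simp: N_def)
  also have "(\<Sum>i\<in>insert 0 (insert 1 {2..N}). coeff F i * ?y ^ i)
      = a + a * z + (\<Sum>i\<in>{2..N}. coeff F i * ?y ^ i)"
    using nz by (simp add: a_def b_def)
  also have "(\<Sum>i\<in>{2..N}. coeff F i * ?y ^ i) = (\<Sum>i\<in>{2..degree F}. coeff F i * ?y ^ i)"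
    by (rule sum.mono_neutral_right) (auto simp: N_def coeff_eq_0)
  also have "\<dots> = (\<Sum>i\<in>{2..degree F}. a * (coeff F i * a ^ (i - 1) / b ^ i * z ^ i))"
  proof (rule sum.cong)
    fix i assume "i \<in> {2..degree F}"
    then have "a ^ i = a * a ^ (i - 1)" by (simp flip: power_Suc)
    then show "coeff F i * ?y ^ i = a * (coeff F i * a ^ (i - 1) / b ^ i * z ^ i)"
      by (simp add: power_mult_distrib power_divide)
  qed simp
  also have "\<dots> = a * poly G z"
    by (simp add: G_def poly_sum poly_monom sum_distrib_left)
  also have "a + a * z + a * poly G z = a * (1 + z + poly G z)"
    by (simp add: algebra_simps)
  finally have "poly F ?y = 0" using z by simp
  moreover have "laurent_abs ?y \<le> laurent_abs a / laurent_abs b"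
    using z(1) nz by (simp add: laurent_abs_mult laurent_abs_divide divide_right_mono mult_left_le)
  ultimately show ?thesis using that[of ?y] by (simp add: a_def b_def)
qed

section \<open>Taylor coefficients and the transference argument\<close>

text \<open>
  The coefficients of \<open>taylor \<xi> P\<close> are those of \<open>P(\<xi> + Y)\<close> as a polynomial in \<open>Y\<close>, that is, the
  Hasse derivatives of \<open>P\<close> at \<open>\<xi>\<close>.
\<close>

definition taylor :: "'a::{field,finite} fls \<Rightarrow> 'a poly poly \<Rightarrow> 'a fls poly" where
  "taylor \<xi> P = pcompose (map_poly poly_T P) [:\<xi>, 1:]"

lemma taylor_0 [simp]: "taylor \<xi> 0 = 0"
  by (simp add: taylor_def)

lemma taylor_pCons: "taylor \<xi> (pCons c P) = [:poly_T c:] + [:\<xi>, 1:] * taylor \<xi> P"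
  by (simp add: taylor_def map_poly_pCons pcompose_pCons)

lemma taylor_add: "taylor \<xi> (P + Q) = taylor \<xi> P + taylor \<xi> Q"
proof (induction P Q rule: poly_induct2)
  case (pCons a P b Q)
  then show ?case by (simp add: taylor_pCons poly_T_add algebra_simps)
qed simp

lemma taylor_diff: "taylor \<xi> (P - Q) = taylor \<xi> P - taylor \<xi> Q"
  using taylor_add[of \<xi> "P - Q" Q] by simp

lemma taylor_smult: "taylor \<xi> (smult c P) = smult (poly_T c) (taylor \<xi> P)"
  by (induction P) (simp_all add: taylor_pCons poly_T_mult smult_add_right)

lemma taylor_mult: "taylor \<xi> (P * Q) = taylor \<xi> P * taylor \<xi> Q"
  by (induction P) (simp_all add: taylor_add taylor_smult taylor_pCons algebra_simps)

lemma taylor_1 [simp]: "taylor \<xi> 1 = 1"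
  by (simp add: taylor_def pcompose_1)

lemma taylor_power: "taylor \<xi> (P ^ k) = taylor \<xi> P ^ k"
  by (induction k) (simp_all add: taylor_mult)

lemma taylor_sum: "taylor \<xi> (sum f A) = (\<Sum>i\<in>A. taylor \<xi> (f i))"
  by (induction A rule: infinite_finite_induct) (simp_all add: taylor_add)

lemma poly_taylor: "poly (taylor \<xi> P) y = eval_over poly_T P (\<xi> + y)"
  by (simp add: taylor_def eval_over_def poly_pcompose)

lemma coeff_taylor_0: "coeff (taylor \<xi> P) 0 = eval_over poly_T P \<xi>"
  using poly_taylor[of \<xi> P 0] by (simp add: poly_0_coeff_0)

lemma degree_map_poly_T [simp]: "degree (map_poly poly_T P) = degree P"
  by (rule degree_map_poly) simp

lemma degree_taylor_le: "degree (taylor \<xi> P) \<le> degree P"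
  using degree_pcompose_le[of "map_poly poly_T P" "[:\<xi>, 1:]"] by (simp add: taylor_def)

lemma map_poly_T_eq_pcompose_taylor: "map_poly poly_T P = pcompose (taylor \<xi> P) [:- \<xi>, 1:]"
  by (simp add: taylor_def pcompose_pCons flip: pcompose_assoc)

text \<open>Each Horner step multiplies by \<open>a\<close> plus the variable and costs at most a
  factor \<open>L\<close>. Applied with \<open>\<xi>\<close> and with \<open>- \<xi>\<close>, this
  shows that the height and the largest Taylor coefficient agree up to the factor
  \<open>L ^ n\<close>.\<close>

lemma laurent_abs_coeff_pcompose_le:
  assumes "\<And>i. laurent_abs (coeff F i) \<le> M" and "laurent_abs a \<le> L" and "1 \<le> L" and "degree F \<le> n"
  shows "laurent_abs (coeff (pcompose F [:a, 1:]) i) \<le> L ^ n * M"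
proof -
  have M: "0 \<le> M" using assms(1)[of 0] laurent_abs_nonneg order_trans by blast
  have "laurent_abs (coeff (pcompose F [:a, 1:]) i) \<le> L ^ degree F * M"
    using assms(1)
  proof (induction F arbitrary: i)
    case (pCons c F)
    show ?case
    proof (cases "F = 0")
      case True
      with pCons.prems[of 0] M show ?thesis by (simp add: pcompose_pCons coeff_pCons split: nat.split)
    next
      case False
      define G where "G = pcompose F [:a, 1:]"
      have G: "laurent_abs (coeff G i) \<le> L ^ degree F * M" for i
        unfolding G_def by (rule pCons.IH) (use pCons.prems[of "Suc _"] in simp)
      have "laurent_abs (a * coeff G i) \<le> L * (L ^ degree F * M)" for i
        unfolding laurent_abs_mult by (rule mult_mono) (use assms(2,3) G in auto)
      moreover have "laurent_abs (coeff G i) \<le> L * (L ^ degree F * M)" for i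
      proof -
        have "1 * (L ^ degree F * M) \<le> L * (L ^ degree F * M)"
          using assms(3) M by (intro mult_right_mono mult_nonneg_nonneg zero_le_power) auto
        with G[of i] show ?thesis by linarith
      qed
      moreover have "laurent_abs c \<le> L * (L ^ degree F * M)"
      proof -
        have "1 * M \<le> L ^ Suc (degree F) * M"
          using assms(3) M by (intro mult_right_mono one_le_power) auto
        then show ?thesis using pCons.prems[of 0] by simp
      qed
      ultimately show ?thesis
        using False unfolding pcompose_pCons G_def[symmetric]
        by (cases i) (auto intro!: laurent_abs_add_le simp: mult.assoc)
    qed
  qed (use M in simp)
  also have "\<dots> \<le> L ^ n * M"
    using assms M by (intro mult_right_mono power_increasing) auto
  finally show ?thesis .
qed

lemma laurent_abs_coeff_taylor_le:
  assumes "height P \<le> M" and "laurent_abs \<xi> \<le> L" and "1 \<le> L" and "degree P \<le> n"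
  shows "laurent_abs (coeff (taylor \<xi> P) i) \<le> L ^ n * M"
  unfolding taylor_def
  by (rule laurent_abs_coeff_pcompose_le)
    (use assms laurent_abs_coeff_le_height[of P] in \<open>auto simp: coeff_map_poly intro: order_trans\<close>)

lemma height_le_taylor:
  assumes "\<And>i. laurent_abs (coeff (taylor \<xi> P) i) \<le> M"
    and "laurent_abs \<xi> \<le> L" and "1 \<le> L" and "degree P \<le> n"
  shows "height P \<le> L ^ n * M"
proof (rule height_leI)
  fix i
  have "poly_T (coeff P i) = coeff (pcompose (taylor \<xi> P) [:- \<xi>, 1:]) i"
    by (simp add: coeff_map_poly flip: map_poly_T_eq_pcompose_taylor)
  also have "laurent_abs \<dots> \<le> L ^ n * M"
    by (rule laurent_abs_coeff_pcompose_le)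
      (use assms degree_taylor_le[of \<xi> P] in \<open>auto intro: order_trans\<close>)
  finally show "laurent_abs (poly_T (coeff P i)) \<le> L ^ n * M" .
qed

section \<open>Small Taylor coefficients by the box principle\<close>

lemma laurent_abs_bound_exists:
  obtains N where "laurent_abs (\<xi> :: 'a::{field,finite} fls) \<le> real CARD('a) ^ N"
  using real_arch_pow[OF card_field_gt_1[where 'a='a], of "laurent_abs \<xi>"] by (meson less_imp_le)

text \<open>A form of Minkowski's theorem on linear forms, by the box principle.\<close>

lemma minkowski_taylor:
  fixes \<xi> :: "'a::{field,finite} fls"
  shows "\<exists>K :: nat. \<forall>b :: nat \<Rightarrow> int. int K \<le> (\<Sum>i\<le>n. b i) \<longrightarrow>
    (\<exists>P. P \<noteq> 0 \<and> degree P \<le> n \<and>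
      (\<forall>i\<le>n. laurent_abs (coeff (taylor \<xi> P) i) \<le> real CARD('a) powi b i))"
proof -
  obtain N where N: "laurent_abs \<xi> \<le> real CARD('a) ^ N"
    by (rule laurent_abs_bound_exists)
  \<comment> \<open>If the coefficients of \<open>P\<close> have degree at most \<open>D\<close> in
    \<open>T\<close>, its Taylor coefficients are at most \<open>q\<close> to the power
    \<open>D' = D + N * n\<close>. The conditions then number (n + 1) D' minus the sum of the
    \<open>b i\<close>, against (n + 1) (D + 1) free coefficients; \<open>?K\<close> pays for the
    surplus (n + 1) N n.\<close>
  let ?K = "(n + 1) * (N * n)"
  have "\<exists>P. P \<noteq> 0 \<and> degree P \<le> n \<and>
      (\<forall>i\<le>n. laurent_abs (coeff (taylor \<xi> P) i) \<le> real CARD('a) powi b i)"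
    if b: "int ?K \<le> (\<Sum>i\<le>n. b i)" for b :: "nat \<Rightarrow> int"
  proof -
    define D where "D = nat (\<Sum>i\<le>n. \<bar>b i\<bar>)"
    have D: "b i \<le> int D" if "i \<le> n" for i
    proof -
      have "\<bar>b i\<bar> \<le> (\<Sum>i\<le>n. \<bar>b i\<bar>)"
        by (rule member_le_sum) (use that in auto)
      then show ?thesis unfolding D_def by linarith
    qed
    define D' where "D' = D + N * n"
    define I where "I = {..n} \<times> {..D}"
    \<comment> \<open>The positions at which the \<open>i\<close>-th Taylor coefficient has to
      vanish to be at most \<open>q\<close> to the power \<open>b i\<close>; below
      \<open>- D'\<close> it vanishes anyway. As \<open>D\<close> bounds every \<open>b i\<close>,
      none of the interval lengths \<open>D' - b i\<close> is negative.\<close>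
    define J where "J = (SIGMA i:{..n}. {- int D'..<- b i})"
    define mk where "mk = (\<lambda>f :: nat \<times> nat \<Rightarrow> 'a.
      \<Sum>i\<le>n. monom (\<Sum>j\<le>D. monom (f (i, j)) j) i)"
    define g where "g = (\<lambda>f. \<lambda>(i, k)\<in>J. fls_nth (coeff (taylor \<xi> (mk f)) i) k)"
    have mk: "coeff (coeff (mk f) i) j = (if i \<le> n \<and> j \<le> D then f (i, j) else 0)" for f i j
      by (simp add: mk_def coeff_sum)
    have "finite J" by (auto simp: J_def)
    have cJ: "int (card J) = (\<Sum>i\<le>n. int D' - b i)"
    proof -
      have "card J = (\<Sum>i\<le>n. card {- int D'..<- b i})"
        unfolding J_def by (rule card_SigmaI) auto
      then have "int (card J) = (\<Sum>i\<le>n. int (nat (int D' - b i)))"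
        by simp
      also have "\<dots> = (\<Sum>i\<le>n. int D' - b i)"
      proof (rule sum.cong)
        show "int (nat (int D' - b i)) = int D' - b i" if "i \<in> {..n}" for i
          using D[of i] that unfolding D'_def by (simp add: add_increasing2)
      qed simp
      finally show ?thesis .
    qed
    have "int (card J) < int (card I)"
    proof -
      have "int (card J) = int (n + 1) * int D' - (\<Sum>i\<le>n. b i)"
        unfolding cJ sum_subtractf by simp
      also have "\<dots> \<le> int (n + 1) * int D' - int ?K" using b by linarith
      also have "\<dots> = int (n + 1) * int D" by (simp add: D'_def algebra_simps)
      also have "\<dots> < int (card I)" by (simp add: I_def algebra_simps)
      finally show ?thesis .
    qed
    then have "CARD('a) ^ card J < CARD('a) ^ card I"
      using card_field_gt_1[where 'a='a] by simp
    moreover have "card (g ` (I \<rightarrow>\<^sub>E UNIV)) \<le> card (J \<rightarrow>\<^sub>E (UNIV :: 'a set))"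
      by (rule card_mono) (use \<open>finite J\<close> in \<open>auto simp: g_def intro!: finite_PiE\<close>)
    ultimately have "card (g ` (I \<rightarrow>\<^sub>E UNIV)) < card (I \<rightarrow>\<^sub>E (UNIV :: 'a set))"
      using \<open>finite J\<close> by (simp add: card_funcsetE I_def)
    \<comment> \<open>Two coefficient choices with the same image under \<open>g\<close> have a
      difference whose Taylor coefficients vanish at all positions of \<open>J\<close>.\<close>
    then have "\<not> inj_on g (I \<rightarrow>\<^sub>E UNIV)" by (rule pigeonhole)
    then obtain f1 f2 where f: "f1 \<in> I \<rightarrow>\<^sub>E UNIV" "f2 \<in> I \<rightarrow>\<^sub>E UNIV" "f1 \<noteq> f2" "g f1 = g f2"
      by (auto simp: inj_on_def)
    define P where "P = mk f1 - mk f2"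
    have cP: "coeff (coeff P i) j = (if i \<le> n \<and> j \<le> D then f1 (i, j) - f2 (i, j) else 0)" for i j
      by (simp add: P_def mk)
    from f obtain i j where "(i, j) \<in> I" "f1 (i, j) \<noteq> f2 (i, j)"
      by (metis PiE_ext surj_pair)
    then have "coeff (coeff P i) j \<noteq> 0" by (simp add: cP I_def)
    then have "P \<noteq> 0" by auto
    moreover have dP: "degree P \<le> n"
      by (rule degree_le) (auto simp: poly_eq_iff cP)
    moreover have "laurent_abs (coeff (taylor \<xi> P) i) \<le> real CARD('a) powi b i" if "i \<le> n" for i
      unfolding laurent_abs_le_powi_iff
    proof (intro allI impI)
      fix k assume k: "k < - b i"
      show "fls_nth (coeff (taylor \<xi> P) i) k = 0"
      proof (cases "k < - int D'")
        case True
        have "height P \<le> real CARD('a) ^ D"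
          unfolding height_le_iff by (auto intro!: degree_le simp: cP)
        then have "laurent_abs (coeff (taylor \<xi> P) i) \<le> (real CARD('a) ^ N) ^ n * real CARD('a) ^ D"
          using N dP card_field_gt_1[where 'a='a]
          by (intro laurent_abs_coeff_taylor_le) (auto intro: one_le_power)
        also have "\<dots> = real CARD('a) powi int D'"
          
          by (simp only: D'_def power_int_of_nat power_add power_mult) (simp only: mult.commute)
        finally show ?thesis using True unfolding laurent_abs_le_powi_iff by blast
      next
        case False
        with k that have J: "(i, k) \<in> J" by (simp add: J_def)
        have "g f1 (i, k) = g f2 (i, k)" using f by simp
        then show ?thesis using J by (simp add: g_def P_def taylor_diff)
      qed
    qed
    ultimately show ?thesis by blast
  qed
  then show ?thesis by blast
qed

text \<open>
  The jet bounds force the linear Taylor coefficient to dominate, since otherwise the polynomial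
  would have small height and contradict the lower bound for \<open>P(\<xi>)\<close>; then Hensel's lemma applies.
\<close>

lemma algebraic_approximation_of_lower_bound:
  fixes \<xi> :: "'a::{field,finite} fls"
  assumes n: "n \<ge> 1" and \<xi>: "\<not> algebraic_deg_le poly_T n \<xi>"
  shows "\<exists>K :: nat. \<forall>A B m. - A \<le> m \<longrightarrow> A + int K \<le> B + (int n - 1) * m \<longrightarrow>
    (\<forall>P. P \<noteq> 0 \<longrightarrow> degree P \<le> n \<longrightarrow> height P \<le> real CARD('a) powi (m + int K) \<longrightarrow>
      laurent_abs (coeff (taylor \<xi> P) 1) \<le> real CARD('a) powi m \<longrightarrow>
      laurent_abs (eval_over poly_T P \<xi>) > real CARD('a) powi (- A)) \<longrightarrow>
    (\<exists>\<alpha>. algebraic_deg_le poly_T n \<alpha> \<and> alg_height poly_T \<alpha> \<le> real CARD('a) powi (B + int K) \<and>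
      0 < laurent_abs (\<xi> - \<alpha>) \<and>
      laurent_abs (\<xi> - \<alpha>) * alg_height poly_T \<alpha> \<le> real CARD('a) powi (int K - A))"
proof -
  let ?q = "real CARD('a)"
  have q: "?q > 1" by (rule card_field_gt_1)
  obtain K1 :: nat where K1: "\<And>b :: nat \<Rightarrow> int. int K1 \<le> (\<Sum>i\<le>n. b i) \<Longrightarrow>
    \<exists>P. P \<noteq> 0 \<and> degree P \<le> n \<and> (\<forall>i\<le>n. laurent_abs (coeff (taylor \<xi> P) i) \<le> ?q powi b i)"
    using minkowski_taylor[of n \<xi>] by auto
  obtain N where N: "laurent_abs \<xi> \<le> ?q ^ N"
    by (rule laurent_abs_bound_exists)
  \<comment> \<open>\<open>K1\<close> comes from the box principle, and \<open>N * n\<close> is the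
    loss in passing from Taylor coefficients to the height.\<close>
  define K where "K = K1 + N * n"
  show ?thesis
  proof (intro exI[of _ K] allI impI)
    fix A B m :: int
    assume m: "- A \<le> m" and AB: "A + int K \<le> B + (int n - 1) * m"
      and lower: "\<forall>P. P \<noteq> 0 \<longrightarrow> degree P \<le> n \<longrightarrow> height P \<le> ?q powi (m + int K) \<longrightarrow>
        laurent_abs (coeff (taylor \<xi> P) 1) \<le> ?q powi m \<longrightarrow>
        laurent_abs (eval_over poly_T P \<xi>) > ?q powi (- A)"
    \<comment> \<open>The value may reach \<open>- A\<close>, the derivative \<open>B\<close>, each
      higher coefficient \<open>m\<close>. The total is \<open>- A + B + (int n - 1) * m\<close>,
      which by \<open>AB\<close> suffices for the box principle.\<close>
    define b where "b = (\<lambda>i :: nat. if i = 0 then - A else if i = 1 then B else m)"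
    have "(\<Sum>i\<le>n. b i) = (\<Sum>i\<in>insert 0 (insert 1 {2..n}). b i)"
      by (rule sum.cong) (use n in auto)
    also have "\<dots> = - A + B + (\<Sum>i\<in>{2..n}. b i)"
      by (simp add: b_def)
    also have "(\<Sum>i\<in>{2..n}. b i) = (\<Sum>i\<in>{2..n}. m)"
      by (rule sum.cong) (auto simp: b_def)
    also have "\<dots> = (int n - 1) * m"
      using n by (simp add: of_nat_diff)
    finally have "int K1 \<le> (\<Sum>i\<le>n. b i)"
      using AB of_nat_mono[of K1 K] unfolding K_def by linarith
    from K1[OF this] obtain P where P: "P \<noteq> 0" "degree P \<le> n"
      and Pb: "\<And>i. i \<le> n \<Longrightarrow> laurent_abs (coeff (taylor \<xi> P) i) \<le> ?q powi b i"
      by blast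
    let ?c = "\<lambda>i. laurent_abs (coeff (taylor \<xi> P) i)"
    have c0: "?c 0 \<le> ?q powi (- A)" using Pb[of 0] by (simp add: b_def)
    have c1: "?c 1 \<le> ?q powi B" using Pb[of 1] n by (simp add: b_def)
    have ci: "?c i \<le> ?q powi m" if "i \<ge> 2" for i
    proof (cases "i \<le> n")
      case False
      then show ?thesis
        using degree_taylor_le[of \<xi> P] P(2) by (simp add: coeff_eq_0)
    qed (use Pb[of i] that in \<open>simp add: b_def\<close>)
    have K': "?q powi (int N * int n) \<le> ?q powi int K" "int N * int n \<le> int K"
      unfolding K_def using q by (auto intro!: power_int_increasing)
    have c0m: "?c 0 \<le> ?q powi m"
      using c0 m powi_card_le_iff[of "- A" m, where 'a='a] by linarith
    have ht: "height P \<le> ?q powi int K * M" if M: "\<And>i. ?c i \<le> M" for M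
    proof -
      have "height P \<le> (?q ^ N) ^ n * M"
        by (rule height_le_taylor[OF M N]) (use P q in \<open>auto intro: one_le_power\<close>)
      also have "(?q ^ N) ^ n = ?q powi (int N * int n)"
        by (simp add: power_mult flip: of_nat_mult)
      also have "\<dots> * M \<le> ?q powi int K * M"
        by (rule mult_right_mono[OF K'(1)]) (use M[of 0] laurent_abs_nonneg order_trans in blast)
      finally show ?thesis .
    qed
    have big: "?c 1 > ?q powi m"
    proof (rule ccontr)
      assume "\<not> ?c 1 > ?q powi m"
      then have "?c i \<le> ?q powi m" for i
        using ci c0m by (metis One_nat_def Suc_1 less_2_cases linorder_not_less)
      from ht[OF this] have "height P \<le> ?q powi (m + int K)"
        using q by (simp add: power_int_add mult.commute)
      from lower[rule_format, OF P this] c0 \<open>\<not> ?c 1 > ?q powi m\<close> show False by (simp add: coeff_taylor_0)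
    qed
    have pm: "?q powi m > 0" using q by simp
    have c01: "?c 0 < ?c 1" using c0m big by linarith
    have hP: "height P \<le> ?q powi int K * ?c 1"
    proof (rule ht)
      fix i :: nat
      consider "i = 0" | "i = 1" | "i \<ge> 2" by linarith
      then show "?c i \<le> ?c 1"
        using ci[of i] c01 big by cases auto
    qed
    have c1pos: "?c 1 > 0" using big pm by linarith
    obtain y where y: "poly (taylor \<xi> P) y = 0" "laurent_abs y \<le> ?c 0 / ?c 1"
    proof (rule hensel_root)
      show "coeff (taylor \<xi> P) 1 \<noteq> 0" using c1pos by auto
      fix i :: nat assume i: "i \<ge> 2"
      have "?c i * ?c 0 ^ (i - 1) \<le> ?c i * ?c 1 ^ (i - 1)"
        using c01 by (intro mult_left_mono power_mono) auto
      also have "\<dots> < ?c 1 * ?c 1 ^ (i - 1)"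
        using ci[OF i] big c1pos by (intro mult_strict_right_mono) auto
      also have "\<dots> = ?c 1 ^ i"
        using i by (simp flip: power_Suc)
      finally show "?c i * ?c 0 ^ (i - 1) < ?c 1 ^ i" .
    qed
    define \<alpha> where "\<alpha> = \<xi> + y"
    have ev: "eval_over poly_T P \<alpha> = 0" using y(1) by (simp add: poly_taylor \<alpha>_def)
    have alg: "algebraic_deg_le poly_T n \<alpha>" using P ev by (intro base.algebraic_deg_leI)
    have hle: "alg_height poly_T \<alpha> \<le> height P" using P ev by (intro base.alg_height_le)
    have "\<xi> \<noteq> \<alpha>" using alg \<xi> by auto
    moreover have "alg_height poly_T \<alpha> \<le> ?q powi (B + int K)"
    proof -
      have "height P \<le> ?q powi int K * ?q powi B"
        using order_trans[OF hP mult_left_mono[OF c1]] q by simp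
      with hle q show ?thesis by (simp add: power_int_add mult.commute)
    qed
    moreover have "laurent_abs (\<xi> - \<alpha>) * alg_height poly_T \<alpha> \<le> ?q powi (int K - A)"
    proof -
      \<comment> \<open>The linear coefficient cancels between the distance and the height, so the
        quality is governed by |P(\<xi>)| alone.\<close>
      have "laurent_abs (\<xi> - \<alpha>) * alg_height poly_T \<alpha> \<le> (?c 0 / ?c 1) * (?q powi int K * ?c 1)"
        using y(2) hle hP base.alg_height_ge_1[OF alg]
        by (intro mult_mono) (auto simp: \<alpha>_def)
      also have "\<dots> = ?q powi int K * ?c 0" using c1pos by simp
      also have "\<dots> \<le> ?q powi int K * ?q powi (- A)"
        using c0 q by (intro mult_left_mono) auto
      also have "\<dots> = ?q powi (int K - A)"
        using q power_int_add[of ?q "int K" "- A"] by simp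
      finally show ?thesis .
    qed
    ultimately show "\<exists>\<alpha>. algebraic_deg_le poly_T n \<alpha> \<and> alg_height poly_T \<alpha> \<le> ?q powi (B + int K) \<and>
        0 < laurent_abs (\<xi> - \<alpha>) \<and>
        laurent_abs (\<xi> - \<alpha>) * alg_height poly_T \<alpha> \<le> ?q powi (int K - A)"
      using alg by auto
  qed
qed

section \<open>Decomposition into \<open>p\<close>-th powers\<close>

lemma prime_CHAR_finite_field: "prime CHAR('a::{field,finite})"
  using finite_imp_CHAR_pos[where 'a='a] prime_CHAR_semidom[where 'a='a] by simp

text \<open>The Frobenius map is additive with trivial kernel, hence injective, hence surjective on
  a finite field. So coefficients have \<open>p\<close>-th roots.\<close>

lemma frobenius_surj:
  obtains y where "y ^ CHAR('a::{field,finite}) = (x :: 'a)"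
proof -
  let ?p = "CHAR('a)"
  have "inj (\<lambda>y :: 'a. y ^ ?p)"
  proof (rule injI)
    fix y z :: 'a assume *: "y ^ ?p = z ^ ?p"
    have "y ^ ?p = ((y - z) + z) ^ ?p" by simp
    also have "\<dots> = (y - z) ^ ?p + z ^ ?p"
      by (rule freshmans_dream[OF prime_CHAR_finite_field refl])
    finally have "(y - z) ^ ?p = 0" using * by simp
    then show "y = z" by simp
  qed
  then have "surj (\<lambda>y :: 'a. y ^ ?p)"
    by (simp add: finite_UNIV_inj_surj)
  then show ?thesis using that by (metis surjD)
qed

text \<open>By additivity of the Frobenius map, a \<open>p\<close>-th power is a polynomial in the
  \<open>p\<close>-th power of the variable, with coefficients raised to the power \<open>p\<close>.
  This is applied in \<open>X\<close>, in \<open>T\<close> and to Taylor polynomials.\<close>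

lemma coeff_power_CHAR:
  fixes P :: "'b::comm_ring_1 poly"
  assumes "prime CHAR('b)"
  shows "coeff (P ^ CHAR('b)) m = (if CHAR('b) dvd m then coeff P (m div CHAR('b)) ^ CHAR('b) else 0)"
proof (induction P arbitrary: m)
  case 0
  have "CHAR('b) > 0" using assms by (simp add: prime_gt_0_nat)
  then show ?case by (simp add: power_0_left)
next
  case (pCons a P)
  let ?p = "CHAR('b)"
  have p: "?p > 0" using assms by (simp add: prime_gt_0_nat)
  have "pCons a P = [:a:] + monom 1 1 * P"
    by (simp add: monom_Suc)
  also have "\<dots> ^ ?p = [:a:] ^ ?p + (monom 1 1 * P) ^ ?p"
    by (rule freshmans_dream) (use assms in simp_all)
  also have "\<dots> = [:a ^ ?p:] + monom 1 ?p * P ^ ?p"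
    by (simp add: power_mult_distrib monom_power poly_const_pow)
  finally have eq: "coeff (pCons a P ^ ?p) m
      = coeff [:a ^ ?p:] m + (if m < ?p then 0 else coeff (P ^ ?p) (m - ?p))"
    by (simp add: coeff_monom_mult)
  show ?case
  proof (cases "m < ?p")
    case True
    then show ?thesis using p unfolding eq
      by (auto simp: coeff_pCons dvd_imp_le split: nat.split dest: dvd_imp_le)
  next
    case False
    then have "m div ?p = Suc ((m - ?p) div ?p)" "?p dvd m - ?p \<longleftrightarrow> ?p dvd m" "m > 0"
      using p by (auto simp: le_div_geq dvd_minus_self)
    with False show ?thesis
      unfolding eq pCons.IH by (auto simp: coeff_pCons split: nat.split)
  qed
qed

text \<open>The monomials in \<open>X\<close> and \<open>T\<close> with exponents below
  \<open>p\<close> form a basis over the \<open>p\<close>-th powers. \<open>R r j\<close> collects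
  the \<open>p\<close>-th roots of the constants standing at exponents congruent to \<open>r\<close>
  in \<open>X\<close> and to \<open>j\<close> in \<open>T\<close>; dividing exponents by
  \<open>p\<close> gives the bounds on degree and height.\<close>

lemma p_basis_decomposition:
  fixes P :: "'a::{field,finite} poly poly"
  defines "p \<equiv> CHAR('a)"
  shows "\<exists>R. P = (\<Sum>r<p. \<Sum>j<p. monom (monom 1 j) r * R r j ^ p) \<and>
    (\<forall>r j. height (R r j) ^ p \<le> height P) \<and> (\<forall>r j. p * degree (R r j) \<le> degree P)"
proof -
  have p: "prime p" unfolding p_def by (rule prime_CHAR_finite_field)
  then have p0: "p > 0" by (rule prime_gt_0_nat)
  obtain rt :: "'a \<Rightarrow> 'a" where rt: "\<And>x. rt x ^ p = x"
    using frobenius_surj unfolding p_def by metis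
  have rt0: "rt 0 = 0" using rt[of 0] by simp
  define R where "R = (\<lambda>r j. \<Sum>i\<le>degree P.
    monom (\<Sum>l\<le>tdeg P. monom (rt (coeff (coeff P (p * i + r)) (p * l + j))) l) i)"
  have R: "coeff (coeff (R r j) i) l = rt (coeff (coeff P (p * i + r)) (p * l + j))" for r j i l
  proof -
    have "coeff P (p * i + r) = 0" if "i > degree P"
    proof (rule coeff_eq_0)
      have "1 * i \<le> p * i" using p0 by (intro mult_right_mono) auto
      with that show "degree P < p * i + r" by linarith
    qed
    moreover have "coeff (coeff P (p * i + r)) (p * l + j) = 0" if "l > tdeg P"
    proof (rule coeff_eq_0)
      have "1 * l \<le> p * l" using p0 by (intro mult_right_mono) auto
      with that degree_coeff_le_tdeg[of P "p * i + r"]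
      show "degree (coeff P (p * i + r)) < p * l + j" by linarith
    qed
    ultimately show ?thesis
      by (cases "i \<le> degree P"; cases "l \<le> tdeg P") (auto simp: R_def coeff_sum rt0)
  qed
  have Rp: "coeff (coeff (R r j ^ p) a) b =
      (if p dvd a \<and> p dvd b then coeff (coeff P (a + r)) (b + j) else 0)" for r j a b
    using p coeff_power_CHAR[of "R r j" a] coeff_power_CHAR[of "coeff (R r j) (a div p)" b]
    by (simp add: p_def[symmetric] R rt)
  show ?thesis
  proof (intro exI[of _ R] conjI allI)
    have "coeff (coeff (\<Sum>r<p. \<Sum>j<p. monom (monom 1 j) r * R r j ^ p) a) b
        = coeff (coeff P a) b" for a b
    proof -
      have "coeff (coeff (\<Sum>r<p. \<Sum>j<p. monom (monom 1 j) r * R r j ^ p) a) b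
          = (\<Sum>r<p. \<Sum>j<p. if r = a mod p \<and> j = b mod p then coeff (coeff P a) b else 0)"
        unfolding coeff_sum
      proof (intro sum.cong refl)
        fix r j assume rj: "r \<in> {..<p}" "j \<in> {..<p}"
        \<comment> \<open>At the exponents \<open>a\<close> and \<open>b\<close> only the pair of
          residues \<open>a mod p\<close>, \<open>b mod p\<close> contributes.\<close>
        have *: "u \<le> v \<and> p dvd v - u \<longleftrightarrow> u = v mod p" if "u < p" for u v
        proof
          assume "u \<le> v \<and> p dvd v - u"
          then have "v mod p = u mod p" by (metis mod_eq_dvd_iff_nat)
          with that show "u = v mod p" by simp
        next
          assume "u = v mod p"
          then show "u \<le> v \<and> p dvd v - u"
            by (simp add: minus_mod_eq_mult_div mod_less_eq_dividend)
        qed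
        show "coeff (coeff (monom (monom 1 j) r * R r j ^ p) a) b
            = (if r = a mod p \<and> j = b mod p then coeff (coeff P a) b else 0)"
          using *[of r a] *[of j b] rj by (auto simp: coeff_monom_mult Rp)
      qed
      also have "\<dots> = (\<Sum>r<p. if r = a mod p then \<Sum>j<p. if j = b mod p then coeff (coeff P a) b else 0 else 0)"
        by (intro sum.cong refl) auto
      also have "\<dots> = coeff (coeff P a) b"
        using p0 by (simp add: sum.delta)
      finally show ?thesis .
    qed
    then show "P = (\<Sum>r<p. \<Sum>j<p. monom (monom 1 j) r * R r j ^ p)"
      by (simp add: poly_eq_iff)
  next
    fix r j
    show "height (R r j) ^ p \<le> height P"
    proof (cases "R r j = 0")
      case False
      obtain i where i: "degree (coeff (R r j) i) = tdeg (R r j)" "coeff (R r j) i \<noteq> 0"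
        by (rule tdeg_attained[OF False])
      then have "lead_coeff (coeff (R r j) i) \<noteq> 0" by (metis leading_coeff_0_iff)
      then have "coeff (coeff P (p * i + r)) (p * tdeg (R r j) + j) \<noteq> 0"
        unfolding i(1) R using rt0 by auto
      then have "p * tdeg (R r j) + j \<le> tdeg P" and "P \<noteq> 0"
        using le_degree degree_coeff_le_tdeg order_trans by (blast, auto)
      then have "real CARD('a) ^ (tdeg (R r j) * p) \<le> real CARD('a) ^ tdeg P"
        using card_field_gt_1[where 'a='a] by (intro power_increasing) (auto simp: mult.commute)
      then show ?thesis
        using False \<open>P \<noteq> 0\<close> by (simp add: height_eq power_mult)
    qed (use p0 height_nonneg in \<open>simp add: power_0_left\<close>)
    show "p * degree (R r j) \<le> degree P"
    proof (cases "R r j = 0")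
      case False
      let ?i = "degree (R r j)"
      have "coeff (R r j) ?i \<noteq> 0" using False by simp
      then obtain l where "coeff (coeff (R r j) ?i) l \<noteq> 0"
        by (metis leading_coeff_0_iff)
      then have "coeff P (p * ?i + r) \<noteq> 0"
        unfolding R using rt0 by auto
      then have "p * ?i + r \<le> degree P" by (rule le_degree)
      then show ?thesis by simp
    qed simp
  qed
qed

text \<open>A strictly largest summand exceeds the sum of all others, so it cannot be
  cancelled.\<close>

lemma laurent_abs_le_sum_distinct:
  fixes f :: "'b \<Rightarrow> 'a::{field,finite} fls"
  assumes "finite A" and "i \<in> A"
    and distinct: "\<And>x y. x \<in> A \<Longrightarrow> y \<in> A \<Longrightarrow> f x \<noteq> 0 \<Longrightarrow> laurent_abs (f x) = laurent_abs (f y) \<Longrightarrow> x = y"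
  shows "laurent_abs (f i) \<le> laurent_abs (sum f A)"
proof -
  obtain m where m: "m \<in> A" and max: "\<And>x. x \<in> A \<Longrightarrow> laurent_abs (f x) \<le> laurent_abs (f m)"
  proof -
    have "Max ((\<lambda>x. laurent_abs (f x)) ` A) \<in> (\<lambda>x. laurent_abs (f x)) ` A"
      using assms by (intro Max_in) auto
    then obtain m where "m \<in> A" "Max ((\<lambda>x. laurent_abs (f x)) ` A) = laurent_abs (f m)" by auto
    then show ?thesis
      by (intro that[of m]) (use assms Max_ge in \<open>auto simp flip: \<open>_ = laurent_abs (f m)\<close>\<close>)
  qed
  have "laurent_abs (f m) \<le> laurent_abs (sum f A)"
  proof (cases "f m = 0")
    case False
    have rest: "laurent_abs (sum f (A - {m})) < laurent_abs (f m)"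
    proof (cases "sum f (A - {m}) = 0")
      case nz: False
      obtain x where x: "x \<in> A - {m}" "laurent_abs (sum f (A - {m})) \<le> laurent_abs (f x)"
        using laurent_abs_sum_ge_exists[OF _ nz] assms(1) by blast
      have "laurent_abs (f x) \<noteq> laurent_abs (f m)"
        using distinct[of m x] m x(1) False by auto
      with x max[of x] show ?thesis by force
    qed (use False in simp)
    have "f m = sum f A - sum f (A - {m})"
      using assms(1) m by (simp add: sum_diff1)
    with rest show ?thesis
      using laurent_abs_diff_le[of "sum f A" _ "sum f (A - {m})"]
      by (metis linorder_not_less max.cobounded1 max.cobounded2 max_less_iff_conj)
  qed simp
  with max[OF assms(2)] show ?thesis by linarith
qed

text \<open>The valuation of a nonzero \<open>j\<close>-th summand is congruent to
  \<open>- j\<close> modulo \<open>p\<close>, so nonzero summands have distinct absolute values: the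
  powers of \<open>T\<close> below \<open>p\<close> are orthogonal over the \<open>p\<close>-th
  powers.\<close>

lemma laurent_abs_le_sum_p_basis:
  fixes z :: "nat \<Rightarrow> 'a::{field,finite} fls"
  assumes "i < p"
  shows "laurent_abs (fls_X_inv ^ i * z i ^ p) \<le> laurent_abs (\<Sum>j<p. fls_X_inv ^ j * z j ^ p)"
proof (rule laurent_abs_le_sum_distinct)
  fix x y assume xy: "x \<in> {..<p}" "y \<in> {..<p}" and nz: "fls_X_inv ^ x * z x ^ p \<noteq> 0"
    and eq: "laurent_abs (fls_X_inv ^ x * z x ^ p) = laurent_abs (fls_X_inv ^ y * z y ^ p)"
  have nz': "fls_X_inv ^ y * z y ^ p \<noteq> 0" using eq nz by (metis laurent_abs_eq_0_iff)
  have "fls_subdegree (fls_X_inv ^ x * z x ^ p) = fls_subdegree (fls_X_inv ^ y * z y ^ p)"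
    using eq unfolding laurent_abs_ex_powi[OF nz] laurent_abs_ex_powi[OF nz']
    by (metis powi_card_le_iff neg_equal_iff_equal order_antisym order_refl)
  then have "- int x + int p * fls_subdegree (z x) = - int y + int p * fls_subdegree (z y)"
    using nz nz' by (simp add: fls_subdegree_pow)
  then have "int x - int y = int p * (fls_subdegree (z x) - fls_subdegree (z y))"
    by (simp add: algebra_simps)
  then have "int x mod int p = int y mod int p"
    by (simp add: mod_eq_dvd_iff)
  with xy show "x = y" by simp
qed (use assms in auto)

section \<open>Descent from \<open>C\<^sub>\<infinity>\<close> to the Laurent series field\<close>

lemma poly_T_of_nat: "poly_T (of_nat m * c) = of_nat m * poly_T c"
  by (induction m) (simp_all add: poly_T_add algebra_simps)

lemma taylor_pderiv: "taylor \<xi> (pderiv P) = pderiv (taylor \<xi> P)"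
proof -
  have "map_poly poly_T (pderiv P) = pderiv (map_poly poly_T P)"
    by (rule poly_eqI) (simp add: coeff_map_poly coeff_pderiv poly_T_of_nat del: of_nat_Suc)
  then show ?thesis
    by (simp add: taylor_def pderiv_pcompose pderiv_pCons)
qed

lemma height_pderiv_le:
  fixes P :: "'a::{field,finite} poly poly"
  shows "height (pderiv P) \<le> height P"
proof (rule height_leI)
  fix i
  have "laurent_abs (poly_T (coeff (pderiv P) i))
      = laurent_abs (of_nat (Suc i) :: 'a fls) * laurent_abs (poly_T (coeff P (Suc i)))"
    by (simp add: coeff_pderiv poly_T_of_nat laurent_abs_mult del: of_nat_Suc)
  also have "\<dots> \<le> 1 * height P"
    by (intro mult_mono laurent_abs_of_nat_le_1 laurent_abs_coeff_le_height) simp_all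
  finally show "laurent_abs (poly_T (coeff (pderiv P) i)) \<le> height P" by simp
qed

lemma poly_T_monom: "poly_T (monom 1 j) = fls_X_inv ^ j"
  by (induction j) (simp_all add: poly_T_pCons monom_0 monom_Suc)

lemma taylor_monom: "taylor \<xi> (monom c r) = smult (poly_T c) ([:\<xi>, 1:] ^ r)"
  by (induction r) (simp_all add: taylor_pCons monom_0 monom_Suc)

text \<open>
  Both the height and the distance of the root, read off from the Newton polygon at \<open>\<xi>\<close>, are raised to
  the power \<open>1/p\<close>, so that the quality of the approximation is preserved.
\<close>

lemma p_basis_descent_step:
  fixes \<xi> :: "'a::{field,finite} fls"
  defines "p \<equiv> CHAR('a)"
  shows "\<exists>K \<ge> 1. \<forall>P \<rho> k. 0 < \<rho> \<longrightarrow> \<rho> \<le> 1 \<longrightarrow> p \<le> k \<longrightarrow> coeff (taylor \<xi> P) k \<noteq> 0 \<longrightarrow>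
    (\<forall>i. laurent_abs (coeff (taylor \<xi> P) i) * \<rho> ^ i \<le> laurent_abs (coeff (taylor \<xi> P) k) * \<rho> ^ k) \<longrightarrow>
    (\<exists>R. p * degree R \<le> degree P \<and> height R ^ p \<le> height P \<and> coeff (taylor \<xi> R) (k div p) \<noteq> 0 \<and>
      laurent_abs (coeff (taylor \<xi> R) 0) ^ p
        \<le> laurent_abs (coeff (taylor \<xi> R) (k div p)) ^ p * (K * \<rho>) ^ (k div p))"
proof -
  let ?q = "real CARD('a)"
  have p: "prime p" unfolding p_def by (rule prime_CHAR_finite_field)
  then have p0: "p > 0" by (rule prime_gt_0_nat)
  have q: "?q > 1" by (rule card_field_gt_1)
  obtain N where N: "laurent_abs \<xi> \<le> ?q ^ N"
    by (rule laurent_abs_bound_exists)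
  define e where "e = (\<lambda>r s. coeff ([:\<xi>, 1:] ^ r) s)"
  define E where "E = ?q ^ (N * p)"
  have E1: "E \<ge> 1" using q by (simp add: E_def)
  have e: "e r s = of_nat (r choose s) * \<xi> ^ (r - s)" for r s
    by (cases "s \<le> r")
      (simp_all add: e_def coeff_linear_poly_power coeff_eq_0 degree_linear_power binomial_eq_0)
  have e_le: "laurent_abs (e r s) \<le> E" if "r < p" for r s
  proof -
    have "laurent_abs (e r s) \<le> 1 * (?q ^ N) ^ (r - s)"
      unfolding e laurent_abs_mult laurent_abs_power
      using N laurent_abs_of_nat_le_1 by (intro mult_mono power_mono) auto
    also have "\<dots> = ?q ^ (N * (r - s))" by (simp add: power_mult)
    also have "\<dots> \<le> E"
      unfolding E_def using q that by (intro power_increasing mult_left_mono) auto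
    finally show ?thesis .
  qed
  \<comment> \<open>\<open>E ^ p\<close> is the cost of solving the triangular system for the
    \<open>S r 0\<close>; \<open>E * ?q ^ p\<close> is lost when one \<open>R r j\<close> is
    selected at the index \<open>k div p\<close>.\<close>
  define K where "K = E ^ p * (E * ?q ^ p)"
  have K1: "K \<ge> 1"
  proof -
    have "1 * (1 * 1) \<le> K"
      unfolding K_def using E1 q by (intro mult_mono one_le_power) auto
    then show ?thesis by simp
  qed
  show ?thesis
  proof (intro exI[of _ K] conjI K1 allI impI)
    fix P :: "'a poly poly" and \<rho> :: real and k :: nat
    assume \<rho>: "0 < \<rho>" "\<rho> \<le> 1" and k: "p \<le> k" and ck: "coeff (taylor \<xi> P) k \<noteq> 0"
      and dom: "\<forall>i. laurent_abs (coeff (taylor \<xi> P) i) * \<rho> ^ i \<le> laurent_abs (coeff (taylor \<xi> P) k) * \<rho> ^ k"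
    let ?c = "\<lambda>i. coeff (taylor \<xi> P) i"
    obtain R where P: "P = (\<Sum>r<p. \<Sum>j<p. monom (monom 1 j) r * R r j ^ p)"
      and hR: "\<And>r j. height (R r j) ^ p \<le> height P" and dR: "\<And>r j. p * degree (R r j) \<le> degree P"
      using p_basis_decomposition[of P] unfolding p_def[symmetric] by auto
    define S where "S = (\<lambda>r i. \<Sum>j<p. fls_X_inv ^ j * coeff (taylor \<xi> (R r j)) i ^ p)"
    define k' where "k' = k div p"
    have k': "k' \<ge> 1" using k p0 unfolding k'_def by (simp add: div_greater_zero_iff Suc_leI)
    \<comment> \<open>The Taylor polynomial of \<open>R r j ^ p\<close> is a polynomial in the
      \<open>p\<close>-th power of the variable, and that of the factor X^r has degree
      \<open>r < p\<close>. Hence in the convolution at \<open>p * i + s\<close> only the term with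
      \<open>t = s\<close> survives.\<close>
    have c: "?c (p * i + s) = (\<Sum>r<p. e r s * S r i)" if s: "s < p" for i s
    proof -
      have summand: "coeff (taylor \<xi> (monom (monom 1 j) r * R r j ^ p)) (p * i + s)
          = e r s * (fls_X_inv ^ j * coeff (taylor \<xi> (R r j)) i ^ p)" if r: "r < p" for r j
      proof -
        let ?F = "taylor \<xi> (R r j)"
        have Fp: "coeff (?F ^ p) m = (if p dvd m then coeff ?F (m div p) ^ p else 0)" for m
          using coeff_power_CHAR[of ?F m] p by (simp add: p_def)
        have "coeff ([:\<xi>, 1:] ^ r * ?F ^ p) (p * i + s)
            = (\<Sum>t\<le>p * i + s. e r t * coeff (?F ^ p) (p * i + s - t))"
          by (simp add: coeff_mult e_def)
        also have "\<dots> = (\<Sum>t\<in>{s}. e r t * coeff (?F ^ p) (p * i + s - t))"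
        proof (rule sum.mono_neutral_right)
          show "\<forall>t\<in>{..p * i + s} - {s}. e r t * coeff (?F ^ p) (p * i + s - t) = 0"
          proof
            fix t assume t: "t \<in> {..p * i + s} - {s}"
            show "e r t * coeff (?F ^ p) (p * i + s - t) = 0"
            proof (cases "t \<le> r")
              case True
              have "\<not> p dvd p * i + s - t"
              proof
                assume "p dvd p * i + s - t"
                then have "(p * i + s) mod p = t mod p"
                  using t by (metis DiffD1 atMost_iff mod_eq_dvd_iff_nat)
                then show False using t True r s by simp
              qed
              then show ?thesis by (simp add: Fp)
            qed (simp add: e binomial_eq_0)
          qed
        qed auto
        also have "\<dots> = e r s * coeff ?F i ^ p"
          using p0 by (simp add: Fp)
        finally show ?thesis
          by (simp add: taylor_mult taylor_monom taylor_power poly_T_monom mult_ac)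
      qed
      have "?c (p * i + s) = (\<Sum>r<p. \<Sum>j<p. coeff (taylor \<xi> (monom (monom 1 j) r * R r j ^ p)) (p * i + s))"
        by (subst P) (simp add: taylor_sum coeff_sum)
      also have "\<dots> = (\<Sum>r<p. e r s * S r i)"
        unfolding S_def sum_distrib_left by (intro sum.cong refl summand) auto
      finally show ?thesis .
    qed

    \<comment> \<open>Some summand is at least as large as the whole sum, first over
      \<open>r\<close>, then over \<open>j\<close>; this selects the polynomial to descend
      to.\<close>
    obtain r j where rj: "r < p" "j < p"
      and big: "laurent_abs (?c k) \<le> (E * ?q ^ p) * laurent_abs (coeff (taylor \<xi> (R r j)) k') ^ p"
    proof -
      have ckeq: "?c k = (\<Sum>r<p. e r (k mod p) * S r k')"
        using c[of "k mod p" k'] p0 by (simp add: k'_def)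
      then obtain r where r: "r < p" "laurent_abs (?c k) \<le> laurent_abs (e r (k mod p) * S r k')"
        using laurent_abs_sum_ge_exists[of "{..<p}" "\<lambda>r. e r (k mod p) * S r k'"] ck by auto
      then have "S r k' \<noteq> 0" 
        by (metis ck laurent_abs_0 laurent_abs_pos_iff linorder_not_less mult_zero_right)
      then obtain j where j: "j < p"
        "laurent_abs (S r k') \<le> laurent_abs (fls_X_inv ^ j * coeff (taylor \<xi> (R r j)) k' ^ p)"
        using laurent_abs_sum_ge_exists[of "{..<p}" "\<lambda>j. fls_X_inv ^ j * coeff (taylor \<xi> (R r j)) k' ^ p"]
        unfolding S_def by auto
      have "laurent_abs (?c k) \<le> E * (?q ^ p * laurent_abs (coeff (taylor \<xi> (R r j)) k') ^ p)"
      proof -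
        have "laurent_abs (?c k) \<le> laurent_abs (e r (k mod p)) * laurent_abs (S r k')"
          using r by (simp add: laurent_abs_mult)
        also have "\<dots> \<le> E * laurent_abs (S r k')"
          using e_le[OF r(1)] by (intro mult_right_mono) auto
        also have "laurent_abs (S r k') \<le> ?q ^ j * laurent_abs (coeff (taylor \<xi> (R r j)) k') ^ p"
          using j(2) by (simp add: laurent_abs_mult laurent_abs_power)
        also have "\<dots> \<le> ?q ^ p * laurent_abs (coeff (taylor \<xi> (R r j)) k') ^ p"
          using q j(1) by (intro mult_right_mono power_increasing) auto
        finally show ?thesis using E1 by simp
      qed
      with r j that show ?thesis by (simp add: mult.assoc)
    qed
    define m where "m = laurent_abs (?c k) * \<rho> ^ k'"
    have m0: "m \<ge> 0" using \<rho> by (simp add: m_def)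
    have c_le: "laurent_abs (?c s) \<le> m" if "s < p" for s
    proof -
      \<comment> \<open>This holds because \<open>s\<close> is at most \<open>p - 1\<close> and
        \<open>k\<close> is at least \<open>p * k'\<close>. It lets the dominance of
        \<open>k\<close> bound all \<open>?c s\<close> with \<open>s < p\<close> by the single
        quantity \<open>m\<close>.\<close>
      have "s + k' \<le> k"
      proof -
        have "(p - 1) * 1 \<le> (p - 1) * k'" using k' by (intro mult_left_mono) auto
        then have "(p - 1) + k' \<le> (p - 1) * k' + k'" by simp
        also have "\<dots> = p * k'" using p0 by (simp add: algebra_simps diff_mult_distrib)
        also have "\<dots> \<le> k" unfolding k'_def by simp
        finally show ?thesis using that by linarith
      qed
      have "laurent_abs (?c s) * \<rho> ^ s \<le> laurent_abs (?c k) * \<rho> ^ k" using dom by blast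
      also have "\<dots> \<le> laurent_abs (?c k) * \<rho> ^ (s + k')"
        using \<rho> \<open>s + k' \<le> k\<close> by (intro mult_left_mono power_decreasing) auto
      also have "\<dots> = m * \<rho> ^ s"
        unfolding m_def by (simp add: power_add mult_ac)
      finally show ?thesis using \<rho> by simp
    qed
    \<comment> \<open>The system expressing \<open>?c r\<close> by the \<open>S u 0\<close> is
      unitriangular: \<open>e r r = 1\<close>, and \<open>e u r = 0\<close> for
      \<open>u < r\<close>. Solving it from \<open>r = p - 1\<close> downwards costs one factor
      \<open>E\<close> per step.\<close>
    have S_le: "laurent_abs (S r 0) \<le> E ^ (p - r) * m" if "r < p" for r
      using that
    proof (induction "p - r" arbitrary: r rule: less_induct)
      case less
      have "?c r = (\<Sum>u<p. e u r * S u 0)" using c[of r 0] less.prems by simp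
      also have "\<dots> = (\<Sum>u\<in>insert r {r<..<p}. e u r * S u 0)"
        by (rule sum.mono_neutral_right) (use less.prems in \<open>auto simp: e binomial_eq_0\<close>)
      also have "\<dots> = S r 0 + (\<Sum>u\<in>{r<..<p}. e u r * S u 0)"
        by (simp add: e)
      finally have "S r 0 = ?c r - (\<Sum>u\<in>{r<..<p}. e u r * S u 0)" by simp
      also have "laurent_abs \<dots> \<le> E ^ (p - r) * m"
      proof (intro laurent_abs_diff_le laurent_abs_sum_le)
        have "1 * m \<le> E ^ (p - r) * m"
          using E1 m0 by (intro mult_right_mono one_le_power) auto
        with c_le[OF less.prems] show "laurent_abs (?c r) \<le> E ^ (p - r) * m" by simp
        show "0 \<le> E ^ (p - r) * m" using E1 m0 by simp
        fix u assume u: "u \<in> {r<..<p}"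
        have "laurent_abs (e u r * S u 0) \<le> E * (E ^ (p - u) * m)"
          unfolding laurent_abs_mult
          using u e_le less.hyps E1 by (intro mult_mono) auto
        also have "\<dots> = E ^ Suc (p - u) * m" by simp
        also have "\<dots> \<le> E ^ (p - r) * m"
          using E1 m0 u by (intro mult_right_mono power_increasing) auto
        finally show "laurent_abs (e u r * S u 0) \<le> E ^ (p - r) * m" .
      qed
      finally show ?case .
    qed
    let ?d = "\<lambda>i. laurent_abs (coeff (taylor \<xi> (R r j)) i) ^ p"
    have "1 * ?d 0 \<le> ?q ^ j * ?d 0"
      using q by (intro mult_right_mono one_le_power) auto
    also have "\<dots> = laurent_abs (fls_X_inv ^ j * coeff (taylor \<xi> (R r j)) 0 ^ p)"
      by (simp add: laurent_abs_mult laurent_abs_power)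
    \<comment> \<open>Orthogonality passes the bound from the whole sum over \<open>j\<close> to the
      chosen summand.\<close>
    also have "\<dots> \<le> laurent_abs (S r 0)"
      unfolding S_def by (rule laurent_abs_le_sum_p_basis[OF rj(2)])
    also have "\<dots> \<le> E ^ (p - r) * m" by (rule S_le[OF rj(1)])
    also have "\<dots> \<le> E ^ p * m"
      using E1 m0 by (intro mult_right_mono power_increasing) auto
    also have "\<dots> \<le> E ^ p * (((E * ?q ^ p) * ?d k') * \<rho> ^ k')"
      unfolding m_def using E1 \<rho> big by (intro mult_left_mono mult_right_mono) auto
    also have "\<dots> = K * (?d k' * \<rho> ^ k')" by (simp add: K_def)
    \<comment> \<open>Since \<open>k'\<close> is at least 1, the constant can be moved into the
      radius.\<close>
    also have "\<dots> \<le> K ^ k' * (?d k' * \<rho> ^ k')"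
      using K1 k' \<rho> by (intro mult_right_mono self_le_power) auto
    finally have "?d 0 \<le> ?d k' * (K * \<rho>) ^ k'"
      by (simp add: power_mult_distrib mult_ac)
    moreover have "coeff (taylor \<xi> (R r j)) k' \<noteq> 0"
    proof
      assume "coeff (taylor \<xi> (R r j)) k' = 0"
      with big p0 have "laurent_abs (?c k) \<le> 0" by (simp add: power_0_left)
      with ck show False by (metis laurent_abs_pos_iff linorder_not_less)
    qed
    ultimately show "\<exists>R. p * degree R \<le> degree P \<and> height R ^ p \<le> height P \<and>
        coeff (taylor \<xi> R) (k div p) \<noteq> 0 \<and>
        laurent_abs (coeff (taylor \<xi> R) 0) ^ p
          \<le> laurent_abs (coeff (taylor \<xi> R) (k div p)) ^ p * (K * \<rho>) ^ (k div p)"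
      using hR dR unfolding k'_def by blast
  qed
qed

text \<open>Choosing the last maximum makes every later term strictly smaller, as the strict
  inequality in Hensel's lemma demands.\<close>

lemma exists_last_argmax:
  fixes f :: "nat \<Rightarrow> real"
  shows "\<exists>k\<le>N. (\<forall>i\<le>N. f i \<le> f k) \<and> (\<forall>i\<le>N. k < i \<longrightarrow> f i < f k)"
proof -
  define M where "M = Max (f ` {..N})"
  define A where "A = {i. i \<le> N \<and> f i = M}"
  have "M \<in> f ` {..N}" unfolding M_def by (rule Max_in) auto
  then have "A \<noteq> {}" by (auto simp: A_def)
  have fin: "finite A" by (simp add: A_def)
  have le: "f i \<le> M" if "i \<le> N" for i using that unfolding M_def by (intro Max_ge) auto
  have "Max A \<in> A" using fin \<open>A \<noteq> {}\<close> by (rule Max_in)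
  then have A: "Max A \<le> N" "f (Max A) = M" by (simp_all add: A_def)
  have "f i < M" if "i \<le> N" "Max A < i" for i
  proof -
    have "i \<notin> A" using that(2) Max_ge[OF fin, of i] by auto
    with that(1) le[of i] show ?thesis by (auto simp: A_def)
  qed
  with A le show ?thesis by auto
qed

text \<open>
  The hypothesis on \<open>k\<close> says that the Newton polygon of \<open>P\<close> at \<open>\<xi>\<close> shows a root within distance \<open>\<rho>\<close>.
\<close>

lemma near_root_descent:
  fixes \<xi> :: "'a::{field,finite} fls"
  shows "\<exists>D \<ge> 1. \<forall>P \<rho> k. degree P \<le> d \<longrightarrow> 0 < \<rho> \<longrightarrow> D * \<rho> \<le> 1 \<longrightarrow> 1 \<le> k \<longrightarrow>
    coeff (taylor \<xi> P) k \<noteq> 0 \<longrightarrow>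
    laurent_abs (coeff (taylor \<xi> P) 0) \<le> laurent_abs (coeff (taylor \<xi> P) k) * \<rho> ^ k \<longrightarrow>
    (\<exists>Q \<beta> s. Q \<noteq> 0 \<and> degree Q \<le> d \<and> eval_over poly_T Q \<beta> = 0 \<and> s \<le> d \<and>
      height Q ^ (CHAR('a) ^ s) \<le> height P \<and> laurent_abs (\<xi> - \<beta>) ^ (CHAR('a) ^ s) \<le> D * \<rho>)"
proof (induction d)
  case 0
  have "coeff (taylor \<xi> P) k = 0" if "degree P \<le> 0" "1 \<le> k" for P k
    using degree_taylor_le[of \<xi> P] that by (intro coeff_eq_0) linarith
  then show ?case by (intro exI[of _ 1]) auto
next
  case (Suc d)
  let ?p = "CHAR('a)"
  have p: "prime ?p" by (rule prime_CHAR_finite_field)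
  then have p2: "?p \<ge> 2" by (rule prime_ge_2_nat)
  obtain D' where D': "D' \<ge> 1" and IH: "\<And>P \<rho> k. degree P \<le> d \<Longrightarrow> 0 < \<rho> \<Longrightarrow> D' * \<rho> \<le> 1 \<Longrightarrow> 1 \<le> k \<Longrightarrow>
    coeff (taylor \<xi> P) k \<noteq> 0 \<Longrightarrow>
    laurent_abs (coeff (taylor \<xi> P) 0) \<le> laurent_abs (coeff (taylor \<xi> P) k) * \<rho> ^ k \<Longrightarrow>
    \<exists>Q \<beta> s. Q \<noteq> 0 \<and> degree Q \<le> d \<and> eval_over poly_T Q \<beta> = 0 \<and> s \<le> d \<and>
      height Q ^ (?p ^ s) \<le> height P \<and> laurent_abs (\<xi> - \<beta>) ^ (?p ^ s) \<le> D' * \<rho>"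
    using Suc.IH by auto
  obtain K where K: "K \<ge> 1" and step: "\<And>P \<rho> k. 0 < \<rho> \<Longrightarrow> \<rho> \<le> 1 \<Longrightarrow> ?p \<le> k \<Longrightarrow>
    coeff (taylor \<xi> P) k \<noteq> 0 \<Longrightarrow>
    \<forall>i. laurent_abs (coeff (taylor \<xi> P) i) * \<rho> ^ i \<le> laurent_abs (coeff (taylor \<xi> P) k) * \<rho> ^ k \<Longrightarrow>
    \<exists>R. ?p * degree R \<le> degree P \<and> height R ^ ?p \<le> height P \<and> coeff (taylor \<xi> R) (k div ?p) \<noteq> 0 \<and>
      laurent_abs (coeff (taylor \<xi> R) 0) ^ ?p
        \<le> laurent_abs (coeff (taylor \<xi> R) (k div ?p)) ^ ?p * (K * \<rho>) ^ (k div ?p)"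
    using p_basis_descent_step[of \<xi>] by auto
  \<comment> \<open>The descent continues at radius \<rho>' = (K \<rho>)^(1/p), and this choice
    gives (D' \<rho>')^p = D \<rho>.\<close>
  define D where "D = D' ^ ?p * K"
  have "D' ^ 1 * 1 \<le> D' ^ ?p * K"
    using D' K p2 by (intro mult_mono power_increasing) auto
  then have DD': "D' \<le> D" by (simp add: D_def)
  with D' have D1: "D \<ge> 1" by linarith
  show ?case
  proof (intro exI[of _ D] conjI D1 allI impI)
    fix P :: "'a poly poly" and \<rho> :: real and k0 :: nat
    let ?c = "\<lambda>i. laurent_abs (coeff (taylor \<xi> P) i)"
    assume deg: "degree P \<le> Suc d" and \<rho>: "0 < \<rho>" and D\<rho>: "D * \<rho> \<le> 1" and k0: "1 \<le> k0"
      and ck0: "coeff (taylor \<xi> P) k0 \<noteq> 0" and near: "?c 0 \<le> ?c k0 * \<rho> ^ k0"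
    have \<rho>D: "\<rho> \<le> D * \<rho>" "D' * \<rho> \<le> D * \<rho>" using D1 DD' \<rho> by simp_all
    have P0: "P \<noteq> 0" using ck0 by auto
    define N where "N = max k0 (degree P)"
    obtain k where k: "k \<le> N" and kmax: "\<And>i. i \<le> N \<Longrightarrow> ?c i * \<rho> ^ i \<le> ?c k * \<rho> ^ k"
      and klast: "\<And>i. i \<le> N \<Longrightarrow> k < i \<Longrightarrow> ?c i * \<rho> ^ i < ?c k * \<rho> ^ k"
      using exists_last_argmax[of N "\<lambda>i. ?c i * \<rho> ^ i"] by auto
    have zero: "coeff (taylor \<xi> P) i = 0" if "i > N" for i
      using that degree_taylor_le[of \<xi> P] by (intro coeff_eq_0) (simp add: N_def)
    have "0 < ?c k0 * \<rho> ^ k0" using ck0 \<rho> by simp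
    also have "\<dots> \<le> ?c k * \<rho> ^ k" by (rule kmax) (simp add: N_def)
    finally have ck: "coeff (taylor \<xi> P) k \<noteq> 0" by auto
    \<comment> \<open>If 0 were the last maximum, the term at \<open>k0\<close> would be strictly
      smaller than the constant term, against \<open>near\<close>.\<close>
    have k1: "k \<ge> 1"
    proof (rule ccontr)
      assume "\<not> k \<ge> 1"
      then have "k = 0" by simp
      with klast[of k0] near k0 show False by (simp add: N_def)
    qed
    have all: "\<forall>i. ?c i * \<rho> ^ i \<le> ?c k * \<rho> ^ k"
    proof
      show "?c i * \<rho> ^ i \<le> ?c k * \<rho> ^ k" for i
        using kmax[of i] zero[of i] \<rho> by (cases "i \<le> N") auto
    qed
    have above: "?c i * \<rho> ^ i < ?c k * \<rho> ^ k" if "i > k" for i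
      using klast[of i] zero[of i] \<rho> ck that by (cases "i \<le> N") auto
    consider "k = 1" | "2 \<le> k" "k < ?p" | "?p \<le> k" using k1 by linarith
    then show "\<exists>Q \<beta> s. Q \<noteq> 0 \<and> degree Q \<le> Suc d \<and> eval_over poly_T Q \<beta> = 0 \<and> s \<le> Suc d \<and>
      height Q ^ (?p ^ s) \<le> height P \<and> laurent_abs (\<xi> - \<beta>) ^ (?p ^ s) \<le> D * \<rho>"
    proof cases
      case 1
      have c0: "?c 0 \<le> ?c 1 * \<rho>" using spec[OF all, of 0] 1 by simp
      obtain y where y: "poly (taylor \<xi> P) y = 0" "laurent_abs y \<le> ?c 0 / ?c 1"
      proof (rule hensel_root)
        show "coeff (taylor \<xi> P) 1 \<noteq> 0" using ck 1 by simp
        fix i :: nat assume i: "i \<ge> 2"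
        then obtain l where l: "i = Suc l" by (cases i) auto
        have "?c i * \<rho> ^ l < ?c 1"
          using above[of i] 1 i \<rho> by (simp add: l)
        moreover have "?c 1 ^ l > 0" using ck 1 by simp
        ultimately have "?c i * \<rho> ^ l * ?c 1 ^ l < ?c 1 * ?c 1 ^ l"
          by (rule mult_strict_right_mono)
        moreover have "?c i * ?c 0 ^ l \<le> ?c i * (?c 1 * \<rho>) ^ l"
          using c0 by (intro mult_left_mono power_mono) auto
        ultimately show "?c i * ?c 0 ^ (i - 1) < ?c 1 ^ i"
          by (simp add: l power_mult_distrib mult_ac)
      qed
      have "?c 0 / ?c 1 \<le> \<rho>"
        using c0 ck 1 by (simp add: divide_le_eq mult.commute)
      with y(2) \<rho>D have "laurent_abs y \<le> D * \<rho>" by linarith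
      then show ?thesis
        using y(1) P0 deg
        by (intro exI[of _ P] exI[of _ "\<xi> + y"] exI[of _ 0]) (simp add: poly_taylor)
    next
      \<comment> \<open>The characteristic does not divide \<open>k\<close>, so the coefficient of
        the derivative at \<open>k - 1\<close> is as large as that of \<open>P\<close> at
        \<open>k\<close>. The derivative thus inherits the Newton polygon condition at the same
        radius, with smaller degree and no larger height.\<close>
      case 2
      let ?F = "taylor \<xi> (pderiv P)"
      have F: "coeff ?F i = of_nat (Suc i) * coeff (taylor \<xi> P) (Suc i)" for i
        by (simp add: taylor_pderiv coeff_pderiv del: of_nat_Suc)
      have "\<not> ?p dvd k" using 2 by (auto dest: dvd_imp_le)
      then have knz: "(of_nat k :: 'a fls) \<noteq> 0" by (simp add: of_nat_eq_0_iff_char_dvd)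
      have Fk: "laurent_abs (coeff ?F (k - 1)) = ?c k"
        using 2 laurent_abs_of_nat[OF knz] by (simp add: F laurent_abs_mult del: of_nat_Suc)
      have "?c 1 * \<rho> \<le> (?c k * \<rho> ^ (k - 1)) * \<rho>"
        using spec[OF all, of 1] 2 by (cases k) (simp_all add: mult_ac)
      then have n1: "laurent_abs (coeff ?F 0) \<le> laurent_abs (coeff ?F (k - 1)) * \<rho> ^ (k - 1)"
        using \<rho> unfolding Fk by (simp add: F)
      have n2: "coeff ?F (k - 1) \<noteq> 0" using Fk ck by (metis laurent_abs_eq_0_iff)
      have n3: "degree (pderiv P) \<le> d"
        by (rule degree_le) (use deg in \<open>auto simp: coeff_pderiv coeff_eq_0\<close>)
      have n4: "D' * \<rho> \<le> 1" "1 \<le> k - 1" using \<rho>D D\<rho> 2 by linarith+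
      obtain Q \<beta> s where "Q \<noteq> 0" "degree Q \<le> d" "eval_over poly_T Q \<beta> = 0" "s \<le> d"
        "height Q ^ (?p ^ s) \<le> height (pderiv P)" "laurent_abs (\<xi> - \<beta>) ^ (?p ^ s) \<le> D' * \<rho>"
        using IH[OF n3 \<rho> n4 n2 n1] by blast
      then show ?thesis
        using height_pderiv_le[of P] \<rho>D(2)
        by (intro exI[of _ Q] exI[of _ \<beta>] exI[of _ s]) auto
    next
      case 3
      let ?k = "k div ?p"
      obtain R where R: "?p * degree R \<le> degree P" "height R ^ ?p \<le> height P"
        "coeff (taylor \<xi> R) ?k \<noteq> 0"
        and near': "laurent_abs (coeff (taylor \<xi> R) 0) ^ ?p
        \<le> laurent_abs (coeff (taylor \<xi> R) ?k) ^ ?p * (K * \<rho>) ^ ?k"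
        using step[OF \<rho> _ 3 ck all] \<rho>D D\<rho> by auto
      \<comment> \<open>With this radius \<open>near'\<close> becomes the \<open>p\<close>-th power
        of the Newton polygon condition for \<open>R\<close>, and the induction hypothesis applies.
        The exponent \<open>s\<close> grows by one for the root taken here.\<close>
      define \<rho>' where "\<rho>' = root ?p (K * \<rho>)"
      have \<rho>': "\<rho>' > 0" "\<rho>' ^ ?p = K * \<rho>"
        using K \<rho> p2 by (simp_all add: \<rho>'_def)
      have "(K * \<rho>) ^ ?k = (\<rho>' ^ ?k) ^ ?p"
        by (simp add: \<rho>'(2)[symmetric] power_mult[symmetric] mult.commute)
      with near' have "laurent_abs (coeff (taylor \<xi> R) 0) ^ ?p
        \<le> (laurent_abs (coeff (taylor \<xi> R) ?k) * \<rho>' ^ ?k) ^ ?p"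
        by (simp add: power_mult_distrib)
      then have n1: "laurent_abs (coeff (taylor \<xi> R) 0) \<le> laurent_abs (coeff (taylor \<xi> R) ?k) * \<rho>' ^ ?k"
        using \<rho>' p2 by (subst (asm) power_mono_iff) auto
      have Dp: "(D' * \<rho>') ^ ?p = D * \<rho>"
        by (simp add: power_mult_distrib \<rho>' D_def)
      have "(D' * \<rho>') ^ ?p \<le> 1 ^ ?p" using D\<rho> unfolding Dp by simp
      then have n2: "D' * \<rho>' \<le> 1"
        using \<rho>' D' p2 by (subst (asm) power_mono_iff) auto
      have n3: "degree R \<le> d"
      proof (cases "degree R = 0")
        case False
        have "2 * degree R \<le> ?p * degree R" using p2 by (intro mult_right_mono) auto
        with R(1) deg False show ?thesis by linarith
      qed simp
      have n4: "1 \<le> ?k" using 3 p2 by (simp add: Suc_leI div_greater_zero_iff)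
      obtain Q \<beta> s where Q: "Q \<noteq> 0" "degree Q \<le> d" "eval_over poly_T Q \<beta> = 0" "s \<le> d"
        and hQ: "height Q ^ (?p ^ s) \<le> height R" and cl: "laurent_abs (\<xi> - \<beta>) ^ (?p ^ s) \<le> D' * \<rho>'"
        using IH[OF n3 \<rho>'(1) n2 n4 R(3) n1] by blast
      have "height Q ^ (?p ^ Suc s) = (height Q ^ (?p ^ s)) ^ ?p"
        by (simp add: mult.commute flip: power_mult)
      also have "\<dots> \<le> height R ^ ?p"
        using hQ height_nonneg[of Q] by (intro power_mono) auto
      also note R(2)
      finally have hQ': "height Q ^ (?p ^ Suc s) \<le> height P" .
      have "laurent_abs (\<xi> - \<beta>) ^ (?p ^ Suc s) = (laurent_abs (\<xi> - \<beta>) ^ (?p ^ s)) ^ ?p"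
        by (simp add: mult.commute flip: power_mult)
      also have "\<dots> \<le> (D' * \<rho>') ^ ?p"
        using cl by (intro power_mono) auto
      also note Dp
      finally show ?thesis
        using Q hQ' by (intro exI[of _ Q] exI[of _ \<beta>] exI[of _ "Suc s"]) auto
    qed
  qed
qed

section \<open>Comparison of the exponents\<close>

lemma ereal_leI_real:
  assumes "\<And>v :: real. v < x \<Longrightarrow> ereal v \<le> y"
  shows "ereal x \<le> y"
proof (rule ccontr)
  assume "\<not> ereal x \<le> y"
  then obtain v where "y < ereal v" "ereal v < ereal x"
    using ereal_dense2[of y "ereal x"] by (auto simp: not_le)
  with assms[of v] show False by simp
qed

lemma ex_power_bracket:
  fixes q :: real
  assumes "q > 1" and "Y \<ge> 1"
  shows "\<exists>m. q ^ m \<le> Y \<and> Y < q ^ Suc m"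
proof -
  obtain k where "Y < q ^ k" using real_arch_pow[OF assms(1)] by blast
  then show ?thesis
  proof (induction k)
    case 0
    with assms show ?case by simp
  next
    case (Suc k)
    then show ?case by (meson not_le)
  qed
qed

text \<open>A finite set has a least positive value. The exponents ask for infinitely many
  approximants, and letting the error tend to 0 supplies them.\<close>

lemma infinite_of_small_values:
  fixes f :: "'b \<Rightarrow> real"
  assumes "\<And>\<epsilon>. \<epsilon> > 0 \<Longrightarrow> \<exists>x\<in>S. 0 < f x \<and> f x < \<epsilon>"
  shows "infinite S"
proof
  assume "finite S"
  define A where "A = insert 1 {y \<in> f ` S. 0 < y}"
  have fin: "finite A" using \<open>finite S\<close> by (simp add: A_def)
  have "Min A \<in> A" by (rule Min_in[OF fin]) (simp add: A_def)
  then have "Min A > 0" by (auto simp: A_def)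
  from assms[OF this] obtain x where x: "x \<in> S" "0 < f x" "f x < Min A" by blast
  then have "f x \<in> A" by (auto simp: A_def)
  with Min_le[OF fin this] x(3) show False by simp
qed

lemma w_star_exp_geI:
  assumes "\<And>\<epsilon>. \<epsilon> > 0 \<Longrightarrow> \<exists>\<alpha>. algebraic_deg_le poly_T n \<alpha> \<and> 0 < laurent_abs (\<xi> - \<alpha>) \<and>
    laurent_abs (\<xi> - \<alpha>) < \<epsilon> \<and> laurent_abs (\<xi> - \<alpha>) < alg_height poly_T \<alpha> powr (- v - 1)"
  shows "ereal v \<le> w_star_exp n \<xi>"
  unfolding w_star_exp_def
proof (rule Sup_upper, rule imageI, rule CollectI)
  let ?S = "{\<alpha>. algebraic_deg_le poly_T n \<alpha> \<and> 0 < laurent_abs (\<xi> - \<alpha>) \<and>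
    laurent_abs (\<xi> - \<alpha>) < alg_height poly_T \<alpha> powr (- v - 1)}"
  show "infinite ?S"
    by (rule infinite_of_small_values[where f = "\<lambda>\<alpha>. laurent_abs (\<xi> - \<alpha>)"]) (use assms in blast)
qed

section \<open>Polynomials evaluated in C_infinity\<close>

context completed_alg_closure
begin

abbreviation embT :: "'a poly \<Rightarrow> 'c" where
  "embT \<equiv> (\<lambda>c. emb (to_ac (poly_T c)))"

sublocale C: coeff_embedding embT
  by (rule coeff_embedding_completed) unfold_locales

lemma emb_0 [simp]: "emb 0 = 0"
  using emb_add[of 0 0] by (metis add_0 add_cancel_right_left)

lemma emb_minus: "emb (- x) = - emb x"
  using emb_add[of x "- x"] by (simp add: eq_neg_iff_add_eq_0 add.commute)

lemma emb_diff: "emb (x - y) = emb x - emb y"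
  using emb_add[of x "- y"] by (simp add: emb_minus)

lemma emb_eq_0_iff: "emb (to_ac x) = 0 \<longleftrightarrow> x = 0"
  using absC_extends[of x] absC_eq_0_iff[of "emb (to_ac x)"] by (metis laurent_abs_eq_0_iff)

lemma absC_0 [simp]: "absC 0 = 0"
  by (simp add: absC_eq_0_iff)

lemma absC_1 [simp]: "absC 1 = 1"
  using absC_extends[of 1] by (simp add: emb_1)

lemma absC_power: "absC (z ^ n) = absC z ^ n"
  by (induction n) (simp_all add: absC_mult)

lemma absC_minus [simp]: "absC (- z) = absC z"
proof -
  have "absC (-1) = laurent_abs (-1 :: 'a fls)"
    using absC_extends[of "-1"] by (simp add: emb_minus emb_1)
  then have "absC (-1) = 1" by simp
  then show ?thesis using absC_mult[of "-1" z] by simp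
qed

lemma absC_sum_le_exists:
  assumes "finite A" "A \<noteq> {}"
  shows "\<exists>i\<in>A. absC (sum f A) \<le> absC (f i)"
  using assms
proof (induction A rule: finite_ne_induct)
  case (insert x F)
  then obtain i where i: "i \<in> F" "absC (sum f F) \<le> absC (f i)" by blast
  have le: "absC (sum f (insert x F)) \<le> max (absC (f x)) (absC (sum f F))"
    using insert.hyps absC_add_le_max[of "f x" "sum f F"] by simp
  show ?case
  proof (cases "absC (f x) \<le> absC (sum f F)")
    case True
    with le i have "absC (sum f (insert x F)) \<le> absC (f i)" by linarith
    with i show ?thesis by blast
  next
    case False
    with le have "absC (sum f (insert x F)) \<le> absC (f x)" by linarith
    then show ?thesis by blast
  qed
qed simp

lemma eval_over_embT: "eval_over embT P (emb (to_ac x)) = emb (to_ac (eval_over poly_T P x))"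
  by (induction P) (simp_all add: C.eval_over_pCons base.eval_over_pCons emb_add emb_mult)

text \<open>The field enters only through vanishing at the point, which the embedding preserves and
  reflects. So a Laurent series has the same degree and height when viewed in C_infinity.\<close>

lemma is_min_poly_over_embT: "is_min_poly_over embT (emb (to_ac x)) P \<longleftrightarrow> is_min_poly_over poly_T x P"
  unfolding is_min_poly_over_def eval_over_embT emb_eq_0_iff ..

lemma algebraic_deg_le_embT: "algebraic_deg_le embT n (emb (to_ac x)) \<longleftrightarrow> algebraic_deg_le poly_T n x"
  and alg_height_embT: "alg_height embT (emb (to_ac x)) = alg_height poly_T x"
  unfolding algebraic_deg_le_def alg_height_def algebraic_over_def min_poly_over_def
    is_min_poly_over_embT eval_over_embT emb_eq_0_iff by simp_all

lemma eval_over_embT_taylor: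
  "eval_over embT P \<alpha> = poly (map_poly (\<lambda>x. emb (to_ac x)) (taylor \<xi> P)) (\<alpha> - emb (to_ac \<xi>))"
proof (induction P)
  case (pCons c P)
  let ?\<phi> = "\<lambda>x :: 'a fls. emb (to_ac x)"
  have add: "map_poly ?\<phi> (F + G) = map_poly ?\<phi> F + map_poly ?\<phi> G" for F G
    by (rule poly_eqI) (simp add: coeff_map_poly emb_add)
  have smult: "map_poly ?\<phi> (smult a F) = smult (?\<phi> a) (map_poly ?\<phi> F)" for a F
    by (rule poly_eqI) (simp add: coeff_map_poly emb_mult)
  have "taylor \<xi> (pCons c P) = [:poly_T c:] + (smult \<xi> (taylor \<xi> P) + pCons 0 (taylor \<xi> P))"
    by (simp add: taylor_pCons)
  then have "map_poly ?\<phi> (taylor \<xi> (pCons c P))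
      = [:embT c:] + (smult (?\<phi> \<xi>) (map_poly ?\<phi> (taylor \<xi> P)) + pCons 0 (map_poly ?\<phi> (taylor \<xi> P)))"
    by (simp only: add smult) (simp add: map_poly_pCons)
  then show ?case
    by (simp add: C.eval_over_pCons pCons.IH algebra_simps)
qed simp

text \<open>A root of \<open>P\<close> near \<open>\<xi>\<close> is visible in the Newton polygon of \<open>P\<close> at \<open>\<xi>\<close>.\<close>

lemma near_root_taylor:
  assumes root: "eval_over embT P \<alpha> = 0" and nz: "eval_over poly_T P \<xi> \<noteq> 0"
  shows "\<exists>k\<ge>1. coeff (taylor \<xi> P) k \<noteq> 0 \<and>
    laurent_abs (coeff (taylor \<xi> P) 0) \<le> laurent_abs (coeff (taylor \<xi> P) k) * absC (emb (to_ac \<xi>) - \<alpha>) ^ k"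
proof -
  let ?\<phi> = "\<lambda>x :: 'a fls. emb (to_ac x)"
  let ?c = "\<lambda>i. coeff (taylor \<xi> P) i"
  define y where "y = \<alpha> - ?\<phi> \<xi>"
  define N where "N = Suc (degree P)"
  have "0 = poly (map_poly ?\<phi> (taylor \<xi> P)) y"
    using root by (simp add: eval_over_embT_taylor[of P \<alpha> \<xi>] y_def)
  also have "\<dots> = (\<Sum>i\<le>N. coeff (map_poly ?\<phi> (taylor \<xi> P)) i * y ^ i)"
    by (rule poly_eq_sum_atMost)
      (use degree_taylor_le[of \<xi> P] map_poly_degree_leq[of ?\<phi> "taylor \<xi> P"] in \<open>simp add: N_def\<close>)
  also have "\<dots> = (\<Sum>i\<le>N. ?\<phi> (?c i) * y ^ i)"
    by (simp add: coeff_map_poly)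
  also have "{..N} = insert 0 {1..N}" by auto
  also have "(\<Sum>i\<in>insert 0 {1..N}. ?\<phi> (?c i) * y ^ i) = ?\<phi> (?c 0) + (\<Sum>i\<in>{1..N}. ?\<phi> (?c i) * y ^ i)"
    by simp
  \<comment> \<open>The constant term is minus the sum of the others, so by the ultrametric
    inequality one of these is at least as large.\<close>
  finally have "?\<phi> (?c 0) = - (\<Sum>i\<in>{1..N}. ?\<phi> (?c i) * y ^ i)"
    by (simp add: eq_neg_iff_add_eq_0)
  then have "laurent_abs (?c 0) = absC (\<Sum>i\<in>{1..N}. ?\<phi> (?c i) * y ^ i)"
    by (metis absC_extends absC_minus)
  moreover obtain k where k: "k \<in> {1..N}"
    "absC (\<Sum>i\<in>{1..N}. ?\<phi> (?c i) * y ^ i) \<le> absC (?\<phi> (?c k) * y ^ k)"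
    using absC_sum_le_exists[of "{1..N}" "\<lambda>i. ?\<phi> (?c i) * y ^ i"] by (auto simp: N_def)
  moreover have "absC y = absC (?\<phi> \<xi> - \<alpha>)"
    using absC_minus[of y] by (simp add: y_def)
  ultimately have le: "laurent_abs (?c 0) \<le> laurent_abs (?c k) * absC (?\<phi> \<xi> - \<alpha>) ^ k"
    by (simp add: absC_mult absC_power absC_extends)
  have "laurent_abs (?c 0) > 0" using nz by (simp add: coeff_taylor_0)
  with le have "?c k \<noteq> 0" by (metis laurent_abs_0 linorder_not_less mult_zero_left)
  with le k(1) show ?thesis by auto
qed

lemma w_hat_at_exp_geI:
  assumes "\<exists>H0::real. \<forall>H>H0. \<exists>\<alpha>. algebraic_deg_le poly_T n \<alpha> \<and> alg_height poly_T \<alpha> \<le> H \<and>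
    0 < laurent_abs (\<xi> - \<alpha>) \<and> laurent_abs (\<xi> - \<alpha>) < inverse (alg_height poly_T \<alpha>) * H powr (- v)"
  shows "ereal v \<le> w_hat_at_exp emb absC n \<xi>"
  unfolding w_hat_at_exp_def
proof (rule Sup_upper, rule imageI, rule CollectI)
  obtain H0 where H0: "\<And>H. H > H0 \<Longrightarrow> \<exists>\<alpha>. algebraic_deg_le poly_T n \<alpha> \<and> alg_height poly_T \<alpha> \<le> H \<and>
    0 < laurent_abs (\<xi> - \<alpha>) \<and> laurent_abs (\<xi> - \<alpha>) < inverse (alg_height poly_T \<alpha>) * H powr (- v)"
    using assms by auto
  show "\<exists>H0. \<forall>H>H0. \<exists>\<alpha>. algebraic_deg_le embT n \<alpha> \<and> alg_height embT \<alpha> \<le> H \<and>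
    0 < absC (emb (to_ac \<xi>) - \<alpha>) \<and>
    absC (emb (to_ac \<xi>) - \<alpha>) < inverse (alg_height embT \<alpha>) * H powr (- v)"
  proof (intro exI[of _ H0] allI impI)
    fix H assume "H > H0"
    from H0[OF this] obtain \<alpha> where \<alpha>: "algebraic_deg_le poly_T n \<alpha>" "alg_height poly_T \<alpha> \<le> H"
      "0 < laurent_abs (\<xi> - \<alpha>)" "laurent_abs (\<xi> - \<alpha>) < inverse (alg_height poly_T \<alpha>) * H powr (- v)"
      by blast
    have "absC (emb (to_ac \<xi>) - emb (to_ac \<alpha>)) = laurent_abs (\<xi> - \<alpha>)"
      using absC_extends[of "\<xi> - \<alpha>"] by (simp add: emb_diff)
    with \<alpha> show "\<exists>\<alpha>. algebraic_deg_le embT n \<alpha> \<and> alg_height embT \<alpha> \<le> H \<and>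
      0 < absC (emb (to_ac \<xi>) - \<alpha>) \<and>
      absC (emb (to_ac \<xi>) - \<alpha>) < inverse (alg_height embT \<alpha>) * H powr (- v)"
      by (intro exI[of _ "emb (to_ac \<alpha>)"]) (simp add: algebraic_deg_le_embT alg_height_embT)
  qed
qed

end

section \<open>From families of good approximations to exponents\<close>

text \<open>The parameter \<open>Z\<close> will be a power of \<open>q\<close> and \<open>s\<close> will be \<open>w - n + 1\<close>.\<close>

definition good_approximation :: "nat \<Rightarrow> 'a::{field,finite} fls \<Rightarrow> real \<Rightarrow> real \<Rightarrow> real \<Rightarrow> real \<Rightarrow> bool" where
  "good_approximation n \<xi> C s w Z \<longleftrightarrow> (\<exists>\<alpha>. algebraic_deg_le poly_T n \<alpha> \<and>
     alg_height poly_T \<alpha> \<le> C * Z powr s \<and> 0 < laurent_abs (\<xi> - \<alpha>) \<and>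
     laurent_abs (\<xi> - \<alpha>) * alg_height poly_T \<alpha> \<le> C * Z powr (- w))"

text \<open>With \<open>h\<close> the height of \<alpha>, the product |\<xi> - \<alpha>| h^(1 + v)
  is at most a constant times Z^(v s - w), which tends to 0. Arbitrarily large \<open>m\<close>
  suffice, since infinitely many \<alpha> are counted.\<close>

lemma w_star_exp_ge_of_good_approximation:
  fixes \<xi> :: "'a::{field,finite} fls"
  assumes C: "C > 0" and s: "s > 0" and v: "v \<ge> 0" "v * s < w" and w: "w > 0"
    and fam: "\<And>M. \<exists>m\<ge>M. good_approximation n \<xi> C s w (real CARD('a) ^ m)"
  shows "ereal v \<le> w_star_exp n \<xi>"
proof (rule w_star_exp_geI)
  fix \<epsilon> :: real assume \<epsilon>: "\<epsilon> > 0"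
  let ?q = "real CARD('a)"
  have q: "?q > 1" by (rule card_field_gt_1)
  have lim: "filterlim (\<lambda>m :: nat. ?q ^ m) at_top sequentially"
    unfolding filterlim_at_top eventually_sequentially
  proof
    fix Y :: real
    obtain N where "Y < ?q ^ N" using real_arch_pow[OF q] by blast
    moreover have "?q ^ N \<le> ?q ^ m" if "N \<le> m" for m
      using q that by (intro power_increasing) auto
    ultimately show "\<exists>N. \<forall>m\<ge>N. Y \<le> ?q ^ m" by force
  qed
  have "((\<lambda>Z :: real. C * Z powr (- w)) \<longlongrightarrow> 0) at_top"
    using w by (intro tendsto_mult_right_zero tendsto_neg_powr filterlim_ident) auto
  then have "\<forall>\<^sub>F Z in at_top. C * Z powr (- w) < \<epsilon>"
    by (rule order_tendstoD) (use \<epsilon> in simp)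
  moreover have "((\<lambda>Z :: real. C * C powr v * Z powr (- (w - v * s))) \<longlongrightarrow> 0) at_top"
    using v by (intro tendsto_mult_right_zero tendsto_neg_powr filterlim_ident) auto
  then have "\<forall>\<^sub>F Z in at_top. C * C powr v * Z powr (- (w - v * s)) < 1"
    by (rule order_tendstoD) simp
  ultimately have "\<forall>\<^sub>F Z in at_top. C * Z powr (- w) < \<epsilon> \<and> C * C powr v * Z powr (- (w - v * s)) < 1"
    by (rule eventually_conj)
  then have "\<forall>\<^sub>F m in sequentially. C * (?q ^ m) powr (- w) < \<epsilon> \<and>
      C * C powr v * (?q ^ m) powr (- (w - v * s)) < 1"
    using lim by (rule eventually_compose_filterlim)
  then obtain M where M: "\<And>m. m \<ge> M \<Longrightarrow> C * (?q ^ m) powr (- w) < \<epsilon> \<and>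
      C * C powr v * (?q ^ m) powr (- (w - v * s)) < 1"
    by (auto simp: eventually_sequentially)
  obtain m where "m \<ge> M" and good: "good_approximation n \<xi> C s w (?q ^ m)"
    using fam by blast
  define Z where "Z = ?q ^ m"
  have Z: "Z > 0" using q by (simp add: Z_def)
  from M[OF \<open>m \<ge> M\<close>] have small: "C * Z powr (- w) < \<epsilon>" "C * C powr v * Z powr (- (w - v * s)) < 1"
    by (simp_all add: Z_def)
  obtain \<alpha> where \<alpha>: "algebraic_deg_le poly_T n \<alpha>" and h: "alg_height poly_T \<alpha> \<le> C * Z powr s"
    and d: "0 < laurent_abs (\<xi> - \<alpha>)"
    and dh: "laurent_abs (\<xi> - \<alpha>) * alg_height poly_T \<alpha> \<le> C * Z powr (- w)"
    using good unfolding good_approximation_def Z_def by blast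
  let ?h = "alg_height poly_T \<alpha>"
  have h1: "?h \<ge> 1" by (rule base.alg_height_ge_1[OF \<alpha>])
  have "laurent_abs (\<xi> - \<alpha>) * 1 \<le> laurent_abs (\<xi> - \<alpha>) * ?h"
    using h1 by (intro mult_left_mono) auto
  with dh small have "laurent_abs (\<xi> - \<alpha>) < \<epsilon>" by linarith
  moreover have "laurent_abs (\<xi> - \<alpha>) < ?h powr (- v - 1)"
  proof -
    have "?h powr v \<le> (C * Z powr s) powr v"
      using h h1 v by (intro powr_mono2) auto
    also have "\<dots> = C powr v * Z powr (v * s)"
      using C Z by (simp add: powr_mult powr_powr mult.commute)
    finally have hv: "?h powr v \<le> C powr v * Z powr (v * s)" .
    have "laurent_abs (\<xi> - \<alpha>) * ?h * ?h powr v \<le> (C * Z powr (- w)) * (C powr v * Z powr (v * s))"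
      by (rule mult_mono[OF dh hv]) (use C in auto)
    also have "\<dots> = C * C powr v * Z powr (- (w - v * s))"
      using Z by (simp add: powr_add[symmetric] mult_ac)
    finally have "laurent_abs (\<xi> - \<alpha>) * (?h powr (v + 1)) < 1"
      using small h1 by (simp add: powr_add mult_ac)
    then have "laurent_abs (\<xi> - \<alpha>) < inverse (?h powr (v + 1))"
      using h1 by (simp add: field_simps)
    also have "\<dots> = ?h powr (- v - 1)"
      by (simp flip: powr_minus)
    finally show ?thesis .
  qed
  ultimately show "\<exists>\<alpha>. algebraic_deg_le poly_T n \<alpha> \<and> 0 < laurent_abs (\<xi> - \<alpha>) \<and>
    laurent_abs (\<xi> - \<alpha>) < \<epsilon> \<and> laurent_abs (\<xi> - \<alpha>) < alg_height poly_T \<alpha> powr (- v - 1)"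
    using \<alpha> d by blast
qed

text \<open>The uniform exponent has to serve every large \<open>H\<close>, so all large
  \<open>m\<close> are required: take \<open>m\<close> with q^m \<le> (H / C)^(1 / s) < q^(m +
  1).\<close>

lemma (in completed_alg_closure) w_hat_at_exp_ge_of_good_approximation:
  assumes C: "C > 0" and s: "s > 0" and v: "v * s < w" and w: "w > 0"
    and fam: "\<And>m :: nat. m \<ge> M \<Longrightarrow> good_approximation n \<xi> C s w (real CARD('a) ^ m)"
  shows "ereal v \<le> w_hat_at_exp emb absC n \<xi>"
proof (rule w_hat_at_exp_geI)
  let ?q = "real CARD('a)"
  have q: "?q > 1" by (rule card_field_gt_1)
  \<comment> \<open>This collects the constants from \<open>q ^ m\<close> being larger than
    \<open>Y / q\<close>, where \<open>Y\<close> is \<open>(H / C) powr (1 / s)\<close>.\<close>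
  define C' where "C' = C * (inverse C powr (1 / s) / ?q) powr (- w)"
  have "w / s - v > 0" using v s by (simp add: field_simps)
  then have "((\<lambda>H :: real. C' * H powr (- (w / s - v))) \<longlongrightarrow> 0) at_top"
    by (intro tendsto_mult_right_zero tendsto_neg_powr filterlim_ident) auto
  then have "\<forall>\<^sub>F H in at_top. C' * H powr (- (w / s - v)) < 1"
    by (rule order_tendstoD) simp
  then obtain H1 where H1: "\<And>H. H \<ge> H1 \<Longrightarrow> C' * H powr (- (w / s - v)) < 1"
    by (auto simp: eventually_at_top_linorder)
  define H0 where "H0 = max H1 (C * (?q ^ Suc M) powr s)"
  show "\<exists>H0::real. \<forall>H>H0. \<exists>\<alpha>. algebraic_deg_le poly_T n \<alpha> \<and> alg_height poly_T \<alpha> \<le> H \<and>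
    0 < laurent_abs (\<xi> - \<alpha>) \<and> laurent_abs (\<xi> - \<alpha>) < inverse (alg_height poly_T \<alpha>) * H powr (- v)"
  proof (intro exI[of _ H0] allI impI)
    fix H assume H: "H > H0"
    have "C * (?q ^ Suc M) powr s > 0" using C q by simp
    then have Hpos: "H > 0" using H unfolding H0_def by linarith
    define Y where "Y = (H / C) powr (1 / s)"
    have Ys: "C * Y powr s = H" using C s Hpos by (simp add: Y_def powr_powr)
    have "(?q ^ Suc M) powr s < Y powr s"
    proof -
      have "C * (?q ^ Suc M) powr s < C * Y powr s" using H unfolding Ys H0_def by linarith
      then show ?thesis using C by simp
    qed
    then have YM: "?q ^ Suc M < Y"
      using s q by (metis powr_mono2 linorder_not_less less_imp_le Y_def powr_ge_zero)
    have Ypos: "Y > 0" using YM q by (meson order.strict_trans zero_less_power zero_less_one)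
    have "?q ^ 0 \<le> ?q ^ Suc M" using q by (intro power_increasing) auto
    with YM have "Y \<ge> 1" by simp
    then obtain m where qm_le: "?q ^ m \<le> Y" and qm_gt: "Y < ?q ^ Suc m"
      using ex_power_bracket[OF q] by blast
    have "?q ^ Suc M < ?q ^ Suc m" using YM qm_gt by linarith
    then have "M \<le> m" using q by (metis Suc_le_mono less_imp_le power_less_imp_less_exp)
    from fam[OF this] obtain \<alpha> where \<alpha>: "algebraic_deg_le poly_T n \<alpha>"
      and h: "alg_height poly_T \<alpha> \<le> C * (?q ^ m) powr s" and d: "0 < laurent_abs (\<xi> - \<alpha>)"
      and dh: "laurent_abs (\<xi> - \<alpha>) * alg_height poly_T \<alpha> \<le> C * (?q ^ m) powr (- w)"
      unfolding good_approximation_def by blast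
    let ?h = "alg_height poly_T \<alpha>"
    have h1: "?h \<ge> 1" by (rule base.alg_height_ge_1[OF \<alpha>])
    have "?h \<le> H"
    proof -
      have "C * (?q ^ m) powr s \<le> C * Y powr s"
        using C s qm_le by (intro mult_left_mono powr_mono2) auto
      with h Ys show ?thesis by linarith
    qed
    moreover have "laurent_abs (\<xi> - \<alpha>) < inverse ?h * H powr (- v)"
    proof -
      have "(?q ^ m) powr (- w) \<le> (Y / ?q) powr (- w)"
        using qm_gt q w Ypos by (intro powr_mono2') (auto simp: field_simps)
      also have "Y / ?q = (inverse C powr (1 / s) / ?q) * H powr (1 / s)"
        using C Hpos by (simp add: Y_def powr_mult divide_inverse mult_ac)
      also have "((inverse C powr (1 / s) / ?q) * H powr (1 / s)) powr (- w)
          = (inverse C powr (1 / s) / ?q) powr (- w) * H powr (- (w / s))"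
        using C q Hpos by (subst powr_mult) (auto simp: powr_powr)
      finally have "C * (?q ^ m) powr (- w) \<le> C' * H powr (- (w / s))"
        using C by (simp add: C'_def mult.assoc)
      also have "\<dots> = (C' * H powr (- (w / s - v))) * H powr (- v)"
        using Hpos by (simp add: powr_add[symmetric])
      also have "\<dots> < 1 * H powr (- v)"
        using H1[of H] H Hpos unfolding H0_def by (intro mult_strict_right_mono) auto
      finally have "laurent_abs (\<xi> - \<alpha>) * ?h < H powr (- v)" using dh by linarith
      then show ?thesis using h1 by (simp add: field_simps)
    qed
    ultimately show "\<exists>\<alpha>. algebraic_deg_le poly_T n \<alpha> \<and> alg_height poly_T \<alpha> \<le> H \<and>
      0 < laurent_abs (\<xi> - \<alpha>) \<and> laurent_abs (\<xi> - \<alpha>) < inverse (alg_height poly_T \<alpha>) * H powr (- v)"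
      using \<alpha> d by blast
  qed
qed

lemma algebraic_deg_le_mono: "algebraic_deg_le e m x \<Longrightarrow> m \<le> n \<Longrightarrow> algebraic_deg_le e n x"
  by (auto simp: algebraic_deg_le_def)

lemma eval_over_neq_0:
  assumes "\<not> algebraic_deg_le poly_T n \<xi>" "P \<noteq> 0" "degree P \<le> n"
  shows "eval_over poly_T P \<xi> \<noteq> 0"
  using assms base.algebraic_deg_leI by blast

text \<open>Take \<open>A\<close> about \<open>w * m\<close> and the least admissible
  \<open>B\<close>, which is about \<open>(w - n + 1) * m\<close>. The constant \<open>C\<close>
  depends on \<open>w\<close> and \<open>c\<close> but not on \<open>m\<close>, so the lower bound
  may be available for some \<open>m\<close> only.\<close>

lemma good_approximation_of_lower_bound:
  fixes \<xi> :: "'a::{field,finite} fls"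
  assumes "n \<ge> 1" and "\<not> algebraic_deg_le poly_T n \<xi>"
  shows "\<exists>K :: nat. \<forall>w c. w \<ge> real n \<longrightarrow> c > 0 \<longrightarrow> (\<exists>C>0. \<forall>m :: nat.
    (\<forall>P. P \<noteq> 0 \<longrightarrow> degree P \<le> n \<longrightarrow> height P \<le> real CARD('a) ^ (m + K) \<longrightarrow>
      c * (real CARD('a) ^ (m + K)) powr (- w) \<le> laurent_abs (eval_over poly_T P \<xi>)) \<longrightarrow>
    good_approximation n \<xi> C (w - real n + 1) w (real CARD('a) ^ m))"
proof -
  let ?q = "real CARD('a)"
  have q: "?q > 1" by (rule card_field_gt_1)
  obtain K :: nat where K: "\<forall>A B m. - A \<le> m \<longrightarrow> A + int K \<le> B + (int n - 1) * m \<longrightarrow>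
    (\<forall>P. P \<noteq> 0 \<longrightarrow> degree P \<le> n \<longrightarrow> height P \<le> ?q powi (m + int K) \<longrightarrow>
      laurent_abs (coeff (taylor \<xi> P) 1) \<le> ?q powi m \<longrightarrow>
      laurent_abs (eval_over poly_T P \<xi>) > ?q powi (- A)) \<longrightarrow>
    (\<exists>\<alpha>. algebraic_deg_le poly_T n \<alpha> \<and> alg_height poly_T \<alpha> \<le> ?q powi (B + int K) \<and>
      0 < laurent_abs (\<xi> - \<alpha>) \<and>
      laurent_abs (\<xi> - \<alpha>) * alg_height poly_T \<alpha> \<le> ?q powi (int K - A))"
    using algebraic_approximation_of_lower_bound[OF assms] by auto
  show ?thesis
  proof (intro exI[of _ K] allI impI)
    fix w c :: real assume w: "w \<ge> real n" and c: "c > 0"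
    obtain j where j: "?q powr (- real j) < c"
    proof -
      obtain j where "inverse c < ?q ^ j" using real_arch_pow[OF q] by blast
      then have "inverse (?q ^ j) < c" using c q by (simp add: field_simps)
      then show ?thesis using that q by (simp add: powr_minus powr_realpow)
    qed
    \<comment> \<open>\<open>A\<close> exceeds \<open>w * m\<close> by at most
      \<open>j + 1 + w * K\<close>, and the height exponent \<open>B + K\<close> brings in
      \<open>2 * K\<close> more; \<open>j\<close> absorbs the constant \<open>c\<close>, and the 1
      the rounding.\<close>
    define E where "E = real j + 1 + w * K + 2 * K"
    define C where "C = ?q powr E"
    have C0: "C > 0" using q by (simp add: C_def)
    show "\<exists>C>0. \<forall>m :: nat.
      (\<forall>P. P \<noteq> 0 \<longrightarrow> degree P \<le> n \<longrightarrow> height P \<le> ?q ^ (m + K) \<longrightarrow>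
        c * (?q ^ (m + K)) powr (- w) \<le> laurent_abs (eval_over poly_T P \<xi>)) \<longrightarrow>
      good_approximation n \<xi> C (w - real n + 1) w (?q ^ m)"
    proof (intro exI[of _ C] conjI C0 allI impI)
      fix m :: nat
      assume lower: "\<forall>P. P \<noteq> 0 \<longrightarrow> degree P \<le> n \<longrightarrow> height P \<le> ?q ^ (m + K) \<longrightarrow>
        c * (?q ^ (m + K)) powr (- w) \<le> laurent_abs (eval_over poly_T P \<xi>)"
      define A where "A = int j + \<lceil>w * (m + K)\<rceil>"
      define B where "B = A + int K - (int n - 1) * int m"
      have A_ge: "real_of_int A \<ge> real j + w * (m + K)" and A_le: "real_of_int A \<le> real j + w * (m + K) + 1"
        unfolding A_def by (linarith, linarith)
      have w0: "w \<ge> 0" using w by simp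
      have "real_of_int A \<ge> 0"
        using A_ge mult_nonneg_nonneg[OF w0, of "real (m + K)"] by linarith
      then have "A \<ge> 0" by simp
      have powi: "?q powi i = ?q powr real_of_int i" for i
        using q by (simp add: powr_real_of_int')
      have pw: "(?q ^ a) powr x = ?q powr (a * x)" for a :: nat and x :: real
        using q by (simp add: powr_realpow[symmetric] powr_powr)
      have "?q powi (- A) < c * (?q ^ (m + K)) powr (- w)"
      proof -
        have "?q powi (- A) \<le> ?q powr (- real j + - (w * (m + K)))"
          unfolding powi using A_ge q by (intro powr_mono) auto
        also have "\<dots> = ?q powr (- real j) * (?q ^ (m + K)) powr (- w)"
          unfolding pw powr_add by (simp add: mult.commute)
        also have "\<dots> < c * (?q ^ (m + K)) powr (- w)"
          using j q by (intro mult_strict_right_mono) auto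
        finally show ?thesis .
      qed
      moreover have "?q powi (int m + int K) = ?q ^ (m + K)"
        by (simp flip: of_nat_add)
      ultimately have hyp: "\<forall>P. P \<noteq> 0 \<longrightarrow> degree P \<le> n \<longrightarrow> height P \<le> ?q powi (int m + int K) \<longrightarrow>
        laurent_abs (coeff (taylor \<xi> P) 1) \<le> ?q powi int m \<longrightarrow>
        laurent_abs (eval_over poly_T P \<xi>) > ?q powi (- A)"
        using lower by (metis order.strict_trans2)
      have AB: "- A \<le> int m" "A + int K \<le> B + (int n - 1) * int m"
        using \<open>A \<ge> 0\<close> by (simp_all add: B_def)
      obtain \<alpha> where \<alpha>: "algebraic_deg_le poly_T n \<alpha>" "0 < laurent_abs (\<xi> - \<alpha>)"
        and h: "alg_height poly_T \<alpha> \<le> ?q powi (B + int K)"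
        and d: "laurent_abs (\<xi> - \<alpha>) * alg_height poly_T \<alpha> \<le> ?q powi (int K - A)"
        using K[THEN spec, THEN spec, THEN spec, THEN mp, OF AB(1), THEN mp, OF AB(2), THEN mp, OF hyp] by blast
      have "?q powi (B + int K) \<le> ?q powr (E + m * (w - real n + 1))"
        unfolding powi B_def E_def using A_le q by (intro powr_mono) (auto simp: algebra_simps)
      also have "\<dots> = C * (?q ^ m) powr (w - real n + 1)"
        by (simp only: C_def pw powr_add[of _ E])
      finally have h': "alg_height poly_T \<alpha> \<le> C * (?q ^ m) powr (w - real n + 1)"
        using h by linarith
      have wK: "w * K \<ge> 0" using w0 by simp
      have "?q powi (int K - A) \<le> ?q powr (E + m * (- w))"
        unfolding powi E_def using A_ge q wK by (intro powr_mono) (auto simp: algebra_simps)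
      also have "\<dots> = C * (?q ^ m) powr (- w)"
        by (simp only: C_def pw powr_add[of _ E])
      finally have d': "laurent_abs (\<xi> - \<alpha>) * alg_height poly_T \<alpha> \<le> C * (?q ^ m) powr (- w)"
        using d by linarith
      from \<alpha> h' d' show "good_approximation n \<xi> C (w - real n + 1) w (?q ^ m)"
        unfolding good_approximation_def by blast
    qed
  qed
qed

text \<open>Rational approximations with exponent 1. They settle the case of an infinite exponent,
  where the quotient is 1.\<close>

lemma good_approximation_linear:
  fixes \<xi> :: "'a::{field,finite} fls"
  assumes n: "n \<ge> 1" and \<xi>: "\<not> algebraic_deg_le poly_T n \<xi>"
  shows "\<exists>C>0. \<forall>m :: nat. good_approximation n \<xi> C 1 1 (real CARD('a) ^ m)"
proof -
  let ?q = "real CARD('a)"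
  have q: "?q > 1" by (rule card_field_gt_1)
  have \<xi>1: "\<not> algebraic_deg_le poly_T 1 \<xi>"
    using \<xi> n algebraic_deg_le_mono by blast
  obtain K :: nat where K: "\<forall>A B m. - A \<le> m \<longrightarrow> A + int K \<le> B + (int 1 - 1) * m \<longrightarrow>
    (\<forall>P. P \<noteq> 0 \<longrightarrow> degree P \<le> 1 \<longrightarrow> height P \<le> ?q powi (m + int K) \<longrightarrow>
      laurent_abs (coeff (taylor \<xi> P) 1) \<le> ?q powi m \<longrightarrow>
      laurent_abs (eval_over poly_T P \<xi>) > ?q powi (- A)) \<longrightarrow>
    (\<exists>\<alpha>. algebraic_deg_le poly_T 1 \<alpha> \<and> alg_height poly_T \<alpha> \<le> ?q powi (B + int K) \<and>
      0 < laurent_abs (\<xi> - \<alpha>) \<and>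
      laurent_abs (\<xi> - \<alpha>) * alg_height poly_T \<alpha> \<le> ?q powi (int K - A))"
    using algebraic_approximation_of_lower_bound[OF order_refl \<xi>1] by auto
  define C where "C = ?q ^ (2 * K + 1)"
  have C0: "C > 0" using q by (simp add: C_def)
  have T_ge_1: "laurent_abs (poly_T c) \<ge> 1" if "c \<noteq> 0" for c :: "'a poly"
    using that q by (simp add: laurent_abs_poly_T)
  show ?thesis
  proof (intro exI[of _ C] conjI C0 allI)
    fix m :: nat
    define A where "A = int m + 1"
    have "?q powi (-1) < ?q powi 0" "?q powi (- A) < ?q powi 0"
      by (rule power_int_strict_increasing; use q in \<open>simp add: A_def\<close>)+
    then have small: "?q powi (-1) < 1" "?q powi (- A) < 1" by simp_all
    \<comment> \<open>For \<open>m = - 1\<close> the lower bound always holds: the derivative of a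
      linear \<open>P\<close> is a polynomial in \<open>T\<close>, so smaller than 1 means 0. Then
      \<open>P\<close> is a nonzero constant in \<open>X\<close>, of absolute value at least
      1.\<close>
    have hyp: "\<forall>P. P \<noteq> 0 \<longrightarrow> degree P \<le> 1 \<longrightarrow> height P \<le> ?q powi (- 1 + int K) \<longrightarrow>
      laurent_abs (coeff (taylor \<xi> P) 1) \<le> ?q powi (- 1) \<longrightarrow>
      laurent_abs (eval_over poly_T P \<xi>) > ?q powi (- A)"
    proof (intro allI impI)
      fix P :: "'a poly poly"
      assume P: "P \<noteq> 0" "degree P \<le> 1" and c1: "laurent_abs (coeff (taylor \<xi> P) 1) \<le> ?q powi (- 1)"
      obtain a P' where P': "P = pCons a P'" by (cases P) auto
      have "degree P' = 0" using P(2) by (cases "P' = 0") (auto simp: P')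
      then obtain b where "P' = [:b:]" by (rule degree_eq_zeroE)
      with P' have ab: "P = [:a, b:]" by simp
      have "coeff (taylor \<xi> P) 1 = poly_T b"
        by (simp add: ab taylor_pCons)
      with c1 small(1) T_ge_1[of b] have b: "b = 0" by force
      with P ab T_ge_1[of a] have "laurent_abs (poly_T a) \<ge> 1" by auto
      then show "laurent_abs (eval_over poly_T P \<xi>) > ?q powi (- A)"
        using small(2) by (simp add: ab b base.eval_over_pCons)
    qed
    have AB: "- A \<le> - 1" "A + int K \<le> (A + int K) + (int 1 - 1) * (- 1)"
      by (simp_all add: A_def)
    obtain \<alpha> where \<alpha>: "algebraic_deg_le poly_T 1 \<alpha>" "0 < laurent_abs (\<xi> - \<alpha>)"
      and h: "alg_height poly_T \<alpha> \<le> ?q powi ((A + int K) + int K)"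
      and d: "laurent_abs (\<xi> - \<alpha>) * alg_height poly_T \<alpha> \<le> ?q powi (int K - A)"
      using K[THEN spec, THEN spec, THEN spec, THEN mp, OF AB(1), THEN mp, OF AB(2), THEN mp, OF hyp] by blast
    have "?q powi ((A + int K) + int K) = ?q powi (int (2 * K + 1 + m))"
      by (simp add: A_def algebra_simps)
    also have "\<dots> = C * (?q ^ m) powr 1"
      using q unfolding power_int_of_nat power_add by (simp add: C_def)
    finally have h': "alg_height poly_T \<alpha> \<le> C * (?q ^ m) powr 1" using h by simp
    have "?q powi (int K - A) \<le> ?q powi (int (2 * K + 1) + - int m)"
      unfolding powi_card_le_iff by (simp add: A_def)
    also have "\<dots> = C * (?q ^ m) powr (- 1)"
      proof -
      have "?q powi (int (2 * K + 1) + - int m) = ?q powi int (2 * K + 1) * ?q powi (- int m)"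
        by (rule power_int_add) (use q in simp)
      also have "\<dots> = C * (?q ^ m) powr (- 1)"
        unfolding C_def power_int_of_nat power_int_minus using q by (simp add: powr_minus)
      finally show ?thesis .
    qed
    finally have d': "laurent_abs (\<xi> - \<alpha>) * alg_height poly_T \<alpha> \<le> C * (?q ^ m) powr (- 1)"
      using d by linarith
    from \<alpha> h' d' n show "good_approximation n \<xi> C 1 1 (?q ^ m)"
      unfolding good_approximation_def using algebraic_deg_le_mono by blast
  qed
qed

section \<open>Dirichlet's theorem and lower bounds for values of polynomials\<close>

lemma dirichlet_polynomials:
  fixes \<xi> :: "'a::{field,finite} fls"
  assumes \<xi>: "\<not> algebraic_deg_le poly_T n \<xi>" and v: "v < real n"
  shows "\<exists>H0 \<ge> 1. \<forall>H>H0. \<exists>P. degree P \<le> n \<and> height P \<le> H \<and>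
    0 < laurent_abs (eval_over poly_T P \<xi>) \<and> laurent_abs (eval_over poly_T P \<xi>) < H powr (- v)"
proof -
  let ?q = "real CARD('a)"
  have q: "?q > 1" by (rule card_field_gt_1)
  obtain K :: nat where K: "\<And>b :: nat \<Rightarrow> int. int K \<le> (\<Sum>i\<le>n. b i) \<Longrightarrow>
    \<exists>P. P \<noteq> 0 \<and> degree P \<le> n \<and> (\<forall>i\<le>n. laurent_abs (coeff (taylor \<xi> P) i) \<le> ?q powi b i)"
    using minkowski_taylor[of n \<xi>] by auto
  obtain N where N: "laurent_abs \<xi> \<le> ?q ^ N"
    by (rule laurent_abs_bound_exists)
  define D where "D = N * n"
  define E where "E = K + n * D"
  define C where "C = ?q ^ (E + n)"
  have "((\<lambda>H :: real. C * H powr (- (real n - v))) \<longlongrightarrow> 0) at_top"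
    using v by (intro tendsto_mult_right_zero tendsto_neg_powr filterlim_ident) auto
  then have "\<forall>\<^sub>F H in at_top. C * H powr (- (real n - v)) < 1"
    by (rule order_tendstoD) simp
  then obtain H1 where H1: "\<And>H. H \<ge> H1 \<Longrightarrow> C * H powr (- (real n - v)) < 1"
    by (auto simp: eventually_at_top_linorder)
  \<comment> \<open>The second entry forces \<open>m\<close> to be at least \<open>E + D\<close>, so
    that the bound for the value is also at most \<open>m - D\<close>.\<close>
  define H0 where "H0 = max H1 (?q ^ Suc (E + D))"
  have "?q ^ Suc (E + D) \<ge> 1" using q by (intro one_le_power) auto
  then have "H0 \<ge> 1" unfolding H0_def by simp
  moreover have "\<exists>P. degree P \<le> n \<and> height P \<le> H \<and>
    0 < laurent_abs (eval_over poly_T P \<xi>) \<and> laurent_abs (eval_over poly_T P \<xi>) < H powr (- v)"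
    if H: "H > H0" for H
  proof -
    have HH: "H \<ge> 1" "H \<ge> H1" "H > ?q ^ Suc (E + D)" using H \<open>H0 \<ge> 1\<close> by (auto simp: H0_def)
    obtain m where m: "?q ^ m \<le> H" "H < ?q ^ Suc m"
      using ex_power_bracket[OF q HH(1)] by blast
    have "?q ^ Suc (E + D) < ?q ^ Suc m" using HH(3) m(2) by linarith
    then have "Suc (E + D) < Suc m" using q by (rule power_less_imp_less_exp[rotated])
    then have mE: "E + D \<le> m" by simp
    \<comment> \<open>Subtracting \<open>D\<close> compensates the loss from Taylor coefficients to
      the height. The sum is \<open>E - n * D\<close>, which is \<open>K\<close>.\<close>
    define b where "b = (\<lambda>i :: nat. if i = 0 then int E - int n * int m else int m - int D)"
    have "(\<Sum>i\<le>n. b i) = (\<Sum>i\<in>insert 0 {1..n}. b i)"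
      by (rule sum.cong) auto
    also have "\<dots> = int E - int n * int m + (\<Sum>i\<in>{1..n}. b i)"
      by (simp add: b_def)
    also have "(\<Sum>i\<in>{1..n}. b i) = (\<Sum>i\<in>{1..n}. int m - int D)"
      by (rule sum.cong) (auto simp: b_def)
    also have "int E - int n * int m + \<dots> = int K"
      by (simp add: E_def algebra_simps)
    finally obtain P where P: "P \<noteq> 0" "degree P \<le> n"
      and Pb: "\<And>i. i \<le> n \<Longrightarrow> laurent_abs (coeff (taylor \<xi> P) i) \<le> ?q powi b i"
      using K[of b] by auto
    have mD: "int (m - D) = int m - int D" using mE by (simp add: of_nat_diff)
    have b_le: "b i \<le> int (m - D)" for i
    proof (cases "i = 0")
      case True
      have "0 \<le> int n * int m" by simp
      moreover have "b i = int E - int n * int m" using True by (simp add: b_def)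
      ultimately show ?thesis using mD mE by linarith
    qed (simp add: b_def mD)
    have c_le: "laurent_abs (coeff (taylor \<xi> P) i) \<le> ?q ^ (m - D)" for i
    proof (cases "i \<le> n")
      case True
      have "?q powi b i \<le> ?q powi int (m - D)" using b_le[of i] by (simp only: powi_card_le_iff)
      with Pb[OF True] show ?thesis by simp
    next
      case False
      then show ?thesis using degree_taylor_le[of \<xi> P] P(2) by (simp add: coeff_eq_0)
    qed
    have "height P \<le> (?q ^ N) ^ n * ?q ^ (m - D)"
      by (rule height_le_taylor[OF c_le N]) (use P q in \<open>auto intro: one_le_power\<close>)
    also have "\<dots> = ?q ^ m"
      using mE by (simp add: D_def flip: power_mult power_add)
    finally have "height P \<le> H" using m(1) by linarith
    moreover have "laurent_abs (eval_over poly_T P \<xi>) < H powr (- v)"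
    proof -
      have "laurent_abs (eval_over poly_T P \<xi>) \<le> ?q powi (int E - int n * int m)"
        using Pb[of 0] by (simp add: b_def coeff_taylor_0)
      also have "\<dots> = ?q ^ E / (?q ^ m) ^ n"
        using q by (simp add: power_int_diff mult.commute flip: power_mult of_nat_mult)
      also have "\<dots> \<le> ?q ^ E / (H / ?q) ^ n"
        using m(2) HH(1) q by (intro divide_left_mono power_mono mult_pos_pos zero_less_power)
          (auto simp: field_simps)
      also have "\<dots> = C / H ^ n"
        using q by (simp add: C_def power_add power_divide)
      also have "\<dots> = (C * H powr (- (real n - v))) * H powr (- v)"
      proof -
        have "H powr (- (real n - v)) * H powr (- v) = H powr (- real n)"
          by (simp flip: powr_add)
        also have "\<dots> = inverse (H ^ n)"
          using HH(1) by (simp add: powr_minus powr_realpow)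
        finally show ?thesis by (simp add: divide_inverse mult.assoc)
      qed
      also have "\<dots> < 1 * H powr (- v)"
        using H1[OF HH(2)] HH(1) by (intro mult_strict_right_mono) auto
      finally show ?thesis by simp
    qed
    ultimately show ?thesis
      using P eval_over_neq_0[OF \<xi> P] by auto
  qed
  ultimately show ?thesis by blast
qed

lemma w_hat_exp_ge:
  assumes "\<not> algebraic_deg_le poly_T n \<xi>"
  shows "ereal (real n) \<le> w_hat_exp n \<xi>"
proof (rule ereal_leI_real)
  fix v assume "v < real n"
  from dirichlet_polynomials[OF assms this] show "ereal v \<le> w_hat_exp n \<xi>"
    unfolding w_hat_exp_def by (intro Sup_upper imageI CollectI) blast
qed

lemma w_exp_ge:
  assumes \<xi>: "\<not> algebraic_deg_le poly_T n \<xi>" and n: "n \<ge> 1"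
  shows "ereal (real n) \<le> w_exp n \<xi>"
proof (rule ereal_leI_real)
  fix v0 assume "v0 < real n"
  \<comment> \<open>A positive \<open>v\<close> makes \<open>H powr (- v)\<close> tend to 0, which
    gives infinitely many polynomials, and lets \<open>H\<close> be replaced by the smaller
    height.\<close>
  define v where "v = max v0 (real n / 2)"
  have v: "v > 0" "v < real n" "v0 \<le> v"
    using \<open>v0 < real n\<close> n by (auto simp: v_def)
  have "ereal v \<le> w_exp n \<xi>"
    unfolding w_exp_def
  proof (rule Sup_upper, rule imageI, rule CollectI,
      rule infinite_of_small_values[where f = "\<lambda>P. laurent_abs (eval_over poly_T P \<xi>)"])
    fix \<epsilon> :: real assume "\<epsilon> > 0"
    obtain H0 where H0: "H0 \<ge> 1" "\<And>H. H > H0 \<Longrightarrow> \<exists>P. degree P \<le> n \<and> height P \<le> H \<and>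
      0 < laurent_abs (eval_over poly_T P \<xi>) \<and> laurent_abs (eval_over poly_T P \<xi>) < H powr (- v)"
      using dirichlet_polynomials[OF \<xi> v(2)] by auto
    have "((\<lambda>H :: real. H powr (- v)) \<longlongrightarrow> 0) at_top"
      using v by (intro tendsto_neg_powr filterlim_ident) auto
    then have "\<forall>\<^sub>F H in at_top. H powr (- v) < \<epsilon>"
      by (rule order_tendstoD) fact
    then obtain H1 where H1: "\<And>H. H \<ge> H1 \<Longrightarrow> H powr (- v) < \<epsilon>"
      by (auto simp: eventually_at_top_linorder)
    define H where "H = max H1 (H0 + 1)"
    have H: "H > H0" "H \<ge> H1" by (auto simp: H_def)
    obtain P where P: "degree P \<le> n" "height P \<le> H" "0 < laurent_abs (eval_over poly_T P \<xi>)"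
      "laurent_abs (eval_over poly_T P \<xi>) < H powr (- v)"
      using H0(2)[OF H(1)] by blast
    have "P \<noteq> 0" using P(3) by auto
    then have "H powr (- v) \<le> height P powr (- v)"
      using P(2) v height_ge_1[of P] by (intro powr_mono2') auto
    then show "\<exists>P\<in>{P. degree P \<le> n \<and> 0 < laurent_abs (eval_over poly_T P \<xi>) \<and>
        laurent_abs (eval_over poly_T P \<xi>) < height P powr - v}.
        0 < laurent_abs (eval_over poly_T P \<xi>) \<and> laurent_abs (eval_over poly_T P \<xi>) < \<epsilon>"
      using P H1[OF H(2)] by (intro bexI[of _ P]) auto
  qed
  with v(3) show "ereal v0 \<le> w_exp n \<xi>" by (meson ereal_less_eq(3) order_trans)
qed

text \<open>Above the exponent only finitely many polynomials violate the bound with constant 1;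
  \<open>c\<close> is the minimum of 1 and their ratios.\<close>

lemma w_exp_lower_bound:
  fixes \<xi> :: "'a::{field,finite} fls"
  assumes \<xi>: "\<not> algebraic_deg_le poly_T n \<xi>" and w: "w_exp n \<xi> < ereal w"
  shows "\<exists>c>0. \<forall>P. P \<noteq> 0 \<longrightarrow> degree P \<le> n \<longrightarrow>
    c * height P powr (- w) \<le> laurent_abs (eval_over poly_T P \<xi>)"
proof -
  let ?e = "\<lambda>P. laurent_abs (eval_over poly_T P \<xi>)"
  define S where "S = {P. degree P \<le> n \<and> 0 < ?e P \<and> ?e P < height P powr (- w)}"
  have "finite S"
  proof (rule ccontr)
    assume "infinite S"
    then have "ereal w \<le> w_exp n \<xi>"
      unfolding w_exp_def S_def by (intro Sup_upper imageI CollectI)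
    with w show False by simp
  qed
  define A where "A = insert 1 ((\<lambda>P. ?e P * height P powr w) ` S)"
  have fin: "finite A" using \<open>finite S\<close> by (simp add: A_def)
  have pos: "height P > 0" if "P \<noteq> 0" for P :: "'a poly poly"
    using height_ge_1[OF that] by linarith
  have "Min A \<in> A" by (rule Min_in[OF fin]) (simp add: A_def)
  moreover have "y > 0" if "y \<in> A" for y
  proof (cases "y = 1")
    case False
    with that obtain P where P: "P \<in> S" "y = ?e P * height P powr w" by (auto simp: A_def)
    then have "0 < ?e P" "P \<noteq> 0" by (auto simp: S_def)
    with pos[of P] P(2) show ?thesis by simp
  qed simp
  ultimately have c0: "Min A > 0" by blast
  have "Min A * height P powr (- w) \<le> ?e P" if P: "P \<noteq> 0" "degree P \<le> n" for P
  proof (cases "P \<in> S")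
    case True
    then have "Min A \<le> ?e P * height P powr w"
      by (intro Min_le[OF fin]) (simp add: A_def)
    then have "Min A * height P powr (- w) \<le> (?e P * height P powr w) * height P powr (- w)"
      by (intro mult_right_mono) auto
    also have "\<dots> = ?e P"
      using pos[OF P(1)] by (simp add: powr_minus)
    finally show ?thesis .
  next
    case False
    have "0 < ?e P" using eval_over_neq_0[OF \<xi> P] by simp
    with False P have "height P powr (- w) \<le> ?e P" by (auto simp: S_def)
    moreover have "Min A \<le> 1" by (rule Min_le[OF fin]) (simp add: A_def)
    then have "Min A * height P powr (- w) \<le> 1 * height P powr (- w)"
      by (intro mult_right_mono) auto
    ultimately show ?thesis by linarith
  qed
  with c0 show ?thesis by blast
qed

text \<open>The lower bounds hold only strictly above the exponent. A strict inequality survives a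
  small common increase of \<open>w\<close> and \<open>s = w - n + 1\<close>.\<close>

lemma exponent_perturbation:
  fixes v w s :: real
  assumes "v * s < w"
  shows "\<exists>w'>w. v * (s + (w' - w)) < w'"
proof -
  define \<delta> where "\<delta> = (w - v * s) / (\<bar>v\<bar> + 1)"
  have \<delta>: "\<delta> > 0" using assms by (simp add: \<delta>_def)
  have "v * \<delta> \<le> \<bar>v\<bar> * \<delta>" using \<delta> by (intro mult_right_mono) auto
  also have "\<dots> < (\<bar>v\<bar> + 1) * \<delta>" using \<delta> by simp
  also have "\<dots> = w - v * s" by (simp add: \<delta>_def)
  finally have "v * (s + \<delta>) < w + \<delta>" using \<delta> by (simp add: distrib_left)
  with \<delta> show ?thesis by (intro exI[of _ "w + \<delta>"]) simp
qed

lemma exp_quotient_ereal: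
  assumes "real n \<le> w"
  shows "exp_quotient n (ereal w) = ereal (w / (w - real n + 1))"
  using assms by (simp add: exp_quotient_def one_ereal_def)

section \<open>The three inequalities\<close>

lemma w_star_exp_ge_1:
  fixes \<xi> :: "'a::{field,finite} fls"
  assumes "n \<ge> 1" and "\<not> algebraic_deg_le poly_T n \<xi>"
  shows "1 \<le> w_star_exp n \<xi>"
proof -
  obtain C where C: "C > 0" "\<And>m :: nat. good_approximation n \<xi> C 1 1 (real CARD('a) ^ m)"
    using good_approximation_linear[OF assms] by auto
  have ge: "ereal v \<le> w_star_exp n \<xi>" if "0 \<le> v" "v < 1" for v
    by (rule w_star_exp_ge_of_good_approximation[of C 1 v 1]) (use C that in auto)
  have "ereal 1 \<le> w_star_exp n \<xi>"
  proof (rule ereal_leI_real)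
    fix v :: real assume "v < 1"
    then have "ereal (max v 0) \<le> w_star_exp n \<xi>" by (intro ge) auto
    then show "ereal v \<le> w_star_exp n \<xi>" by (meson ereal_less_eq(3) max.cobounded1 order_trans)
  qed
  then show ?thesis by (simp add: one_ereal_def)
qed

lemma (in completed_alg_closure) w_hat_at_exp_ge_1:
  assumes "n \<ge> 1" and "\<not> algebraic_deg_le poly_T n \<xi>"
  shows "1 \<le> w_hat_at_exp emb absC n \<xi>"
proof -
  obtain C where C: "C > 0" "\<And>m :: nat. good_approximation n \<xi> C 1 1 (real CARD('a) ^ m)"
    using good_approximation_linear[OF assms] by auto
  have "ereal 1 \<le> w_hat_at_exp emb absC n \<xi>"
  proof (rule ereal_leI_real)
    fix v :: real assume "v < 1"
    then show "ereal v \<le> w_hat_at_exp emb absC n \<xi>"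
      by (intro w_hat_at_exp_ge_of_good_approximation[of C 1 v 1 0]) (use C in auto)
  qed
  then show ?thesis by (simp add: one_ereal_def)
qed

lemma (in completed_alg_closure) w_hat_at_exp_ge_exp_quotient:
  assumes n: "n \<ge> 1" and \<xi>: "\<not> algebraic_deg_le poly_T n \<xi>"
  shows "exp_quotient n (w_exp n \<xi>) \<le> w_hat_at_exp emb absC n \<xi>"
proof (cases "w_exp n \<xi>")
  case PInf
  then show ?thesis using w_hat_at_exp_ge_1[OF assms] by (simp add: exp_quotient_def)
next
  case MInf
  then show ?thesis using w_exp_ge[OF \<xi> n] by simp
next
  case (real w0)
  let ?q = "real CARD('a)"
  have q: "?q > 1" by (rule card_field_gt_1)
  have w0: "real n \<le> w0" using w_exp_ge[OF \<xi> n] real by simp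
  obtain K :: nat where K: "\<forall>w c. w \<ge> real n \<longrightarrow> c > 0 \<longrightarrow> (\<exists>C>0. \<forall>m :: nat.
    (\<forall>P. P \<noteq> 0 \<longrightarrow> degree P \<le> n \<longrightarrow> height P \<le> ?q ^ (m + K) \<longrightarrow>
      c * (?q ^ (m + K)) powr (- w) \<le> laurent_abs (eval_over poly_T P \<xi>)) \<longrightarrow>
    good_approximation n \<xi> C (w - real n + 1) w (?q ^ m))"
    using good_approximation_of_lower_bound[OF assms] by (rule exE)
  have "ereal (w0 / (w0 - real n + 1)) \<le> w_hat_at_exp emb absC n \<xi>"
  proof (rule ereal_leI_real)
    fix v assume "v < w0 / (w0 - real n + 1)"
    then have "v * (w0 - real n + 1) < w0" using w0 by (simp add: field_simps)
    then obtain w where w: "w > w0" "v * ((w0 - real n + 1) + (w - w0)) < w"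
      using exponent_perturbation by blast
    then have vw: "v * (w - real n + 1) < w" by (simp add: algebra_simps)
    have wn: "w \<ge> real n" using w w0 by simp
    have less: "w_exp n \<xi> < ereal w" using real w by simp
    then obtain c where c: "c > 0" and lower: "\<And>P. P \<noteq> 0 \<Longrightarrow> degree P \<le> n \<Longrightarrow>
      c * height P powr (- w) \<le> laurent_abs (eval_over poly_T P \<xi>)"
      using w_exp_lower_bound[OF \<xi> less] by auto
    obtain C where C: "C > 0" and good: "\<forall>m :: nat.
      (\<forall>P. P \<noteq> 0 \<longrightarrow> degree P \<le> n \<longrightarrow> height P \<le> ?q ^ (m + K) \<longrightarrow>
        c * (?q ^ (m + K)) powr (- w) \<le> laurent_abs (eval_over poly_T P \<xi>)) \<longrightarrow>
      good_approximation n \<xi> C (w - real n + 1) w (?q ^ m)"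
      using K[rule_format, OF wn c] by (rule exE) (erule conjE, rule that)
    have "good_approximation n \<xi> C (w - real n + 1) w (?q ^ m)" for m
    proof (rule good[THEN spec, THEN mp], intro allI impI)
      fix P :: "'a poly poly" assume P: "P \<noteq> 0" "degree P \<le> n" "height P \<le> ?q ^ (m + K)"
      have "(?q ^ (m + K)) powr (- w) \<le> height P powr (- w)"
        using P height_ge_1[OF P(1)] wn by (intro powr_mono2') auto
      with c have "c * (?q ^ (m + K)) powr (- w) \<le> c * height P powr (- w)" by simp
      with lower[OF P(1,2)] show "c * (?q ^ (m + K)) powr (- w) \<le> laurent_abs (eval_over poly_T P \<xi>)"
        by linarith
    qed
    then show "ereal v \<le> w_hat_at_exp emb absC n \<xi>"
      by (intro w_hat_at_exp_ge_of_good_approximation[OF C _ vw, of 0]) (use wn n in auto)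
  qed
  then show ?thesis using exp_quotient_ereal[OF w0] real by simp
qed

lemma w_star_exp_ge_exp_quotient:
  fixes \<xi> :: "'a::{field,finite} fls"
  assumes n: "n \<ge> 1" and \<xi>: "\<not> algebraic_deg_le poly_T n \<xi>"
  shows "exp_quotient n (w_hat_exp n \<xi>) \<le> w_star_exp n \<xi>"
proof (cases "w_hat_exp n \<xi>")
  case PInf
  then show ?thesis using w_star_exp_ge_1[OF assms] by (simp add: exp_quotient_def)
next
  case MInf
  then show ?thesis using w_hat_exp_ge[OF \<xi>] by simp
next
  case (real w0)
  let ?q = "real CARD('a)"
  have q: "?q > 1" by (rule card_field_gt_1)
  have w0: "real n \<le> w0" using w_hat_exp_ge[OF \<xi>] real by simp
  obtain K :: nat where K: "\<forall>w c. w \<ge> real n \<longrightarrow> c > 0 \<longrightarrow> (\<exists>C>0. \<forall>m :: nat.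
    (\<forall>P. P \<noteq> 0 \<longrightarrow> degree P \<le> n \<longrightarrow> height P \<le> ?q ^ (m + K) \<longrightarrow>
      c * (?q ^ (m + K)) powr (- w) \<le> laurent_abs (eval_over poly_T P \<xi>)) \<longrightarrow>
    good_approximation n \<xi> C (w - real n + 1) w (?q ^ m))"
    using good_approximation_of_lower_bound[OF assms] by (rule exE)
  have ge: "ereal v \<le> w_star_exp n \<xi>" if v: "v \<ge> 0" "v < w0 / (w0 - real n + 1)" for v
  proof -
    have "v * (w0 - real n + 1) < w0" using v w0 by (simp add: field_simps)
    then obtain w where w: "w > w0" "v * ((w0 - real n + 1) + (w - w0)) < w"
      using exponent_perturbation by blast
    then have vw: "v * (w - real n + 1) < w" by (simp add: algebra_simps)
    have wn: "w \<ge> real n" using w w0 by simp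
    \<comment> \<open>Above the uniform exponent, the lower bound holds for arbitrarily large
      \<open>H\<close>, though perhaps not for all. This suffices for the starred exponent.\<close>
    have often: "\<exists>H>H0. \<forall>P. degree P \<le> n \<longrightarrow> height P \<le> H \<longrightarrow> P \<noteq> 0 \<longrightarrow>
      H powr (- w) \<le> laurent_abs (eval_over poly_T P \<xi>)" for H0
    proof (rule ccontr)
      assume *: "\<not> ?thesis"
      have "\<forall>H>H0. \<exists>P. degree P \<le> n \<and> height P \<le> H \<and>
        0 < laurent_abs (eval_over poly_T P \<xi>) \<and> laurent_abs (eval_over poly_T P \<xi>) < H powr (- w)"
      proof (intro allI impI)
        fix H assume "H > H0"
        with * obtain P where "degree P \<le> n" "height P \<le> H" "P \<noteq> 0"
          "laurent_abs (eval_over poly_T P \<xi>) < H powr (- w)"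
          by (meson not_le)
        with eval_over_neq_0[OF \<xi>, of P] show "\<exists>P. degree P \<le> n \<and> height P \<le> H \<and>
          0 < laurent_abs (eval_over poly_T P \<xi>) \<and> laurent_abs (eval_over poly_T P \<xi>) < H powr (- w)"
          by (intro exI[of _ P]) simp
      qed
      then have "ereal w \<le> w_hat_exp n \<xi>"
        unfolding w_hat_exp_def by (intro Sup_upper imageI CollectI) blast
      with real w show False by simp
    qed
    \<comment> \<open>The price of replacing \<open>H\<close> by the power \<open>q ^ m'\<close>
      with \<open>H < q ^ Suc m'\<close>.\<close>
    define c where "c = ?q powr (- w)"
    have c: "c > 0" using q by (simp add: c_def)
    obtain C where C: "C > 0" and good: "\<forall>m :: nat.
      (\<forall>P. P \<noteq> 0 \<longrightarrow> degree P \<le> n \<longrightarrow> height P \<le> ?q ^ (m + K) \<longrightarrow>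
        c * (?q ^ (m + K)) powr (- w) \<le> laurent_abs (eval_over poly_T P \<xi>)) \<longrightarrow>
      good_approximation n \<xi> C (w - real n + 1) w (?q ^ m)"
      using K[rule_format, OF wn c] by (rule exE) (erule conjE, rule that)
    have "\<exists>m\<ge>M. good_approximation n \<xi> C (w - real n + 1) w (?q ^ m)" for M
    proof -
      obtain H where H: "H > ?q ^ (M + K)" and lower: "\<And>P. degree P \<le> n \<Longrightarrow> height P \<le> H \<Longrightarrow> P \<noteq> 0 \<Longrightarrow>
        H powr (- w) \<le> laurent_abs (eval_over poly_T P \<xi>)"
        using often[of "?q ^ (M + K)"] by auto
      have "?q ^ (M + K) \<ge> 1" using q by (intro one_le_power) auto
      with H have H1: "H \<ge> 1" by linarith
      obtain m' where m': "?q ^ m' \<le> H" "H < ?q ^ Suc m'"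
        using ex_power_bracket[OF q H1] by blast
      have "?q ^ (M + K) < ?q ^ Suc m'" using H m'(2) by linarith
      then have "M + K < Suc m'" using q by (rule power_less_imp_less_exp[rotated])
      then obtain m where m: "m' = m + K" "m \<ge> M"
        by (metis add.commute add_le_imp_le_right le_add_diff_inverse less_Suc_eq_le le_trans le_add2)
      have "good_approximation n \<xi> C (w - real n + 1) w (?q ^ m)"
      proof (rule good[THEN spec, THEN mp], intro allI impI)
        fix P :: "'a poly poly" assume P: "P \<noteq> 0" "degree P \<le> n" "height P \<le> ?q ^ (m + K)"
        have "c * (?q ^ (m + K)) powr (- w) = (?q * ?q ^ m') powr (- w)"
          unfolding c_def m using q by (subst powr_mult) auto
        also have "\<dots> \<le> H powr (- w)"
          using m'(2) H1 wn by (intro powr_mono2') auto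
        also have "\<dots> \<le> laurent_abs (eval_over poly_T P \<xi>)"
          using P m'(1) m by (intro lower) auto
        finally show "c * (?q ^ (m + K)) powr (- w) \<le> laurent_abs (eval_over poly_T P \<xi>)" .
      qed
      with m show ?thesis by blast
    qed
    then show ?thesis
      by (intro w_star_exp_ge_of_good_approximation[OF C _ v(1) vw]) (use wn n in auto)
  qed
  have "w0 / (w0 - real n + 1) > 0" using w0 n by simp
  have "ereal (w0 / (w0 - real n + 1)) \<le> w_star_exp n \<xi>"
  proof (rule ereal_leI_real)
    fix v assume "v < w0 / (w0 - real n + 1)"
    with \<open>w0 / (w0 - real n + 1) > 0\<close> have "ereal (max v 0) \<le> w_star_exp n \<xi>" by (intro ge) auto
    then show "ereal v \<le> w_star_exp n \<xi>" by (meson ereal_less_eq(3) max.cobounded1 order_trans)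
  qed
  then show ?thesis using exp_quotient_ereal[OF w0] real by simp
qed

text \<open>The descent replaces \<alpha> by a Laurent series \<beta>, with the bounds on height and
  distance replaced by their p^s-th roots. So the exponent is kept, and the constant
  \<open>D\<close> is absorbed by the gap between \<open>v\<close> and \<open>w\<close>.\<close>

lemma (in completed_alg_closure) w_hat_at_exp_le_w_star_exp:
  assumes n: "n \<ge> 1" and \<xi>: "\<not> algebraic_deg_le poly_T n \<xi>"
  shows "w_hat_at_exp emb absC n \<xi> \<le> w_star_exp n \<xi>"
  unfolding w_hat_at_exp_def
proof (rule Sup_least, elim imageE CollectE exE, hypsubst)
  fix w H0 :: real
  assume *: "\<forall>H>H0. \<exists>\<alpha>. algebraic_deg_le embT n \<alpha> \<and> alg_height embT \<alpha> \<le> H \<and>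
    0 < absC (emb (to_ac \<xi>) - \<alpha>) \<and>
    absC (emb (to_ac \<xi>) - \<alpha>) < inverse (alg_height embT \<alpha>) * H powr (- w)"
  let ?p = "CHAR('a)"
  have p1: "?p \<ge> 1" using prime_CHAR_finite_field[where 'a='a] by (simp add: prime_gt_0_nat Suc_leI)
  obtain D where D: "D \<ge> 1" and descent: "\<And>P \<rho> k. degree P \<le> n \<Longrightarrow> 0 < \<rho> \<Longrightarrow> D * \<rho> \<le> 1 \<Longrightarrow> 1 \<le> k \<Longrightarrow>
    coeff (taylor \<xi> P) k \<noteq> 0 \<Longrightarrow>
    laurent_abs (coeff (taylor \<xi> P) 0) \<le> laurent_abs (coeff (taylor \<xi> P) k) * \<rho> ^ k \<Longrightarrow>
    \<exists>Q \<beta> s. Q \<noteq> 0 \<and> degree Q \<le> n \<and> eval_over poly_T Q \<beta> = 0 \<and> s \<le> n \<and>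
      height Q ^ (?p ^ s) \<le> height P \<and> laurent_abs (\<xi> - \<beta>) ^ (?p ^ s) \<le> D * \<rho>"
    using near_root_descent[of n \<xi>] by auto
  have ge: "ereal v \<le> w_star_exp n \<xi>" if v: "v \<ge> 0" "v < w" for v
  proof (rule w_star_exp_geI)
    fix \<epsilon> :: real assume \<epsilon>: "\<epsilon> > 0"
    \<comment> \<open>Since \<open>s\<close> is at most \<open>n\<close>, a p^s-th root of a number
      below \<epsilon>' is still below \<epsilon>.\<close>
    define \<epsilon>' where "\<epsilon>' = min \<epsilon> 1 ^ (?p ^ n)"
    have \<epsilon>': "\<epsilon>' > 0" "\<epsilon>' \<le> 1" using \<epsilon> by (auto simp: \<epsilon>'_def power_le_one)
    have "((\<lambda>H :: real. D * H powr (- (w - v))) \<longlongrightarrow> 0) at_top"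
      using v by (intro tendsto_mult_right_zero tendsto_neg_powr filterlim_ident) auto
    then have "\<forall>\<^sub>F H in at_top. D * H powr (- (w - v)) < \<epsilon>'"
      by (rule order_tendstoD) fact
    then obtain H1 where H1: "\<And>H. H \<ge> H1 \<Longrightarrow> D * H powr (- (w - v)) < \<epsilon>'"
      by (auto simp: eventually_at_top_linorder)
    define H where "H = max H1 (max (H0 + 1) 1)"
    have H: "H > H0" "H \<ge> H1" "H \<ge> 1" by (auto simp: H_def)
    obtain \<alpha> where \<alpha>: "algebraic_deg_le embT n \<alpha>" and h: "alg_height embT \<alpha> \<le> H"
      and d0: "0 < absC (emb (to_ac \<xi>) - \<alpha>)"
      and d: "absC (emb (to_ac \<xi>) - \<alpha>) < inverse (alg_height embT \<alpha>) * H powr (- w)"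
      using * H(1) by blast
    let ?h = "alg_height embT \<alpha>"
    define \<rho> where "\<rho> = absC (emb (to_ac \<xi>) - \<alpha>)"
    obtain P where P: "P \<noteq> 0" "eval_over embT P \<alpha> = 0" "degree P \<le> n" "height P = ?h"
      using C.algebraic_deg_leE[OF \<alpha>] .
    have h1: "?h \<ge> 1" by (rule C.alg_height_ge_1[OF \<alpha>])
    have "D * \<rho> \<le> D * (inverse ?h * H powr (- w))"
      using d D by (intro mult_left_mono) (auto simp: \<rho>_def)
    \<comment> \<open>One part of the power of \<open>H\<close> beats \<open>D\<close>; the other is
      weakened to a power of the height of \<alpha>, which uses \<open>v \<ge> 0\<close>.\<close>
    also have "\<dots> = inverse ?h * H powr (- v) * (D * H powr (- (w - v)))"
      using H(3) by (simp add: powr_add[symmetric])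
    also have "\<dots> < inverse ?h * H powr (- v) * \<epsilon>'"
      using H1[OF H(2)] H(3) h1 by (intro mult_strict_left_mono) auto
    also have "\<dots> \<le> inverse ?h * ?h powr (- v) * \<epsilon>'"
      using h h1 v \<epsilon>' by (intro mult_right_mono mult_left_mono powr_mono2') auto
    also have "inverse ?h * ?h powr (- v) = ?h powr (- v - 1)"
      using h1 by (simp add: powr_diff divide_inverse)
    finally have D\<rho>: "D * \<rho> < ?h powr (- v - 1) * \<epsilon>'" .
    have hv: "?h powr (- v - 1) \<le> 1"
      using h1 v powr_mono[of "- v - 1" 0 ?h] by simp
    have "?h powr (- v - 1) * \<epsilon>' \<le> 1 * \<epsilon>'" using hv \<epsilon>' by (intro mult_right_mono) auto
    with D\<rho> have D\<epsilon>: "D * \<rho> < \<epsilon>'" by linarith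
    have "?h powr (- v - 1) * \<epsilon>' \<le> ?h powr (- v - 1) * 1" using \<epsilon>' by (intro mult_left_mono) auto
    with D\<rho> have Dh: "D * \<rho> < ?h powr (- v - 1)" by linarith
    have D1: "D * \<rho> \<le> 1" using D\<epsilon> \<epsilon>' by linarith
    obtain k where k: "1 \<le> k" "coeff (taylor \<xi> P) k \<noteq> 0"
      "laurent_abs (coeff (taylor \<xi> P) 0) \<le> laurent_abs (coeff (taylor \<xi> P) k) * \<rho> ^ k"
      using near_root_taylor[OF P(2) eval_over_neq_0[OF \<xi> P(1,3)]] unfolding \<rho>_def by auto
    have "0 < \<rho>" using d0 by (simp add: \<rho>_def)
    obtain Q \<beta> s where Q: "Q \<noteq> 0" "degree Q \<le> n" "eval_over poly_T Q \<beta> = 0" and s: "s \<le> n"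
      and hQ: "height Q ^ (?p ^ s) \<le> height P" and cl: "laurent_abs (\<xi> - \<beta>) ^ (?p ^ s) \<le> D * \<rho>"
      using descent[OF P(3) \<open>0 < \<rho>\<close> D1 k] by blast
    let ?N = "?p ^ s"
    have N: "?N > 0" "?N \<le> ?p ^ n" using p1 s by (auto intro: power_increasing)
    have \<beta>: "algebraic_deg_le poly_T n \<beta>" using Q by (intro base.algebraic_deg_leI)
    then have "\<xi> \<noteq> \<beta>" using \<xi> by auto
    let ?h' = "alg_height poly_T \<beta>"
    have h'1: "?h' \<ge> 1" by (rule base.alg_height_ge_1[OF \<beta>])
    have "?h' ^ ?N \<le> height Q ^ ?N"
      using base.alg_height_le[OF Q(1,3)] h'1 by (intro power_mono) auto
    with hQ P(4) have hh: "?h' ^ ?N \<le> ?h" by linarith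
    have "laurent_abs (\<xi> - \<beta>) < \<epsilon>"
    proof -
      have "laurent_abs (\<xi> - \<beta>) ^ ?N < min \<epsilon> 1 ^ (?p ^ n)"
        using cl D\<epsilon> unfolding \<epsilon>'_def by linarith
      also have "\<dots> \<le> min \<epsilon> 1 ^ ?N"
        by (rule power_decreasing[OF N(2)]) (use \<epsilon> in auto)
      finally have "laurent_abs (\<xi> - \<beta>) < min \<epsilon> 1"
        by (rule power_less_imp_less_base) (use \<epsilon> in auto)
      then show ?thesis by simp
    qed
    moreover have "laurent_abs (\<xi> - \<beta>) < ?h' powr (- v - 1)"
    proof -
      have "laurent_abs (\<xi> - \<beta>) ^ ?N < ?h powr (- v - 1)"
        using cl Dh by linarith
      also have "\<dots> \<le> (?h' ^ ?N) powr (- v - 1)"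
        using hh h'1 v by (intro powr_mono2') auto
      also have "\<dots> = (?h' powr (- v - 1)) ^ ?N"
        using h'1 by (simp add: powr_realpow[symmetric] powr_powr mult.commute)
      finally show ?thesis
        by (rule power_less_imp_less_base) auto
    qed
    ultimately show "\<exists>\<alpha>. algebraic_deg_le poly_T n \<alpha> \<and> 0 < laurent_abs (\<xi> - \<alpha>) \<and>
      laurent_abs (\<xi> - \<alpha>) < \<epsilon> \<and> laurent_abs (\<xi> - \<alpha>) < alg_height poly_T \<alpha> powr (- v - 1)"
      using \<beta> \<open>\<xi> \<noteq> \<beta>\<close> by auto
  qed
  show "ereal w \<le> w_star_exp n \<xi>"
  proof (rule ereal_leI_real)
    fix v assume vw: "v < w"
    show "ereal v \<le> w_star_exp n \<xi>"
    \<comment> \<open>Negative \<open>v\<close> are covered by the rational approximations, which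
      make the starred exponent at least 1.\<close>
    proof (cases "v \<ge> 0")
      case True
      with vw show ?thesis by (intro ge)
    next
      case False
      then have "ereal v \<le> 1" by (simp add: one_ereal_def)
      with w_star_exp_ge_1[OF n \<xi>] show ?thesis by (rule order_trans[rotated])
    qed
  qed
qed

theorem theorem2p3:
  fixes p k q n :: nat
    and emb :: "'a::{field,finite} fls alg_closure \<Rightarrow> 'c::field"
    and absC :: "'c \<Rightarrow> real"
    and \<xi> :: "'a fls"
  assumes "prime p" and "k \<ge> 1" and "q = p ^ k" and "CARD('a) = q"
    and "n \<ge> 1"
    and "completed_alg_closure emb absC"
    and "\<not> algebraic_deg_le poly_T n \<xi>"
  shows "w_star_exp n \<xi> \<ge> w_hat_at_exp emb absC n \<xi> \<and>
         w_hat_at_exp emb absC n \<xi> \<ge> exp_quotient n (w_exp n \<xi>) \<and>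
         w_star_exp n \<xi> \<ge> exp_quotient n (w_hat_exp n \<xi>)"
proof -
  interpret completed_alg_closure emb absC by fact
  show ?thesis
    using w_hat_at_exp_le_w_star_exp w_hat_at_exp_ge_exp_quotient w_star_exp_ge_exp_quotient assms(5,7)
    by blast
qed

end
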